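(* Let $\rho'_{n,C_i}$ denote the derivative of the cost function $\rho_n$ with respect to the weight $C_i$, and let $\alpha_n^i,\beta_n^i$ be the detection and estimation errors of the optimal policy $\pi_C^\star$. Then, for $0\le n\le N$, $$\rho'_{n,C_i}(\mathbf{t}_n)=p(\mathrm{H}_i)\,z_n^i\,\alpha_n^i(\mathbf{t}_n),\quad i\in\{0,1\},\qquad \rho'_{n,C_i}(\mathbf{t}_n)=p(\mathrm{H}_{i-2})\,z_n^{i-2}\,\beta_n^{i-2}(\mathbf{t}_n),\quad i\in\{2,3\},$$ and in particular $$\rho'_{0,C_i}(\mathbf{t}_0)=p(\mathrm{H}_i)\,\alpha_0^i(\mathbf{t}_0),\quad i\in\{0,1\},\qquad \rho'_{0,C_i}(\mathbf{t}_0)=p(\mathrm{H}_{i-2})\,\beta_0^{i-2}(\mathbf{t}_0),\quad i\in\{2,3\}.$$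
   Context: Model. A hypothesis $\mathrm{H}\in\{\mathrm{H}_0,\mathrm{H}_1\}$ is drawn with prior probabilities $p(\mathrm{H}_0),p(\mathrm{H}_1)$; given $\mathrm{H}_i$, a real random parameter $\Theta$ is drawn with density $p(\theta\mid \mathrm{H}_i)$; given $\Theta=\theta$, the observations $X_1,\dots,X_N$ (values in a state space $E_X$) are i.i.d. with density $p(x\mid\theta)$. The hypothesis and parameter do not change during observation. Write $\boldsymbol{x}_n=(x_1,\dots,x_n)$. Standing assumptions. $\mathbf{E}[\Theta^2]<\infty$. The hypotheses are separable: for some $i\in\{0,1\}$, $\lim_{N\to\infty}p(\mathrm{H}_i\mid\boldsymbol{x}_N)=1$. There is a sufficient statistic $\mathbf{t}_n=\mathbf{t}_n(\boldsymbol{x}_n)$ in a state space $E_{\mathbf t}$ with $p(\theta\mid\boldsymbol{x}_n)=p(\theta\mid\mathbf{t}_n)$, satisfying $\mathbf{t}_{n+1}=\xi(\mathbf{t}_n,x_{n+1})$ with a fixed initial value $\mathbf{t}_0$; in all conditional probabilities and expectations, conditioning on $\boldsymbol{x}_n$ can be replaced by conditioning on $\mathbf{t}_n$. The posterior probabilities $p(\mathrm{H}_i\mid\mathbf{t}_n)$ are continuous random variables, so that the boundary of the stopping region, $\{\mathbf{t}_n: g(\mathbf{t}_n)=1+\int\rho_{n+1}\,\mathrm{d}Q_{\mathbf{t}_n}\}$ ($n<N$), is a null set; the derivatives $\rho'_{n,C_i}$ are considered off this boundary. The horizon $N\ge1$ and the weights $C_0,\dots,C_3\ge0$ are finite. Notation.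 $Q_{\mathbf{t}_n}(B)=P(\{\tilde x\in E_X:\xi(\mathbf{t}_n,\tilde x)\in B\}\mid\mathbf{t}_n)$ for Borel $B\subseteq E_{\mathbf t}$ (conditional law of $\mathbf{t}_{n+1}$ given $\mathbf{t}_n$). $z_n^i=p(\mathbf{t}_n\mid\mathrm{H}_i)/p(\mathbf{t}_n)$ (so $z_0^i=1$). Cost functions. For $i\in\{0,1\}$, $D^\star_{i,n}(\mathbf{t}_n)=C_{1-i}\,p(\mathrm{H}_{1-i}\mid\mathbf{t}_n)+C_{2+i}\,p(\mathrm{H}_i\mid\mathbf{t}_n)\,\mathbf{Var}[\Theta\mid\mathbf{t}_n,\mathrm{H}_i]$; $g(\mathbf{t}_n)=\min\{D^\star_{0,n},D^\star_{1,n}\}$; $\rho_N(\mathbf{t}_N)=g(\mathbf{t}_N)$ and, for $n<N$, $\rho_n(\mathbf{t}_n)=\min\{g(\mathbf{t}_n),\,1+\int\rho_{n+1}\,\mathrm{d}Q_{\mathbf{t}_n}\}$. Optimal policy $\pi_C^\star$. Stopping rule $\Psi_n=\mathbf{1}_{\{\rho_n(\mathbf{t}_n)=g(\mathbf{t}_n)\}}$ (so $\Psi_N=1$); decision rule $\delta_n\in\{0,1\}$ with $\mathbf{1}_{\{D^\star_{0,n}>D^\star_{1,n}\}}\le\delta_n\le\mathbf{1}_{\{D^\star_{0,n}\ge D^\star_{1,n}\}}$; estimators $\hat\theta_{i,n}=\mathbf{E}[\Theta\mid\boldsymbol{x}_n,\mathrm{H}_i]$. Stopping time $\tau=\inf\{n:\Psi_n=1\}$.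 Performance measures. For $i\in\{0,1\}$, $\alpha_n^i(\mathbf{t}_n)=\mathbf{E}[\mathbf{1}_{\{\delta_\tau=1-i\}}\mid\mathbf{t}_n,\mathrm{H}_i,\tau\ge n]$ and $\beta_n^i(\mathbf{t}_n)=\mathbf{E}[\mathbf{1}_{\{\delta_\tau=i\}}(\hat\theta_{i,\tau}-\Theta)^2\mid\mathbf{t}_n,\mathrm{H}_i,\tau\ge n]$; equivalently, recursively, $\alpha_N^i(\mathbf{t}_N)=\mathbf{1}_{\{\delta_N=1-i\}}\Psi_N$, $\beta_N^i(\mathbf{t}_N)=\mathbf{E}[(\hat\theta_{i,N}-\Theta)^2\mid\mathbf{t}_N,\mathrm{H}_i]\mathbf{1}_{\{\delta_N=i\}}\Psi_N$, and for $n<N$ $$\alpha_n^i(\mathbf{t}_n)=\mathbf{1}_{\{\delta_n=1-i\}}\Psi_n+(1-\Psi_n)\mathbf{E}[\alpha_{n+1}^i(\mathbf{t}_{n+1})\mid\mathbf{t}_n,\mathrm{H}_i],$$ $$\beta_n^i(\mathbf{t}_n)=\mathbf{E}[(\hat\theta_{i,n}-\Theta)^2\mid\mathbf{t}_n,\mathrm{H}_i]\mathbf{1}_{\{\delta_n=i\}}\Psi_n+(1-\Psi_n)\mathbf{E}[\beta_{n+1}^i(\mathbf{t}_{n+1})\mid\mathbf{t}_n,\mathrm{H}_i].$$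
   Formalization: Added assumption: ties D*_0 = D*_1 inside the stopping region form a null set for each n ≤ N. Without it the claim fails: for C = 0 and δ = 1, the derivative in C_0 is 0 but p(H_0)α_0^0 = p(H_0) > 0. Both priors are taken positive. *)

theory Defs
  imports "HOL-Probability.Probability"
begin

text \<open>
  The function \<open>t \<mapsto> E[Y | T = t]\<close>. It is determined up to null sets of the law of \<open>T\<close>;
  \<open>SOME\<close> picks an arbitrary measurable version.
\<close>

definition cexp_given ::
  "'w measure \<Rightarrow> 't measure \<Rightarrow> ('w \<Rightarrow> 't) \<Rightarrow> ('w \<Rightarrow> real) \<Rightarrow> 't \<Rightarrow> real" where
  "cexp_given P E T Y = (SOME f. f \<in> borel_measurable E \<and>
     (AE w in P. f (T w) = real_cond_exp P (vimage_algebra (space P) T E) Y w))"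

text \<open>
  Hypotheses are coded as \<open>0, 1 :: nat\<close>, and the observations are \<open>Obs 1, Obs 2, \<dots>\<close>.
  The measure \<open>X_ref\<close> is the state space of the observations together with the measure
  with respect to which \<open>pdf_X\<close> is a density; densities of \<open>\<Theta>\<close> refer to Lebesgue measure.
  The measure \<open>T_space\<close> only serves as the measurable state space of the statistic.

  The last four fields are the objects of the model that are unique only up to null sets:
  a regular conditional distribution of the next observation given the current statistic, and
  densities \<open>p(t\<^sub>n)\<close>, \<open>p(t\<^sub>n | H\<^sub>i)\<close> with respect to a common measure (which may vary with \<open>n\<close>;
  for instance \<open>t\<^sub>0\<close> is deterministic). They are arbitrary subject to the assumptions below.
\<close>

record ('w, 'x, 't) seq_setup =
  Prob :: "'w measure"
  Hyp :: "'w \<Rightarrow> nat"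
  Theta :: "'w \<Rightarrow> real"
  Obs :: "nat \<Rightarrow> 'w \<Rightarrow> 'x"
  X_ref :: "'x measure"
  prior :: "nat \<Rightarrow> real"
  pdf_Theta :: "nat \<Rightarrow> real \<Rightarrow> real"
  pdf_X :: "real \<Rightarrow> 'x \<Rightarrow> real"
  T_space :: "'t measure"
  t_init :: 't
  t_step :: "'t \<Rightarrow> 'x \<Rightarrow> 't"
  next_law :: "nat \<Rightarrow> 't \<Rightarrow> 'x measure"
  T_ref :: "nat \<Rightarrow> 't measure"
  pdf_T :: "nat \<Rightarrow> 't \<Rightarrow> real"
  pdf_T_given :: "nat \<Rightarrow> nat \<Rightarrow> 't \<Rightarrow> real"

primrec stat :: "('w, 'x, 't) seq_setup \<Rightarrow> nat \<Rightarrow> 'w \<Rightarrow> 't" where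
  "stat S 0 w = t_init S"
| "stat S (Suc n) w = t_step S (stat S n w) (Obs S (Suc n) w)"

definition obs_upto :: "('w, 'x, 't) seq_setup \<Rightarrow> nat \<Rightarrow> 'w \<Rightarrow> nat \<Rightarrow> 'x" where
  "obs_upto S n w = (\<lambda>k\<in>{1..n}. Obs S k w)"

definition obs_alg :: "('w, 'x, 't) seq_setup \<Rightarrow> nat \<Rightarrow> 'w measure" where
  "obs_alg S n = vimage_algebra (space (Prob S)) (obs_upto S n) (PiM {1..n} (\<lambda>_. X_ref S))"

definition stat_alg :: "('w, 'x, 't) seq_setup \<Rightarrow> nat \<Rightarrow> 'w measure" where
  "stat_alg S n = vimage_algebra (space (Prob S)) (stat S n) (T_space S)"

definition hyp_event :: "('w, 'x, 't) seq_setup \<Rightarrow> nat \<Rightarrow> 'w set" where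
  "hyp_event S i = {w \<in> space (Prob S). Hyp S w = i}"

definition Prob_given :: "('w, 'x, 't) seq_setup \<Rightarrow> nat \<Rightarrow> 'w measure" where
  "Prob_given S i = uniform_measure (Prob S) (hyp_event S i)"

definition posterior :: "('w, 'x, 't) seq_setup \<Rightarrow> nat \<Rightarrow> nat \<Rightarrow> 't \<Rightarrow> real" where
  "posterior S i n =
     cexp_given (Prob S) (T_space S) (stat S n) (indicat_real (hyp_event S i))"

text \<open>
  In the assumptions, \<open>joint\<close> is the generative model: the joint density of
  \<open>(H, \<Theta>, X\<^sub>1, \<dots>, X\<^sub>n)\<close> is \<open>p(H\<^sub>i) p(\<theta> | H\<^sub>i) \<Prod>\<^sub>k p(x\<^sub>k | \<theta>)\<close>.

  \<open>sufficient\<close>: conditioning on \<open>x\<^sub>n\<close> can be replaced by conditioning on \<open>t\<^sub>n\<close> for every event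
  determined by the hypothesis, the parameter, the current statistic and the future observations;
  events about the parameter alone give \<open>p(\<theta> | x\<^sub>n) = p(\<theta> | t\<^sub>n)\<close>.

  \<open>separable\<close>: which of the two posterior probabilities tends to one depends on the sample path.

  \<open>posterior_continuous\<close>: the law of \<open>p(H\<^sub>i | t\<^sub>n)\<close> has no atoms. This is required for \<open>n \<ge> 1\<close>
  only, because \<open>p(H\<^sub>i | t\<^sub>0) = p(H\<^sub>i)\<close> is a constant.
\<close>

locale seq_model =
  fixes S :: "('w, 'x, 't) seq_setup" and N :: nat
  assumes prob: "prob_space (Prob S)"
    and horizon: "1 \<le> N"
    and X_ref: "sigma_finite_measure (X_ref S)"
    and prior_pos: "\<And>i. i \<in> {0, 1} \<Longrightarrow> 0 < prior S i"
    and prior_sum: "prior S 0 + prior S 1 = 1"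
    and pdf_Theta_measurable: "\<And>i. i \<in> {0, 1} \<Longrightarrow> pdf_Theta S i \<in> borel_measurable borel"
    and pdf_Theta_nonneg: "\<And>i \<theta>. i \<in> {0, 1} \<Longrightarrow> 0 \<le> pdf_Theta S i \<theta>"
    and pdf_Theta_integral:
      "\<And>i. i \<in> {0, 1} \<Longrightarrow> (\<integral>\<^sup>+ \<theta>. ennreal (pdf_Theta S i \<theta>) \<partial>lborel) = 1"
    and pdf_X_measurable:
      "(\<lambda>(\<theta>, x). pdf_X S \<theta> x) \<in> borel_measurable (borel \<Otimes>\<^sub>M X_ref S)"
    and pdf_X_nonneg: "\<And>\<theta> x. x \<in> space (X_ref S) \<Longrightarrow> 0 \<le> pdf_X S \<theta> x"
    and pdf_X_integral: "\<And>\<theta>. (\<integral>\<^sup>+ x. ennreal (pdf_X S \<theta> x) \<partial>X_ref S) = 1"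
    and joint: "\<And>n. distributed (Prob S)
        (count_space {0, 1} \<Otimes>\<^sub>M lborel \<Otimes>\<^sub>M PiM {1..n} (\<lambda>_. X_ref S))
        (\<lambda>w. (Hyp S w, Theta S w, obs_upto S n w))
        (\<lambda>(i, \<theta>, x). ennreal (prior S i * pdf_Theta S i \<theta> * (\<Prod>k\<in>{1..n}. pdf_X S \<theta> (x k))))"
    and second_moment: "integrable (Prob S) (\<lambda>w. (Theta S w)\<^sup>2)"
    and t_init: "t_init S \<in> space (T_space S)"
    and t_step: "(\<lambda>(t, x). t_step S t x) \<in> T_space S \<Otimes>\<^sub>M X_ref S \<rightarrow>\<^sub>M T_space S"
    and sufficient: "\<And>n A.
        A \<in> sets (count_space {0, 1} \<Otimes>\<^sub>M borel \<Otimes>\<^sub>M T_space S \<Otimes>\<^sub>M PiM {n<..} (\<lambda>_. X_ref S)) \<Longrightarrow>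
        (let B = {w \<in> space (Prob S).
                    (Hyp S w, Theta S w, stat S n w, \<lambda>k\<in>{n<..}. Obs S k w) \<in> A}
         in AE w in Prob S. real_cond_exp (Prob S) (obs_alg S n) (indicat_real B) w
                          = real_cond_exp (Prob S) (stat_alg S n) (indicat_real B) w)"
    and separable: "AE w in Prob S. \<exists>i\<in>{0, 1}.
        (\<lambda>n. real_cond_exp (Prob S) (obs_alg S n) (indicat_real (hyp_event S i)) w)
          \<longlonglongrightarrow> 1"
    and posterior_continuous: "\<And>n i c. 1 \<le> n \<Longrightarrow> n \<le> N \<Longrightarrow> i \<in> {0, 1} \<Longrightarrow>
        AE w in Prob S. posterior S i n (stat S n w) \<noteq> c"
    and next_law_kernel: "\<And>n. next_law S n \<in> T_space S \<rightarrow>\<^sub>M prob_algebra (X_ref S)"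
    and next_law_version: "\<And>n A. A \<in> sets (X_ref S) \<Longrightarrow>
        AE w in Prob S. measure (next_law S n (stat S n w)) A
          = real_cond_exp (Prob S) (stat_alg S n)
              (indicat_real {w \<in> space (Prob S). Obs S (Suc n) w \<in> A}) w"
    and T_ref_sets: "\<And>n. sets (T_ref S n) = sets (T_space S)"
    and pdf_T_nonneg: "\<And>n t. 0 \<le> pdf_T S n t"
    and pdf_T: "\<And>n. distributed (Prob S) (T_ref S n) (stat S n) (\<lambda>t. ennreal (pdf_T S n t))"
    and pdf_T_given_nonneg: "\<And>i n t. i \<in> {0, 1} \<Longrightarrow> 0 \<le> pdf_T_given S i n t"
    and pdf_T_given: "\<And>i n. i \<in> {0, 1} \<Longrightarrow>
        distributed (Prob_given S i) (T_ref S n) (stat S n) (\<lambda>t. ennreal (pdf_T_given S i n t))"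

definition z_ratio :: "('w, 'x, 't) seq_setup \<Rightarrow> nat \<Rightarrow> nat \<Rightarrow> 't \<Rightarrow> real" where
  "z_ratio S i n t = pdf_T_given S i n t / pdf_T S n t"

definition Q_kernel :: "('w, 'x, 't) seq_setup \<Rightarrow> nat \<Rightarrow> 't \<Rightarrow> 't measure" where
  "Q_kernel S n t = distr (next_law S n t) (T_space S) (t_step S t)"

definition cond_var :: "('w, 'x, 't) seq_setup \<Rightarrow> nat \<Rightarrow> nat \<Rightarrow> 't \<Rightarrow> real" where
  "cond_var S i n = cexp_given (Prob_given S i) (T_space S) (stat S n)
     (\<lambda>w. (Theta S w
            - cexp_given (Prob_given S i) (T_space S) (stat S n) (Theta S) (stat S n w))\<^sup>2)"

text \<open>The estimator \<open>E[\<Theta> | x\<^sub>n, H\<^sub>i]\<close> is taken as a random variable, not as a function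
  of the observed values.\<close>

definition estimator :: "('w, 'x, 't) seq_setup \<Rightarrow> nat \<Rightarrow> nat \<Rightarrow> 'w \<Rightarrow> real" where
  "estimator S i n = real_cond_exp (Prob_given S i) (obs_alg S n) (Theta S)"

text \<open>The weights are \<open>C 0, \<dots>, C 3\<close>; other values of \<open>C\<close> are never used.\<close>

definition D_cost ::
  "('w, 'x, 't) seq_setup \<Rightarrow> (nat \<Rightarrow> real) \<Rightarrow> nat \<Rightarrow> nat \<Rightarrow> 't \<Rightarrow> real" where
  "D_cost S C i n t = C (1 - i) * posterior S (1 - i) n t
     + C (2 + i) * posterior S i n t * cond_var S i n t"

definition g_cost :: "('w, 'x, 't) seq_setup \<Rightarrow> (nat \<Rightarrow> real) \<Rightarrow> nat \<Rightarrow> 't \<Rightarrow> real" where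
  "g_cost S C n t = min (D_cost S C 0 n t) (D_cost S C 1 n t)"

function rho ::
  "('w, 'x, 't) seq_setup \<Rightarrow> nat \<Rightarrow> (nat \<Rightarrow> real) \<Rightarrow> nat \<Rightarrow> 't \<Rightarrow> real" where
  "rho S N C n t =
     (if n < N
      then min (g_cost S C n t) (1 + (\<integral>s. rho S N C (Suc n) s \<partial>Q_kernel S n t))
      else g_cost S C n t)"
  by pat_completeness auto
termination
  by (relation "Wellfounded.measure (\<lambda>(S, N, C, n, t). N - n)") auto

declare rho.simps [simp del]

text \<open>
  The derivative of \<open>\<rho>\<^sub>n(t)\<close> with respect to \<open>C\<^sub>i\<close> at the weights \<open>C\<close>. The weights range over
  \<open>[0, \<infinity>)\<close>, so this is the ordinary derivative if \<open>C\<^sub>i > 0\<close> and the right derivative if \<open>C\<^sub>i = 0\<close>.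
\<close>

definition has_cost_derivative ::
  "('w, 'x, 't) seq_setup \<Rightarrow> nat \<Rightarrow> (nat \<Rightarrow> real) \<Rightarrow> nat \<Rightarrow> nat \<Rightarrow> 't \<Rightarrow> real \<Rightarrow> bool" where
  "has_cost_derivative S N C i n t d \<longleftrightarrow>
     ((\<lambda>c. rho S N (C(i := c)) n t) has_real_derivative d) (at (C i) within {0..})"

definition stop_boundary ::
  "('w, 'x, 't) seq_setup \<Rightarrow> nat \<Rightarrow> (nat \<Rightarrow> real) \<Rightarrow> nat \<Rightarrow> 't set" where
  "stop_boundary S N C n = {t \<in> space (T_space S).
     g_cost S C n t = 1 + (\<integral>s. rho S N C (Suc n) s \<partial>Q_kernel S n t)}"

definition stop_rule ::
  "('w, 'x, 't) seq_setup \<Rightarrow> nat \<Rightarrow> (nat \<Rightarrow> real) \<Rightarrow> nat \<Rightarrow> 't \<Rightarrow> real" where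
  "stop_rule S N C n t = of_bool (rho S N C n t = g_cost S C n t)"

definition stop_time ::
  "('w, 'x, 't) seq_setup \<Rightarrow> nat \<Rightarrow> (nat \<Rightarrow> real) \<Rightarrow> 'w \<Rightarrow> nat" where
  "stop_time S N C w = Inf {n. stop_rule S N C n (stat S n w) = 1}"

text \<open>
  The boundary between the two decision regions, inside the stopping region (elsewhere the
  decision rule is not applied).
\<close>

definition decision_boundary ::
  "('w, 'x, 't) seq_setup \<Rightarrow> nat \<Rightarrow> (nat \<Rightarrow> real) \<Rightarrow> nat \<Rightarrow> 't set" where
  "decision_boundary S N C n = {t \<in> space (T_space S).
     stop_rule S N C n t = 1 \<and> D_cost S C 0 n t = D_cost S C 1 n t}"

definition optimal_decision ::
  "('w, 'x, 't) seq_setup \<Rightarrow> nat \<Rightarrow> (nat \<Rightarrow> real) \<Rightarrow> (nat \<Rightarrow> 't \<Rightarrow> nat) \<Rightarrow> bool" where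
  "optimal_decision S N C \<delta> \<longleftrightarrow> (\<forall>n\<le>N.
     \<delta> n \<in> T_space S \<rightarrow>\<^sub>M count_space UNIV \<and>
     (\<forall>t\<in>space (T_space S).
        of_bool (D_cost S C 0 n t > D_cost S C 1 n t) \<le> \<delta> n t \<and>
        \<delta> n t \<le> of_bool (D_cost S C 0 n t \<ge> D_cost S C 1 n t)))"

definition Prob_given_running ::
  "('w, 'x, 't) seq_setup \<Rightarrow> nat \<Rightarrow> (nat \<Rightarrow> real) \<Rightarrow> nat \<Rightarrow> nat \<Rightarrow> 'w measure" where
  "Prob_given_running S N C i n = uniform_measure (Prob S)
     {w \<in> space (Prob S). Hyp S w = i \<and> n \<le> stop_time S N C w}"

text \<open>The errors \<open>\<alpha>\<^sub>n\<^sup>i\<close> and \<open>\<beta>\<^sub>n\<^sup>i\<close> as conditional expectations given \<open>t\<^sub>n\<close>, \<open>H\<^sub>i\<close>, \<open>\<tau> \<ge> n\<close>.\<close>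

definition detection_error ::
  "('w, 'x, 't) seq_setup \<Rightarrow> nat \<Rightarrow> (nat \<Rightarrow> real) \<Rightarrow> (nat \<Rightarrow> 't \<Rightarrow> nat)
     \<Rightarrow> nat \<Rightarrow> nat \<Rightarrow> 't \<Rightarrow> real" where
  "detection_error S N C \<delta> i n =
     cexp_given (Prob_given_running S N C i n) (T_space S) (stat S n)
       (\<lambda>w. let \<tau> = stop_time S N C w in of_bool (\<delta> \<tau> (stat S \<tau> w) = 1 - i))"

definition estimation_error ::
  "('w, 'x, 't) seq_setup \<Rightarrow> nat \<Rightarrow> (nat \<Rightarrow> real) \<Rightarrow> (nat \<Rightarrow> 't \<Rightarrow> nat)
     \<Rightarrow> nat \<Rightarrow> nat \<Rightarrow> 't \<Rightarrow> real" where
  "estimation_error S N C \<delta> i n =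
     cexp_given (Prob_given_running S N C i n) (T_space S) (stat S n)
       (\<lambda>w. let \<tau> = stop_time S N C w in
            of_bool (\<delta> \<tau> (stat S \<tau> w) = i) * (estimator S i \<tau> w - Theta S w)\<^sup>2)"

text \<open>
  The same errors by backward recursion. This makes sense for almost every value of \<open>t\<^sub>n\<close>, also
  for values that the statistic takes at time \<open>n\<close> only if the policy has stopped before.
\<close>

function detection_error_rec ::
  "('w, 'x, 't) seq_setup \<Rightarrow> nat \<Rightarrow> (nat \<Rightarrow> real) \<Rightarrow> (nat \<Rightarrow> 't \<Rightarrow> nat)
     \<Rightarrow> nat \<Rightarrow> nat \<Rightarrow> 't \<Rightarrow> real" where
  "detection_error_rec S N C \<delta> i n t =
     (if n < N
      then of_bool (\<delta> n t = 1 - i) * stop_rule S N C n t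
         + (1 - stop_rule S N C n t)
           * cexp_given (Prob_given S i) (T_space S) (stat S n)
               (\<lambda>w. detection_error_rec S N C \<delta> i (Suc n) (stat S (Suc n) w)) t
      else of_bool (\<delta> n t = 1 - i) * stop_rule S N C n t)"
  by pat_completeness auto
termination
  by (relation "Wellfounded.measure (\<lambda>(S, N, C, \<delta>, i, n, t). N - n)") auto

function estimation_error_rec ::
  "('w, 'x, 't) seq_setup \<Rightarrow> nat \<Rightarrow> (nat \<Rightarrow> real) \<Rightarrow> (nat \<Rightarrow> 't \<Rightarrow> nat)
     \<Rightarrow> nat \<Rightarrow> nat \<Rightarrow> 't \<Rightarrow> real" where
  "estimation_error_rec S N C \<delta> i n t =
     (let e = cexp_given (Prob_given S i) (T_space S) (stat S n)
                (\<lambda>w. (estimator S i n w - Theta S w)\<^sup>2) t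
      in if n < N
         then e * of_bool (\<delta> n t = i) * stop_rule S N C n t
            + (1 - stop_rule S N C n t)
              * cexp_given (Prob_given S i) (T_space S) (stat S n)
                  (\<lambda>w. estimation_error_rec S N C \<delta> i (Suc n) (stat S (Suc n) w)) t
         else e * of_bool (\<delta> n t = i) * stop_rule S N C n t)"
  by pat_completeness auto
termination
  by (relation "Wellfounded.measure (\<lambda>(S, N, C, \<delta>, i, n, t). N - n)") auto

declare detection_error_rec.simps [simp del] estimation_error_rec.simps [simp del]

end

theory Submission
  imports Defs
begin

text \<open>
  As functions of a single weight the costs are minima of affine functions and of integrals of such
  minima, hence Lipschitz with an integrable constant. Off the boundaries each minimum is attained by
  one argument near the given weights, and dominated convergence lets the derivative pass under the
  integral. So the derivative satisfies the same backward recursion as the errors, up to the factor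
  \<open>p(H\<^sub>i | t\<^sub>n)\<close>: by sufficiency \<open>p(H\<^sub>i | t\<^sub>n)\<close> equals \<open>p(H\<^sub>i | x\<^sub>n)\<close>, which is a
  martingale, so this factor can be moved through the conditional expectations, and
  \<open>p(H\<^sub>i | t\<^sub>n) = p(H\<^sub>i) z\<^sub>n\<^sup>i\<close> by Bayes' rule.
\<close>

section \<open>Conditional expectations given a statistic\<close>

text \<open>The objects are given only up to null sets, while a derivative in a weight compares
  uncountably many weights at one fixed value of the statistic. The exceptional sets must therefore
  not depend on the weight, and they must be null for \<open>Q_kernel S n t\<close> at almost every
  \<open>t\<close>; for this the kernel is tied to the joint law of two successive statistics. The
  integrability of the Lipschitz constant comes from the finite second moment of the parameter.
  Conditional expectations under hypothesis \<open>i\<close> are determined only up to null sets of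
  that hypothesis. An observation event that is null under \<open>i\<close> lies, up to a null set
  of the model, where the posterior of \<open>i\<close> vanishes, so the factor in front of the
  error absorbs the ambiguity. The conditional errors need more than the recursion: whether the
  policy still runs at time \<open>n\<close> depends on all earlier statistics, not just on the
  current one. Hence sufficiency, assumed for events, has to be extended to integrals over arbitrary
  events of the observations, under each hypothesis.\<close>

lemma measurable_vimage_algebra_factor:
  fixes g :: "'w \<Rightarrow> real"
  assumes T: "T \<in> X \<rightarrow> space E" and g: "g \<in> borel_measurable (vimage_algebra X T E)"
  shows "\<exists>f\<in>borel_measurable E. \<forall>w\<in>X. f (T w) = g w"
proof -
  have "\<exists>B. B \<in> sets E \<and> T -` B \<inter> X = {w\<in>X. g w < real_of_rat q}" for q
  proof -
    have "{w\<in>space (vimage_algebra X T E). g w < real_of_rat q} \<in> sets (vimage_algebra X T E)"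
      using g by measurable
    then have "{w\<in>X. g w < real_of_rat q} \<in> sets (vimage_algebra X T E)"
      by simp
    then show ?thesis
      unfolding sets_vimage_algebra2[OF T] by auto
  qed
  then obtain B where B: "\<And>q. B q \<in> sets E" "\<And>q. T -` B q \<inter> X = {w\<in>X. g w < real_of_rat q}"
    by metis
  \<comment> \<open>Doob-Dynkin factorization: \<open>g\<close> is recovered from its rational
    sublevel sets, which are preimages of the sets \<open>B q\<close>. Off the range of
    \<open>T\<close> the sets \<open>B q\<close> need not be nested and the infimum may be infinite;
    \<open>real_of_ereal\<close> then returns 0, which is harmless.\<close>
  define f where "f t = real_of_ereal (INF q. if t \<in> B q then ereal (real_of_rat q) else \<infinity>)" for t
  have "f \<in> borel_measurable E"
    unfolding f_def using B(1) by measurable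
  moreover have "f (T w) = g w" if w: "w \<in> X" for w
  proof -
    have *: "T w \<in> B q \<longleftrightarrow> g w < real_of_rat q" for q
      using B(2)[of q] w by auto
    have "(INF q. if T w \<in> B q then ereal (real_of_rat q) else \<infinity>) = ereal (g w)"
    proof (rule antisym)
      show "(INF q. if T w \<in> B q then ereal (real_of_rat q) else \<infinity>) \<le> ereal (g w)"
      proof (rule ereal_le_epsilon2)
        fix e :: real assume "0 < e"
        then obtain q where q: "g w < real_of_rat q" "real_of_rat q < g w + e"
          using of_rat_dense[of "g w" "g w + e"] by auto
        have "(INF q. if T w \<in> B q then ereal (real_of_rat q) else \<infinity>) \<le> ereal (real_of_rat q)"
          using q by (intro INF_lower2[of q]) (auto simp: *)
        also have "\<dots> \<le> ereal (g w) + ereal e"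
          using q by simp
        finally show "(INF q. if T w \<in> B q then ereal (real_of_rat q) else \<infinity>) \<le> ereal (g w) + ereal e" .
      qed
      show "ereal (g w) \<le> (INF q. if T w \<in> B q then ereal (real_of_rat q) else \<infinity>)"
        by (intro INF_greatest) (auto simp: *)
    qed
    then show ?thesis
      by (simp add: f_def)
  qed
  ultimately show ?thesis
    by blast
qed

text \<open>A witness for the \<open>SOME\<close> in \<open>cexp_given\<close> exists because the
  conditional expectation is measurable for the algebra generated by \<open>T\<close> and hence
  factors through \<open>T\<close>. This works for every \<open>Y\<close>, since
  \<open>real_cond_exp\<close> is always measurable.\<close>

lemma
  assumes T: "T \<in> M \<rightarrow>\<^sub>M E"
  shows cexp_given_measurable: "cexp_given M E T Y \<in> borel_measurable E"
    and cexp_given_version: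
      "AE w in M. cexp_given M E T Y (T w) = real_cond_exp M (vimage_algebra (space M) T E) Y w"
proof -
  have "\<exists>f\<in>borel_measurable E. \<forall>w\<in>space M.
      f (T w) = real_cond_exp M (vimage_algebra (space M) T E) Y w"
    using T by (intro measurable_vimage_algebra_factor) (auto simp: measurable_space)
  then have "\<exists>f. f \<in> borel_measurable E \<and>
      (AE w in M. f (T w) = real_cond_exp M (vimage_algebra (space M) T E) Y w)"
    by (auto intro: AE_I2)
  from someI_ex[OF this]
  show "cexp_given M E T Y \<in> borel_measurable E"
    "AE w in M. cexp_given M E T Y (T w) = real_cond_exp M (vimage_algebra (space M) T E) Y w"
    unfolding cexp_given_def by auto
qed

lemma subalgebra_vimage_algebra:
  "T \<in> M \<rightarrow>\<^sub>M E \<Longrightarrow> subalgebra M (vimage_algebra (space M) T E)"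
  unfolding subalgebra_def
  by (auto simp: sets_vimage_algebra2 measurable_sets measurable_space Pi_iff)

lemma (in finite_measure) sigma_finite_subalgebraI:
  assumes "subalgebra M F" shows "sigma_finite_subalgebra M F"
proof -
  interpret finite_measure_subalgebra M F
    using assms by unfold_locales
  show ?thesis
    by unfold_locales
qed

lemma (in finite_measure) cexp_given_integrable:
  assumes T: "T \<in> M \<rightarrow>\<^sub>M E" and Y: "integrable M Y"
  shows "integrable M (\<lambda>w. cexp_given M E T Y (T w))"
proof -
  interpret sigma_finite_subalgebra M "vimage_algebra (space M) T E"
    using T by (intro sigma_finite_subalgebraI subalgebra_vimage_algebra)
  note [measurable] = T cexp_given_measurable[OF T]
  have "integrable M (real_cond_exp M (vimage_algebra (space M) T E) Y)"
    using Y by (rule real_cond_exp_int)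
  then show ?thesis
    using cexp_given_version[OF T, of Y]
    by (subst integrable_cong_AE[where g="real_cond_exp M (vimage_algebra (space M) T E) Y"]) auto
qed

lemma (in finite_measure) cexp_given_integral:
  assumes T: "T \<in> M \<rightarrow>\<^sub>M E" and f: "f \<in> borel_measurable E"
    and Y: "Y \<in> borel_measurable M" and fY: "integrable M (\<lambda>w. f (T w) * Y w)"
  shows "integrable M (\<lambda>w. f (T w) * cexp_given M E T Y (T w))"
    and "(\<integral>w. f (T w) * cexp_given M E T Y (T w) \<partial>M) = (\<integral>w. f (T w) * Y w \<partial>M)"
proof -
  interpret sigma_finite_subalgebra M "vimage_algebra (space M) T E"
    using T by (intro sigma_finite_subalgebraI subalgebra_vimage_algebra)
  note [measurable] = T cexp_given_measurable[OF T] f Y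
  have fT: "(\<lambda>w. f (T w)) \<in> borel_measurable (vimage_algebra (space M) T E)"
    using T[THEN measurable_space] by (intro measurable_compose[OF measurable_vimage_algebra1 f]) auto
  note * = real_cond_exp_intg[OF fY fT Y]
  have ae: "AE w in M. f (T w) * cexp_given M E T Y (T w)
      = f (T w) * real_cond_exp M (vimage_algebra (space M) T E) Y w"
    using cexp_given_version[OF T, of Y] by auto
  have "integrable M (\<lambda>w. f (T w) * cexp_given M E T Y (T w)) \<longleftrightarrow>
    integrable M (\<lambda>w. f (T w) * real_cond_exp M (vimage_algebra (space M) T E) Y w)"
    using ae by (intro integrable_cong_AE) auto
  with * show "integrable M (\<lambda>w. f (T w) * cexp_given M E T Y (T w))"
    by simp
  have "(\<integral>w. f (T w) * cexp_given M E T Y (T w) \<partial>M) =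
    (\<integral>w. f (T w) * real_cond_exp M (vimage_algebra (space M) T E) Y w \<partial>M)"
    using ae by (intro integral_cong_AE) auto
  with * show "(\<integral>w. f (T w) * cexp_given M E T Y (T w) \<partial>M) = (\<integral>w. f (T w) * Y w \<partial>M)"
    by simp
qed

text \<open>The sets of the generated algebra are exactly the preimages of the sets of
  \<open>E\<close>, so the defining identity of conditional expectation has to be tested on these
  only. This is the criterion by which a proposed function of the statistic is recognized as a
  version.\<close>

lemma (in finite_measure) cexp_given_charact:
  assumes T: "T \<in> M \<rightarrow>\<^sub>M E" and h: "h \<in> borel_measurable E"
    and Y: "integrable M Y" and hT: "integrable M (\<lambda>w. h (T w))"
    and eq: "\<And>A. A \<in> sets E \<Longrightarrow>
      (\<integral>w. indicator A (T w) * Y w \<partial>M) = (\<integral>w. indicator A (T w) * h (T w) \<partial>M)"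
  shows "AE w in M. cexp_given M E T Y (T w) = h (T w)"
proof -
  interpret sigma_finite_subalgebra M "vimage_algebra (space M) T E"
    using T by (intro sigma_finite_subalgebraI subalgebra_vimage_algebra)
  have TS: "T \<in> space M \<rightarrow> space E"
    using T[THEN measurable_space] by auto
  have "AE w in M. real_cond_exp M (vimage_algebra (space M) T E) Y w = h (T w)"
  proof (rule real_cond_exp_charact)
    fix A assume "A \<in> sets (vimage_algebra (space M) T E)"
    then obtain B where B: "B \<in> sets E" "A = T -` B \<inter> space M"
      by (auto simp: sets_vimage_algebra2[OF TS])
    have "set_lebesgue_integral M A f = (\<integral>w. indicator B (T w) * f w \<partial>M)" for f :: "_ \<Rightarrow> real"
      unfolding set_lebesgue_integral_def
      by (intro Bochner_Integration.integral_cong) (auto simp: B split: split_indicator)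
    with eq[OF B(1)] show "set_lebesgue_integral M A Y = set_lebesgue_integral M A (\<lambda>w. h (T w))"
      by simp
  qed (use Y hT h TS in \<open>auto intro!: measurable_compose[OF measurable_vimage_algebra1 h]\<close>)
  with cexp_given_version[OF T, of Y] show ?thesis
    by eventually_elim simp
qed

lemma (in finite_measure) cexp_given_cong_AE:
  assumes T: "T \<in> M \<rightarrow>\<^sub>M E" and "AE w in M. Y w = Y' w"
    and "Y \<in> borel_measurable M" "Y' \<in> borel_measurable M"
  shows "AE w in M. cexp_given M E T Y (T w) = cexp_given M E T Y' (T w)"
proof -
  interpret sigma_finite_subalgebra M "vimage_algebra (space M) T E"
    using T by (intro sigma_finite_subalgebraI subalgebra_vimage_algebra)
  show ?thesis
    using cexp_given_version[OF T, of Y] cexp_given_version[OF T, of Y'] real_cond_exp_cong[OF assms(2-4)]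
    by eventually_elim simp
qed

lemma (in finite_measure) cexp_given_nonneg:
  assumes T: "T \<in> M \<rightarrow>\<^sub>M E" and "AE w in M. 0 \<le> Y w" and "Y \<in> borel_measurable M"
  shows "AE w in M. 0 \<le> cexp_given M E T Y (T w)"
proof -
  interpret sigma_finite_subalgebra M "vimage_algebra (space M) T E"
    using T by (intro sigma_finite_subalgebraI subalgebra_vimage_algebra)
  show ?thesis
    using cexp_given_version[OF T, of Y] real_cond_exp_pos[OF assms(2,3)]
    by eventually_elim simp
qed

text \<open>Conditioning on an event of positive measure is a change of density by the normalized
  indicator. Both the measure given a hypothesis and the measure given a hypothesis and a running
  policy are of this kind.\<close>

lemma (in finite_measure)
  fixes f :: "'a \<Rightarrow> real"
  assumes A: "A \<in> sets M" "emeasure M A \<noteq> 0" and f: "f \<in> borel_measurable M"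
  shows integrable_uniform_measure:
      "integrable (uniform_measure M A) f \<longleftrightarrow> integrable M (\<lambda>w. indicator A w * f w)"
    and integral_uniform_measure:
      "(\<integral>w. f w \<partial>uniform_measure M A) = (\<integral>w. indicator A w * f w \<partial>M) / measure M A"
proof -
  have pos: "0 < measure M A"
    using A by (simp add: emeasure_eq_measure zero_less_measure_iff)
  have *: "uniform_measure M A = density M (\<lambda>w. ennreal (indicator A w / measure M A))"
    unfolding uniform_measure_def using pos
    using A(1) divide_ennreal[of 1 "measure M A"]
    by (intro density_cong) (auto simp: emeasure_eq_measure split: split_indicator)
  have "integrable (uniform_measure M A) f \<longleftrightarrow>
      integrable M (\<lambda>w. indicator A w / measure M A * f w)"
    unfolding * using A f pos by (subst integrable_real_density) auto
  also have "\<dots> \<longleftrightarrow> integrable M (\<lambda>w. (1 / measure M A) * (indicator A w * f w))"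
    by (simp add: field_simps)
  also have "\<dots> \<longleftrightarrow> integrable M (\<lambda>w. indicator A w * f w)"
    using pos by (subst integrable_mult_left_iff) simp
  finally show "integrable (uniform_measure M A) f \<longleftrightarrow> integrable M (\<lambda>w. indicator A w * f w)" .
  have "(\<integral>w. f w \<partial>uniform_measure M A) = (\<integral>w. indicator A w / measure M A * f w \<partial>M)"
    unfolding * using A f pos by (subst integral_real_density) auto
  also have "\<dots> = (\<integral>w. indicator A w * f w \<partial>M) / measure M A"
    by (simp add: field_simps)
  finally show "(\<integral>w. f w \<partial>uniform_measure M A) = (\<integral>w. indicator A w * f w \<partial>M) / measure M A" .
qed

text \<open>Along any sequence of parameters tending to \<open>c0\<close> the difference quotients
  are dominated by \<open>L\<close>. The derivative is taken within \<open>S\<close> so that a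
  weight equal to 0 is covered by the right derivative. The null set in the Lipschitz bound may
  depend on \<open>c\<close>, because dominated convergence uses one null set per member of the
  sequence.\<close>

lemma has_real_derivative_integral_within:
  fixes r :: "real \<Rightarrow> 'a \<Rightarrow> real"
  assumes r: "\<And>c. c \<in> S \<Longrightarrow> integrable M (r c)"
    and L: "integrable M L"
    and lip: "\<And>c. c \<in> S \<Longrightarrow> AE s in M. \<bar>r c s - r c0 s\<bar> \<le> \<bar>c - c0\<bar> * L s"
    and d: "d \<in> borel_measurable M"
    and deriv: "AE s in M. ((\<lambda>c. r c s) has_real_derivative d s) (at c0 within S)"
    and c0: "c0 \<in> S"
  shows "((\<lambda>c. \<integral>s. r c s \<partial>M) has_real_derivative (\<integral>s. d s \<partial>M)) (at c0 within S)"
  unfolding has_field_derivative_iff tendsto_at_iff_sequentially comp_def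
proof (intro allI impI)
  fix X :: "nat \<Rightarrow> real" assume X: "\<forall>i. X i \<in> S - {c0}" "X \<longlonglongrightarrow> c0"
  have "(\<lambda>k. \<integral>s. (r (X k) s - r c0 s) / (X k - c0) \<partial>M) \<longlonglongrightarrow> (\<integral>s. d s \<partial>M)"
  proof (rule integral_dominated_convergence[where w="L"])
    show "AE s in M. (\<lambda>k. (r (X k) s - r c0 s) / (X k - c0)) \<longlonglongrightarrow> d s"
      using deriv
    proof eventually_elim
      case (elim s)
      then show ?case
        using X unfolding has_field_derivative_iff tendsto_at_iff_sequentially comp_def by blast
    qed
    show "AE s in M. norm ((r (X k) s - r c0 s) / (X k - c0)) \<le> L s" for k
    proof -
      have "X k \<in> S" "X k \<noteq> c0" using X by auto
      then show ?thesis
        using lip[of "X k"] by (auto elim!: eventually_mono simp: abs_divide field_simps)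
    qed
    show "(\<lambda>s. (r (X k) s - r c0 s) / (X k - c0)) \<in> borel_measurable M" for k
      using X r[of "X k"] r[OF c0] by auto
  qed (use d L in auto)
  also have "(\<lambda>k. \<integral>s. (r (X k) s - r c0 s) / (X k - c0) \<partial>M) =
      (\<lambda>k. ((\<integral>s. r (X k) s \<partial>M) - (\<integral>s. r c0 s \<partial>M)) / (X k - c0))"
    using X r r[OF c0] by (auto simp: Bochner_Integration.integral_diff)
  finally show "(\<lambda>k. ((\<integral>s. r (X k) s \<partial>M) - (\<integral>s. r c0 s \<partial>M)) / (X k - c0)) \<longlonglongrightarrow> (\<integral>s. d s \<partial>M)" .
qed

text \<open>By continuity the strict inequality persists near \<open>c\<close>, so the minimum is
  locally \<open>f\<close>. The larger function need only be continuous; this matters because the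
  cost of stopping may have a kink where the policy continues.\<close>

lemma has_real_derivative_min_less:
  fixes f h :: "real \<Rightarrow> real"
  assumes f: "(f has_real_derivative D) (at c within S)" and h: "continuous (at c within S) h"
    and less: "f c < h c" and c: "c \<in> S"
  shows "((\<lambda>x. min (f x) (h x)) has_real_derivative D) (at c within S)"
proof -
  have fc: "continuous (at c within S) f"
    using f by (rule DERIV_continuous)
  have "((\<lambda>x. h x - f x) \<longlongrightarrow> h c - f c) (at c within S)"
    using h fc by (intro tendsto_diff) (auto simp: continuous_within)
  then have "\<forall>\<^sub>F x in at c within S. 0 < h x - f x"
    using less by (intro order_tendstoD) auto
  then have "\<forall>\<^sub>F x in at c within S. f x = min (f x) (h x)"
    by eventually_elim auto
  then show ?thesis
    using less c by (subst has_field_derivative_cong_eventually[THEN sym]) (use f in auto)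
qed

section \<open>Sufficiency and the transition kernel\<close>

declare One_nat_def [simp del]

context seq_model
begin

sublocale prob_space "Prob S"
  by (rule prob)

abbreviation hist_space :: "nat \<Rightarrow> (nat \<times> real \<times> 't \<times> (nat \<Rightarrow> 'x)) measure" where
  "hist_space n \<equiv> count_space {0, 1} \<Otimes>\<^sub>M borel \<Otimes>\<^sub>M T_space S \<Otimes>\<^sub>M PiM {n<..} (\<lambda>_. X_ref S)"

text \<open>All that \<open>sufficient\<close> speaks about at time \<open>n\<close>: past
  observations enter only through the statistic, while the whole future is kept. Integrands of the
  form \<open>f (hist n w)\<close> are those to which sufficiency applies.\<close>

definition hist :: "nat \<Rightarrow> 'w \<Rightarrow> nat \<times> real \<times> 't \<times> (nat \<Rightarrow> 'x)" where
  "hist n w = (Hyp S w, Theta S w, stat S n w, \<lambda>k\<in>{n<..}. Obs S k w)"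

section \<open>Measurability of the model variables and the observation algebras\<close>

lemma joint_measurable:
  "(\<lambda>w. (Hyp S w, Theta S w, obs_upto S n w)) \<in>
     Prob S \<rightarrow>\<^sub>M count_space {0, 1} \<Otimes>\<^sub>M lborel \<Otimes>\<^sub>M PiM {1..n} (\<lambda>_. X_ref S)"
  using joint[of n] by (rule distributed_measurable)

lemma Hyp_measurable[measurable]: "Hyp S \<in> Prob S \<rightarrow>\<^sub>M count_space {0, 1}"
  using measurable_compose[OF joint_measurable[of 0] measurable_fst] by simp

lemma Theta_measurable[measurable]: "Theta S \<in> borel_measurable (Prob S)"
  using measurable_compose[OF measurable_compose[OF joint_measurable[of 0] measurable_snd] measurable_fst]
  by simp

lemma obs_upto_measurable[measurable]:
  "obs_upto S n \<in> Prob S \<rightarrow>\<^sub>M PiM {1..n} (\<lambda>_. X_ref S)"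
  using measurable_compose[OF measurable_compose[OF joint_measurable[of n] measurable_snd] measurable_snd]
  by simp

lemma Obs_measurable: "1 \<le> k \<Longrightarrow> Obs S k \<in> Prob S \<rightarrow>\<^sub>M X_ref S"
  using measurable_compose[OF obs_upto_measurable[of k] measurable_component_singleton[of k]]
  by (simp add: obs_upto_def)

lemma Obs_Suc_measurable[measurable]: "Obs S (Suc n) \<in> Prob S \<rightarrow>\<^sub>M X_ref S"
  by (rule Obs_measurable) simp

lemma t_step_measurable[measurable (raw)]:
  assumes "f \<in> M \<rightarrow>\<^sub>M T_space S" "g \<in> M \<rightarrow>\<^sub>M X_ref S"
  shows "(\<lambda>w. t_step S (f w) (g w)) \<in> M \<rightarrow>\<^sub>M T_space S"
  using measurable_compose[OF measurable_Pair[OF assms] t_step] by simp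

lemma stat_measurable[measurable]: "stat S n \<in> Prob S \<rightarrow>\<^sub>M T_space S"
  by (induction n) (use t_init in \<open>auto simp: measurable_const\<close>)

lemma space_obs_alg[simp]: "space (obs_alg S n) = space (Prob S)"
  by (simp add: obs_alg_def)

lemma space_stat_alg[simp]: "space (stat_alg S n) = space (Prob S)"
  by (simp add: stat_alg_def)

lemma subalgebra_obs: "subalgebra (Prob S) (obs_alg S n)"
  unfolding obs_alg_def by (intro subalgebra_vimage_algebra obs_upto_measurable)

lemma subalgebra_stat: "subalgebra (Prob S) (stat_alg S n)"
  unfolding stat_alg_def by (rule subalgebra_vimage_algebra) simp

sublocale obs: sigma_finite_subalgebra "Prob S" "obs_alg S n" for n
  by (rule sigma_finite_subalgebraI[OF subalgebra_obs])

sublocale stat: sigma_finite_subalgebra "Prob S" "stat_alg S n" for n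
  by (rule sigma_finite_subalgebraI[OF subalgebra_stat])

lemma obs_upto_obs_alg: "m \<le> n \<Longrightarrow> obs_upto S m \<in> obs_alg S n \<rightarrow>\<^sub>M PiM {1..m} (\<lambda>_. X_ref S)"
proof -
  assume "m \<le> n"
  have "obs_upto S n \<in> obs_alg S n \<rightarrow>\<^sub>M PiM {1..n} (\<lambda>_. X_ref S)"
    unfolding obs_alg_def using obs_upto_measurable[of n, THEN measurable_space]
    by (intro measurable_vimage_algebra1) auto
  then have "(\<lambda>w. restrict (obs_upto S n w) {1..m}) \<in> obs_alg S n \<rightarrow>\<^sub>M PiM {1..m} (\<lambda>_. X_ref S)"
    using \<open>m \<le> n\<close> by (intro measurable_compose[OF _ measurable_restrict_subset]) auto
  also have "(\<lambda>w. restrict (obs_upto S n w) {1..m}) = obs_upto S m"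
    using \<open>m \<le> n\<close> by (auto simp: obs_upto_def fun_eq_iff)
  finally show ?thesis .
qed

lemma obs_alg_mono: "m \<le> n \<Longrightarrow> sets (obs_alg S m) \<subseteq> sets (obs_alg S n)"
proof
  fix A assume mn: "m \<le> n" and A: "A \<in> sets (obs_alg S m)"
  have "obs_upto S m \<in> space (Prob S) \<rightarrow> space (PiM {1..m} (\<lambda>_. X_ref S))"
    using obs_upto_measurable[of m, THEN measurable_space] by auto
  from A obtain B where "B \<in> sets (PiM {1..m} (\<lambda>_. X_ref S))" "A = obs_upto S m -` B \<inter> space (Prob S)"
    unfolding obs_alg_def sets_vimage_algebra2[OF \<open>obs_upto S m \<in> _\<close>] by auto
  then show "A \<in> sets (obs_alg S n)"
    using measurable_sets[OF obs_upto_obs_alg[OF mn]] by auto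
qed

lemma Obs_obs_alg: "1 \<le> k \<Longrightarrow> k \<le> n \<Longrightarrow> Obs S k \<in> obs_alg S n \<rightarrow>\<^sub>M X_ref S"
  using measurable_compose[OF obs_upto_obs_alg[of k n] measurable_component_singleton[of k]]
  by (simp add: obs_upto_def)

lemma stat_obs_alg: "m \<le> n \<Longrightarrow> stat S m \<in> obs_alg S n \<rightarrow>\<^sub>M T_space S"
proof (induction m)
  case 0
  then show ?case using t_init by (auto simp: measurable_const)
next
  case (Suc m)
  have [measurable]: "stat S m \<in> obs_alg S n \<rightarrow>\<^sub>M T_space S" "Obs S (Suc m) \<in> obs_alg S n \<rightarrow>\<^sub>M X_ref S"
    using Suc by (auto intro!: Obs_obs_alg)
  show ?case by simp
qed

lemma stat_stat_alg: "stat S n \<in> stat_alg S n \<rightarrow>\<^sub>M T_space S"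
  unfolding stat_alg_def using stat_measurable[of n, THEN measurable_space]
  by (intro measurable_vimage_algebra1) auto

lemma hist_measurable[measurable]: "hist n \<in> Prob S \<rightarrow>\<^sub>M hist_space n"
proof -
  have [measurable]: "(\<lambda>w. \<lambda>k\<in>{n<..}. Obs S k w) \<in> Prob S \<rightarrow>\<^sub>M PiM {n<..} (\<lambda>_. X_ref S)"
    by (rule measurable_restrict) (auto intro!: Obs_measurable)
  show ?thesis
    unfolding hist_def by measurable
qed

lemma hyp_event_sets[measurable]: "hyp_event S i \<in> sets (Prob S)"
proof (cases "i \<in> {0, 1}")
  case True
  have "hyp_event S i = Hyp S -` {i} \<inter> space (Prob S)"
    by (auto simp: hyp_event_def)
  also have "\<dots> \<in> sets (Prob S)"
    using True by (intro measurable_sets[OF Hyp_measurable]) auto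
  finally show ?thesis .
next
  case False
  then have "hyp_event S i = {}"
    using Hyp_measurable[THEN measurable_space] by (fastforce simp: hyp_event_def)
  then show ?thesis by simp
qed

text \<open>The joint density for zero observations suffices: the product of likelihoods is empty
  and the product space over no indices has mass one. Integrating out \<theta> then leaves the
  prior.\<close>

lemma prob_hyp_event:
  assumes i: "i \<in> {0, 1}" shows "prob (hyp_event S i) = prior S i"
proof -
  define M where "M = PiM {1..0::nat} (\<lambda>_. X_ref S)"
  interpret X: product_sigma_finite "\<lambda>_. X_ref S"
    using X_ref by (simp add: product_sigma_finite_def)
  interpret XM: sigma_finite_measure M
    unfolding M_def by (rule X.sigma_finite) simp
  interpret L: pair_sigma_finite lborel M
    by unfold_locales
  have joint0: "distributed (Prob S) (count_space {0, 1} \<Otimes>\<^sub>M lborel \<Otimes>\<^sub>M M)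
      (\<lambda>w. (Hyp S w, Theta S w, obs_upto S 0 w)) (\<lambda>(j, \<theta>, x). ennreal (prior S j * pdf_Theta S j \<theta>))"
    using joint[of 0] by (simp add: M_def)
  have *: "hyp_event S i = (\<lambda>w. (Hyp S w, Theta S w, obs_upto S 0 w)) -`
      ({i} \<times> space (lborel \<Otimes>\<^sub>M M)) \<inter> space (Prob S)"
    using distributed_measurable[OF joint0, THEN measurable_space] by (auto simp: hyp_event_def space_pair_measure)
  have [measurable]: "pdf_Theta S j \<in> borel_measurable borel" if "j \<in> {0, 1}" for j
    using that by (rule pdf_Theta_measurable)
  have dens[measurable]: "(\<lambda>(j, \<theta>, x). ennreal (prior S j * pdf_Theta S j \<theta>)) \<in>
      borel_measurable (count_space {0, 1::nat} \<Otimes>\<^sub>M lborel \<Otimes>\<^sub>M M)"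
    using distributed_borel_measurable[OF joint0] .
  have mem: "{i} \<times> space (lborel \<Otimes>\<^sub>M M) \<in> sets (count_space {0, 1} \<Otimes>\<^sub>M lborel \<Otimes>\<^sub>M M)"
    using i by (intro pair_measureI sets.top) auto
  note [measurable] = mem
  have "emeasure (Prob S) (hyp_event S i) = (\<integral>\<^sup>+ y. (case y of (j, \<theta>, x) \<Rightarrow> ennreal (prior S j * pdf_Theta S j \<theta>))
      * indicator ({i} \<times> space (lborel \<Otimes>\<^sub>M M)) y \<partial>(count_space {0, 1} \<Otimes>\<^sub>M lborel \<Otimes>\<^sub>M M))"
    unfolding * by (subst distributed_emeasure[OF joint0 mem]) (simp add: case_prod_beta)
  also have "\<dots> = (\<integral>\<^sup>+ j. \<integral>\<^sup>+ y. (case y of (\<theta>, x) \<Rightarrow> ennreal (prior S j * pdf_Theta S j \<theta>))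
      * indicator ({i} \<times> space (lborel \<Otimes>\<^sub>M M)) (j, y) \<partial>(lborel \<Otimes>\<^sub>M M) \<partial>count_space {0, 1})"
    using dens mem by (subst L.nn_integral_fst[symmetric])
      (auto simp: case_prod_beta' intro!: borel_measurable_times_ennreal borel_measurable_indicator)
  also have "\<dots> = (\<integral>\<^sup>+ y. (case y of (\<theta>, x) \<Rightarrow> ennreal (prior S i * pdf_Theta S i \<theta>)) \<partial>(lborel \<Otimes>\<^sub>M M))"
    using i by (auto simp: nn_integral_count_space_finite intro!: nn_integral_cong)
  also have "\<dots> = (\<integral>\<^sup>+ \<theta>. \<integral>\<^sup>+ x. ennreal (prior S i * pdf_Theta S i \<theta>) \<partial>M \<partial>lborel)"
    using i by (subst XM.nn_integral_fst[symmetric]) auto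
  also have "\<dots> = (\<integral>\<^sup>+ \<theta>. ennreal (prior S i) * ennreal (pdf_Theta S i \<theta>) \<partial>lborel)"
    using i prior_pos[OF i] pdf_Theta_nonneg[OF i]
    by (intro nn_integral_cong) (simp add: M_def PiM_empty ennreal_mult less_imp_le)
  also have "\<dots> = ennreal (prior S i)"
    using i pdf_Theta_integral[OF i] by (subst nn_integral_cmult) auto
  finally show ?thesis
    using prior_pos[OF i] by (simp add: emeasure_eq_measure)
qed

section \<open>The conditional measure given a hypothesis\<close>

lemma emeasure_hyp_event: "i \<in> {0, 1} \<Longrightarrow> emeasure (Prob S) (hyp_event S i) \<noteq> 0"
  using prob_hyp_event[of i] prior_pos[of i] by (simp add: emeasure_eq_measure)

lemma prob_space_given: "i \<in> {0, 1} \<Longrightarrow> prob_space (Prob_given S i)"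
  unfolding Prob_given_def using emeasure_hyp_event
  by (intro prob_space_uniform_measure) (auto simp: emeasure_eq_measure)

lemma sets_Prob_given[measurable_cong, simp]: "sets (Prob_given S i) = sets (Prob S)"
  by (simp add: Prob_given_def)

lemma space_Prob_given[simp]: "space (Prob_given S i) = space (Prob S)"
  by (simp add: Prob_given_def)

lemma AE_given:
  assumes "i \<in> {0, 1}"
  shows "(AE w in Prob_given S i. Q w) \<longleftrightarrow> (AE w in Prob S. w \<in> hyp_event S i \<longrightarrow> Q w)"
  unfolding Prob_given_def using emeasure_hyp_event[OF assms]
  by (intro AE_uniform_measure) (auto simp: emeasure_eq_measure less_top[symmetric])

lemma
  fixes f :: "'w \<Rightarrow> real"
  assumes i: "i \<in> {0, 1}" and f: "f \<in> borel_measurable (Prob S)"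
  shows integrable_given: "integrable (Prob_given S i) f \<longleftrightarrow> integrable (Prob S) (\<lambda>w. indicator (hyp_event S i) w * f w)"
    and integral_given: "(\<integral>w. f w \<partial>Prob_given S i) = (\<integral>w. indicator (hyp_event S i) w * f w \<partial>Prob S) / prior S i"
  unfolding Prob_given_def using integrable_uniform_measure[OF hyp_event_sets emeasure_hyp_event[OF i] f]
    integral_uniform_measure[OF hyp_event_sets emeasure_hyp_event[OF i] f] prob_hyp_event[OF i]
  by auto

lemma posterior_measurable[measurable]: "posterior S i n \<in> borel_measurable (T_space S)"
  unfolding posterior_def by (intro cexp_given_measurable) simp

lemma cexp_given_Prob_given_measurable[measurable]:
  "cexp_given (Prob_given S i) (T_space S) (stat S n) Y \<in> borel_measurable (T_space S)"
  by (intro cexp_given_measurable) simp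

lemma cond_var_measurable[measurable]: "cond_var S i n \<in> borel_measurable (T_space S)"
  unfolding cond_var_def by simp

text \<open>Sufficiency in dual form: the event \<open>A\<close>, rather than the integrand, is projected to the statistic.\<close>

lemma sufficient_dual:
  assumes A: "A \<in> sets (obs_alg S n)"
  obtains k where "k \<in> borel_measurable (T_space S)" "\<And>t. 0 \<le> k t" "\<And>t. k t \<le> 1"
    "\<And>f. f \<in> borel_measurable (hist_space n) \<Longrightarrow> integrable (Prob S) (\<lambda>w. f (hist n w)) \<Longrightarrow>
      (\<integral>w. indicat_real A w * f (hist n w) \<partial>Prob S) = (\<integral>w. k (stat S n w) * f (hist n w) \<partial>Prob S)"
proof -
  have A'[measurable]: "A \<in> sets (Prob S)"
    using A subalgebra_obs[of n] by (auto simp: subalgebra_def)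
  let ?c = "cexp_given (Prob S) (T_space S) (stat S n) (indicat_real A)"
  let ?r = "real_cond_exp (Prob S) (stat_alg S n) (indicat_real A)"
  note [measurable] = cexp_given_measurable[OF stat_measurable[of n]]
  have c_r: "AE w in Prob S. ?c (stat S n w) = ?r w"
    using cexp_given_version[OF stat_measurable[of n]] by (simp add: stat_alg_def)
  \<comment> \<open>The conditional probability of \<open>A\<close> given the statistic, truncated
    so that the bounds 0 and 1 hold at every \<open>t\<close>. Almost surely the truncation changes
    nothing.\<close>
  define k where "k t = max 0 (min 1 (?c t))" for t
  have km[measurable]: "k \<in> borel_measurable (T_space S)"
    unfolding k_def by measurable
  have "AE w in Prob S. 0 \<le> ?r w"
    by (intro stat.real_cond_exp_pos) auto
  moreover have "AE w in Prob S. ?r w \<le> 1"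
    by (intro stat.real_cond_exp_le_c) (auto simp: indicator_def intro!: integrable_const_bound[of _ 1])
  ultimately have k_r: "AE w in Prob S. k (stat S n w) = ?r w"
    using c_r by eventually_elim (auto simp: k_def)
  have sets_eq: "(\<integral>w. indicator A w * indicator B (hist n w) \<partial>Prob S)
      = (\<integral>w. k (stat S n w) * indicator B (hist n w) \<partial>Prob S)" if B: "B \<in> sets (hist_space n)" for B
  proof -
    let ?B = "{w \<in> space (Prob S). hist n w \<in> B}"
    note [measurable] = B
    let ?b = "indicat_real ?B"
    have suff: "AE w in Prob S. real_cond_exp (Prob S) (obs_alg S n) ?b w
        = real_cond_exp (Prob S) (stat_alg S n) ?b w"
      using sufficient[OF B] unfolding Let_def hist_def .
    have int: "integrable (Prob S) (\<lambda>w. indicat_real A w * ?b w)"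
      by (intro integrable_const_bound[of _ 1]) (auto simp: indicator_def)
    note [measurable] = measurable_from_subalg[OF subalgebra_obs borel_measurable_cond_exp]
      measurable_from_subalg[OF subalgebra_stat borel_measurable_cond_exp]
    have A_obs: "indicat_real A \<in> borel_measurable (obs_alg S n)"
      using A by simp
    \<comment> \<open>Since \<open>A\<close> is an observation event, the indicator of
      \<open>B\<close> may be replaced by its conditional expectation given the observations, which
      by sufficiency is measurable for the statistic. Against such a factor the indicator of
      \<open>A\<close> may be projected to the statistic as well; finally the indicator of
      \<open>B\<close> is restored.\<close>
    have "(\<integral>w. indicator A w * indicator B (hist n w) \<partial>Prob S) = (\<integral>w. indicat_real A w * ?b w \<partial>Prob S)"
      by (intro Bochner_Integration.integral_cong) (auto simp: indicator_def)
    also have "\<dots> = (\<integral>w. indicat_real A w * real_cond_exp (Prob S) (obs_alg S n) ?b w \<partial>Prob S)"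
      using obs.real_cond_exp_intg(2)[OF int A_obs] by simp
    also have "\<dots> = (\<integral>w. real_cond_exp (Prob S) (stat_alg S n) ?b w * indicat_real A w \<partial>Prob S)"
      using suff by (intro integral_cong_AE) auto
    also have "\<dots> = (\<integral>w. real_cond_exp (Prob S) (stat_alg S n) ?b w * ?r w \<partial>Prob S)"
    proof (rule stat.real_cond_exp_intg(2)[symmetric])
      have "AE w in Prob S. 0 \<le> real_cond_exp (Prob S) (stat_alg S n) ?b w"
        by (intro stat.real_cond_exp_pos) auto
      moreover have "AE w in Prob S. real_cond_exp (Prob S) (stat_alg S n) ?b w \<le> 1"
        by (intro stat.real_cond_exp_le_c) (auto simp: indicator_def intro!: integrable_const_bound[of _ 1])
      ultimately show "integrable (Prob S) (\<lambda>w. real_cond_exp (Prob S) (stat_alg S n) ?b w * indicat_real A w)"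
        by (intro integrable_const_bound[of _ 1]) (auto simp: indicator_def)
    qed auto
    also have "\<dots> = (\<integral>w. k (stat S n w) * real_cond_exp (Prob S) (stat_alg S n) ?b w \<partial>Prob S)"
      using k_r by (intro integral_cong_AE) auto
    also have "\<dots> = (\<integral>w. k (stat S n w) * ?b w \<partial>Prob S)"
    proof (rule stat.real_cond_exp_intg(2))
      show "integrable (Prob S) (\<lambda>w. k (stat S n w) * ?b w)"
        by (intro integrable_const_bound[of _ 1]) (auto simp: indicator_def k_def)
      show "(\<lambda>w. k (stat S n w)) \<in> borel_measurable (stat_alg S n)"
        by (rule measurable_compose[OF stat_stat_alg km])
    qed simp
    also have "\<dots> = (\<integral>w. k (stat S n w) * indicator B (hist n w) \<partial>Prob S)"
      by (intro Bochner_Integration.integral_cong) (auto simp: indicator_def)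
    finally show ?thesis .
  qed
  \<comment> \<open>The passage from events to integrands: both sides of the identity are integrals
    with respect to image measures on \<open>hist_space n\<close>, and measures that agree on all
    sets have the same integrals.\<close>
  let ?M1 = "distr (density (Prob S) (\<lambda>w. ennreal (indicat_real A w))) (hist_space n) (hist n)"
  let ?M2 = "distr (density (Prob S) (\<lambda>w. ennreal (k (stat S n w)))) (hist_space n) (hist n)"
  have k01: "0 \<le> k t" "k t \<le> 1" for t
    by (auto simp: k_def)
  have "?M1 = ?M2"
  proof (rule measure_eqI)
    fix B assume "B \<in> sets ?M1"
    then have B[measurable]: "B \<in> sets (hist_space n)" by simp
    have emb: "emeasure (distr (density (Prob S) (\<lambda>w. ennreal (q w))) (hist_space n) (hist n)) B
        = ennreal (\<integral>w. q w * indicator B (hist n w) \<partial>Prob S)"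
      if [measurable]: "q \<in> borel_measurable (Prob S)" and q: "\<And>w. 0 \<le> q w" "\<And>w. q w \<le> 1" for q
    proof -
      have "emeasure (distr (density (Prob S) (\<lambda>w. ennreal (q w))) (hist_space n) (hist n)) B
        = (\<integral>\<^sup>+w. ennreal (q w) * indicator (hist n -` B \<inter> space (Prob S)) w \<partial>Prob S)"
        by (subst emeasure_distr) (auto simp: emeasure_density)
      also have "\<dots> = (\<integral>\<^sup>+w. ennreal (q w * indicator B (hist n w)) \<partial>Prob S)"
        by (intro nn_integral_cong) (auto simp: indicator_def)
      also have "\<dots> = ennreal (\<integral>w. q w * indicator B (hist n w) \<partial>Prob S)"
        using q by (intro nn_integral_eq_integral integrable_const_bound[of _ 1]) (auto simp: indicator_def)
      finally show ?thesis .
    qed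
    show "emeasure ?M1 B = emeasure ?M2 B"
      using sets_eq[OF B] by (subst (1 2) emb) (auto simp: k01)
  qed simp
  show thesis
  proof (rule that[of k])
    fix f :: "nat \<times> real \<times> 't \<times> (nat \<Rightarrow> 'x) \<Rightarrow> real"
    assume f[measurable]: "f \<in> borel_measurable (hist_space n)"
    have emb: "(\<integral>z. f z \<partial>distr (density (Prob S) (\<lambda>w. ennreal (q w))) (hist_space n) (hist n))
        = (\<integral>w. q w * f (hist n w) \<partial>Prob S)"
      if [measurable]: "q \<in> borel_measurable (Prob S)" and q: "\<And>w. 0 \<le> q w" for q
      using q by (subst integral_distr) (auto simp: integral_real_density)
    show "(\<integral>w. indicator A w * f (hist n w) \<partial>Prob S) = (\<integral>w. k (stat S n w) * f (hist n w) \<partial>Prob S)"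
      using \<open>?M1 = ?M2\<close> k01 by (subst (1 2) emb[symmetric]) auto
  qed (auto simp: k01)
qed

section \<open>Posterior probabilities as weights for observation events\<close>

lemma integrable_indicator_hyp[simp]: "integrable (Prob S) (indicat_real (hyp_event S i))"
  by (rule integrable_const_bound[of _ 1]) (auto simp: indicator_def)

lemma posterior_obs:
  assumes i: "i \<in> {0, 1}"
  shows "AE w in Prob S. real_cond_exp (Prob S) (obs_alg S n) (indicat_real (hyp_event S i)) w
    = posterior S i n (stat S n w)"
proof -
  let ?A = "{z \<in> space (hist_space n). fst z = i}"
  have A: "?A \<in> sets (hist_space n)"
    using i by measurable
  have *: "{w \<in> space (Prob S). (Hyp S w, Theta S w, stat S n w, \<lambda>k\<in>{n<..}. Obs S k w) \<in> ?A}
      = hyp_event S i"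
    using hist_measurable[of n, THEN measurable_space] by (auto simp: hist_def hyp_event_def)
  have "AE w in Prob S. real_cond_exp (Prob S) (obs_alg S n) (indicat_real (hyp_event S i)) w
    = real_cond_exp (Prob S) (stat_alg S n) (indicat_real (hyp_event S i)) w"
    using sufficient[OF A] unfolding Let_def * .
  moreover have "AE w in Prob S. posterior S i n (stat S n w)
    = real_cond_exp (Prob S) (stat_alg S n) (indicat_real (hyp_event S i)) w"
    unfolding posterior_def stat_alg_def by (rule cexp_given_version) simp
  ultimately show ?thesis
    by eventually_elim simp
qed

lemma posterior_bounds:
  "AE w in Prob S. 0 \<le> posterior S i n (stat S n w) \<and> posterior S i n (stat S n w) \<le> 1"
proof -
  let ?r = "real_cond_exp (Prob S) (stat_alg S n) (indicat_real (hyp_event S i))"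
  have "AE w in Prob S. 0 \<le> ?r w"
    by (intro stat.real_cond_exp_pos) auto
  moreover have "AE w in Prob S. ?r w \<le> 1"
    by (intro stat.real_cond_exp_le_c) (auto simp: indicator_def)
  moreover have "AE w in Prob S. posterior S i n (stat S n w) = ?r w"
    unfolding posterior_def stat_alg_def by (rule cexp_given_version) simp
  ultimately show ?thesis
    by eventually_elim simp
qed

text \<open>A change of measure: weighting by the posterior amounts to restricting to the
  hypothesis. By \<open>posterior_obs\<close> the factor \<open>f\<close> may depend on all
  observations up to time \<open>n\<close>; in particular it may contain earlier values of the
  statistic.\<close>

lemma posterior_integral:
  assumes i: "i \<in> {0, 1}" and f: "f \<in> borel_measurable (obs_alg S n)"
    and int: "integrable (Prob S) (\<lambda>w. f w * indicator (hyp_event S i) w)"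
  shows "integrable (Prob S) (\<lambda>w. f w * posterior S i n (stat S n w))"
    and "(\<integral>w. f w * posterior S i n (stat S n w) \<partial>Prob S) = (\<integral>w. f w * indicator (hyp_event S i) w \<partial>Prob S)"
proof -
  note [measurable] = measurable_from_subalg[OF subalgebra_obs borel_measurable_cond_exp]
    measurable_from_subalg[OF subalgebra_obs f]
  note * = obs.real_cond_exp_intg[OF int f borel_measurable_indicator[OF hyp_event_sets]]
  have ae: "AE w in Prob S. f w * posterior S i n (stat S n w)
      = f w * real_cond_exp (Prob S) (obs_alg S n) (indicat_real (hyp_event S i)) w"
    using posterior_obs[OF i, of n] by eventually_elim simp
  show "integrable (Prob S) (\<lambda>w. f w * posterior S i n (stat S n w))"
    using *(1) by (subst integrable_cong_AE[OF _ _ ae]) auto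
  show "(\<integral>w. f w * posterior S i n (stat S n w) \<partial>Prob S) = (\<integral>w. f w * indicator (hyp_event S i) w \<partial>Prob S)"
    using *(2) by (subst integral_cong_AE[OF _ _ ae]) auto
qed

text \<open>If \<open>A\<close> meets the hypothesis in a null set, the nonnegative posterior
  integrates to 0 over \<open>A\<close> and so vanishes there almost surely. Results known only
  under a hypothesis are transferred in this way to the unconditional measure.\<close>

lemma AE_given_obs:
  assumes i: "i \<in> {0, 1}" and A: "A \<in> sets (obs_alg S n)"
    and null: "AE w in Prob S. w \<in> hyp_event S i \<longrightarrow> w \<notin> A"
  shows "AE w in Prob S. w \<in> A \<longrightarrow> posterior S i n (stat S n w) = 0"
proof -
  have A'[measurable]: "A \<in> sets (Prob S)"
    using A subalgebra_obs[of n] by (auto simp: subalgebra_def)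
  have int: "integrable (Prob S) (\<lambda>w. indicat_real A w * indicator (hyp_event S i) w)"
    by (rule integrable_const_bound[of _ 1]) (auto simp: indicator_def)
  have Am: "indicat_real A \<in> borel_measurable (obs_alg S n)"
    using A by simp
  note * = posterior_integral[OF i Am int]
  have "(\<integral>w. indicat_real A w * indicator (hyp_event S i) w \<partial>Prob S) = (\<integral>w. 0 \<partial>Prob S)"
    using null by (intro integral_cong_AE) (auto simp: indicator_def)
  then have "(\<integral>w. indicat_real A w * posterior S i n (stat S n w) \<partial>Prob S) = 0"
    using *(2) by simp
  moreover have "AE w in Prob S. 0 \<le> indicat_real A w * posterior S i n (stat S n w)"
    using posterior_bounds[of i n] by eventually_elim simp
  ultimately have "AE w in Prob S. indicat_real A w * posterior S i n (stat S n w) = 0"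
    using *(1) by (subst (asm) integral_nonneg_eq_0_iff_AE) auto
  then show ?thesis
    by eventually_elim (auto simp: indicator_def)
qed

lemma AE_given_stat:
  assumes i: "i \<in> {0, 1}" and Q: "{t \<in> space (T_space S). Q t} \<in> sets (T_space S)"
    and null: "AE w in Prob_given S i. Q (stat S n w)"
  shows "AE w in Prob S. posterior S i n (stat S n w) = 0 \<or> Q (stat S n w)"
proof -
  let ?A = "stat S n -` (space (T_space S) - {t \<in> space (T_space S). Q t}) \<inter> space (Prob S)"
  have "?A \<in> sets (obs_alg S n)"
    using measurable_sets[OF stat_obs_alg[of n n], of "space (T_space S) - {t \<in> space (T_space S). Q t}"] Q
    by auto
  moreover have "AE w in Prob S. w \<in> hyp_event S i \<longrightarrow> w \<notin> ?A"
    using null unfolding AE_given[OF i] by eventually_elim auto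
  ultimately have "AE w in Prob S. w \<in> ?A \<longrightarrow> posterior S i n (stat S n w) = 0"
    by (rule AE_given_obs[OF i])
  then show ?thesis
    using AE_space
  proof eventually_elim
    case (elim w)
    then show ?case using stat_measurable[of n, THEN measurable_space, of w] by auto
  qed
qed

text \<open>The hypothesis is a component of \<open>hist\<close>, so restriction to it can be
  absorbed into the integrand and the dual form holds under \<open>Prob_given S i\<close> with the
  same \<open>k\<close>. Then \<open>A\<close> is exchanged for \<open>k\<close> of the statistic,
  the integrand is projected to the statistic, and \<open>k\<close> is exchanged back for
  \<open>A\<close>. The event \<open>A\<close> itself need not be determined by the
  statistic.\<close>

lemma sufficient_given:
  assumes i: "i \<in> {0, 1}" and A: "A \<in> sets (obs_alg S n)"
    and f[measurable]: "f \<in> borel_measurable (hist_space n)"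
    and int: "integrable (Prob_given S i) (\<lambda>w. f (hist n w))"
  shows "(\<integral>w. indicator A w * f (hist n w) \<partial>Prob_given S i) =
    (\<integral>w. indicator A w *
      cexp_given (Prob_given S i) (T_space S) (stat S n) (\<lambda>w. f (hist n w)) (stat S n w) \<partial>Prob_given S i)"
proof -
  interpret Pi: prob_space "Prob_given S i"
    by (rule prob_space_given[OF i])
  have A'[measurable]: "A \<in> sets (Prob S)"
    using A subalgebra_obs[of n] by (auto simp: subalgebra_def)
  let ?u = "cexp_given (Prob_given S i) (T_space S) (stat S n) (\<lambda>w. f (hist n w))"
  obtain k where k[measurable]: "k \<in> borel_measurable (T_space S)"
    and k01: "\<And>t. 0 \<le> k t" "\<And>t. k t \<le> 1" and
    k_eq: "\<And>f. f \<in> borel_measurable (hist_space n) \<Longrightarrow> integrable (Prob S) (\<lambda>w. f (hist n w)) \<Longrightarrow>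
      (\<integral>w. indicat_real A w * f (hist n w) \<partial>Prob S) = (\<integral>w. k (stat S n w) * f (hist n w) \<partial>Prob S)"
    using sufficient_dual[OF A] by blast
  have st[measurable]: "stat S n \<in> Prob_given S i \<rightarrow>\<^sub>M T_space S"
    by simp
  have fst_i[measurable]: "Measurable.pred (hist_space n) (\<lambda>z. fst z = i)"
    using i by measurable
  have hyp: "indicat_real (hyp_event S i) w = of_bool (fst (hist n w) = i)" if "w \<in> space (Prob S)" for w
    using that by (auto simp: hyp_event_def hist_def indicator_def)
  have key: "(\<integral>w. indicator A w * h (hist n w) \<partial>Prob_given S i) = (\<integral>w. k (stat S n w) * h (hist n w) \<partial>Prob_given S i)"
    if [measurable]: "h \<in> borel_measurable (hist_space n)" and h: "integrable (Prob_given S i) (\<lambda>w. h (hist n w))" for h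
  proof -
    have "integrable (Prob S) (\<lambda>w. indicator (hyp_event S i) w * h (hist n w))"
      using h by (subst (asm) integrable_given[OF i]) auto
    also have "?this \<longleftrightarrow> integrable (Prob S) (\<lambda>w. of_bool (fst (hist n w) = i) * h (hist n w))"
      by (intro Bochner_Integration.integrable_cong) (auto simp: hyp)
    finally have int': "integrable (Prob S) (\<lambda>w. of_bool (fst (hist n w) = i) * h (hist n w))" .
    have "(\<integral>w. indicator (hyp_event S i) w * (indicat_real A w * h (hist n w)) \<partial>Prob S)
        = (\<integral>w. indicat_real A w * (of_bool (fst (hist n w) = i) * h (hist n w)) \<partial>Prob S)"
      by (intro Bochner_Integration.integral_cong) (auto simp: hyp)
    also have "\<dots> = (\<integral>w. k (stat S n w) * (of_bool (fst (hist n w) = i) * h (hist n w)) \<partial>Prob S)"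
      using int' by (intro k_eq[of "\<lambda>z. of_bool (fst z = i) * h z"]) auto
    also have "\<dots> = (\<integral>w. indicator (hyp_event S i) w * (k (stat S n w) * h (hist n w)) \<partial>Prob S)"
      by (intro Bochner_Integration.integral_cong) (auto simp: hyp)
    finally show ?thesis
      by (subst (1 2) integral_given[OF i]) auto
  qed
  have um[measurable]: "(\<lambda>z. ?u (fst (snd (snd z)))) \<in> borel_measurable (hist_space n)"
    by measurable
  have "(\<integral>w. indicator A w * f (hist n w) \<partial>Prob_given S i) = (\<integral>w. k (stat S n w) * f (hist n w) \<partial>Prob_given S i)"
    using int by (intro key) auto
  also have "\<dots> = (\<integral>w. k (stat S n w) * ?u (stat S n w) \<partial>Prob_given S i)"
  proof (rule Pi.cexp_given_integral(2)[symmetric, OF st k])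
    show "integrable (Prob_given S i) (\<lambda>w. k (stat S n w) * f (hist n w))"
      by (rule Bochner_Integration.integrable_bound[OF int])
        (use k01 in \<open>auto simp: abs_mult mult_left_le_one_le\<close>)
  qed simp
  also have "\<dots> = (\<integral>w. k (stat S n w) * ?u (fst (snd (snd (hist n w)))) \<partial>Prob_given S i)"
    by (simp add: hist_def)
  also have "\<dots> = (\<integral>w. indicator A w * ?u (fst (snd (snd (hist n w)))) \<partial>Prob_given S i)"
    using Pi.cexp_given_integrable[OF st int] by (intro key[symmetric, OF um]) (simp add: hist_def)
  finally show ?thesis
    by (simp add: hist_def)
qed

section \<open>The transition kernel of the statistic\<close>

lemma next_law_subprob[measurable]: "next_law S n \<in> T_space S \<rightarrow>\<^sub>M subprob_algebra (X_ref S)"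
  using next_law_kernel by (rule measurable_prob_algebraD)

lemma
  assumes "t \<in> space (T_space S)"
  shows prob_space_next_law: "prob_space (next_law S n t)"
    and sets_next_law: "sets (next_law S n t) = sets (X_ref S)"
  using next_law_kernel[of n, THEN measurable_space, OF assms] by (auto simp: space_prob_algebra)

lemma t_step_measurable_snd:
  "t \<in> space (T_space S) \<Longrightarrow> t_step S t \<in> next_law S n t \<rightarrow>\<^sub>M T_space S"
  unfolding measurable_cong_sets[OF sets_next_law refl]
  by (rule t_step_measurable) auto

lemma Q_kernel_measurable[measurable]: "Q_kernel S n \<in> T_space S \<rightarrow>\<^sub>M subprob_algebra (T_space S)"
  unfolding Q_kernel_def using t_step by (intro measurable_distr2[where M="X_ref S"]) auto

lemma
  shows sets_Q_kernel[simp, measurable_cong]: "sets (Q_kernel S n t) = sets (T_space S)"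
    and space_Q_kernel[simp]: "space (Q_kernel S n t) = space (T_space S)"
  by (auto simp: Q_kernel_def)

lemma next_pair_kernel:
  "(\<lambda>t. distr (next_law S n t) (T_space S \<Otimes>\<^sub>M X_ref S) (Pair t))
     \<in> T_space S \<rightarrow>\<^sub>M subprob_algebra (T_space S \<Otimes>\<^sub>M X_ref S)"
proof (rule measurable_distr2[OF _ next_law_subprob])
  show "(\<lambda>(t, x). (t, x)) \<in> T_space S \<Otimes>\<^sub>M X_ref S \<rightarrow>\<^sub>M T_space S \<Otimes>\<^sub>M X_ref S"
    by simp
qed

text \<open>For each fixed set, \<open>next_law_version\<close> holds outside a null set that
  depends on that set. Integrating over rectangles removes this dependence, and the rectangles form
  an intersection-stable generator, so they determine the joint law.\<close>

lemma next_joint: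
  "distr (Prob S) (T_space S \<Otimes>\<^sub>M X_ref S) (\<lambda>w. (stat S n w, Obs S (Suc n) w)) =
   Giry_Monad.bind (distr (Prob S) (T_space S) (stat S n))
     (\<lambda>t. distr (next_law S n t) (T_space S \<Otimes>\<^sub>M X_ref S) (Pair t))"
  (is "?M1 = Giry_Monad.bind ?D ?K")
proof (rule measure_eqI_generator_eq[OF Int_stable_pair_measure_generator[of "T_space S" "X_ref S"]])
  note K = next_pair_kernel
  have K': "?K \<in> ?D \<rightarrow>\<^sub>M subprob_algebra (T_space S \<Otimes>\<^sub>M X_ref S)"
    using K by (simp only: measurable_distr_eq1)
  have ne: "space ?D \<noteq> {}"
    using t_init by auto
  show "sets ?M1 = sigma_sets (space (T_space S) \<times> space (X_ref S)) {a \<times> b |a b. a \<in> sets (T_space S) \<and> b \<in> sets (X_ref S)}"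
    by (simp add: sets_pair_measure)
  show "sets (Giry_Monad.bind ?D ?K) = sigma_sets (space (T_space S) \<times> space (X_ref S)) {a \<times> b |a b. a \<in> sets (T_space S) \<and> b \<in> sets (X_ref S)}"
    unfolding sets_pair_measure[symmetric] by (rule sets_bind[OF sets_kernel[OF K'] ne])
  show "{a \<times> b |a b. a \<in> sets (T_space S) \<and> b \<in> sets (X_ref S)} \<subseteq> Pow (space (T_space S) \<times> space (X_ref S))"
    by (auto dest: sets.sets_into_space)
  show "range (\<lambda>k::nat. space (T_space S) \<times> space (X_ref S)) \<subseteq> {a \<times> b |a b. a \<in> sets (T_space S) \<and> b \<in> sets (X_ref S)}"
    by auto
  show "(\<Union>k::nat. space (T_space S) \<times> space (X_ref S)) = space (T_space S) \<times> space (X_ref S)"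
    by auto
  interpret M1: prob_space ?M1
    by (rule prob_space_distr) simp
  show "emeasure ?M1 (space (T_space S) \<times> space (X_ref S)) \<noteq> \<infinity>" for k :: nat
    by simp
  fix X assume "X \<in> {a \<times> b |a b. a \<in> sets (T_space S) \<and> b \<in> sets (X_ref S)}"
  then obtain a b where X: "X = a \<times> b" and a[measurable]: "a \<in> sets (T_space S)"
    and b[measurable]: "b \<in> sets (X_ref S)"
    by auto
  have Xs: "X \<in> sets (T_space S \<Otimes>\<^sub>M X_ref S)"
    unfolding X by measurable
  let ?B = "{w \<in> space (Prob S). Obs S (Suc n) w \<in> b}"
  let ?m = "\<lambda>w. measure (next_law S n (stat S n w)) b"
  have [measurable]: "(\<lambda>t. measure (next_law S n t) b) \<in> borel_measurable (T_space S)"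
    by (rule measurable_compose[OF next_law_subprob]) simp
  note [measurable] = measurable_from_subalg[OF subalgebra_stat borel_measurable_cond_exp]
  have m1: "?m w \<le> 1" if "w \<in> space (Prob S)" for w
    using prob_space.prob_le_1[OF prob_space_next_law] measurable_space[OF stat_measurable that] by auto
  have int: "(\<integral>w. indicator a (stat S n w) * indicat_real ?B w \<partial>Prob S)
      = (\<integral>w. indicat_real a (stat S n w) * real_cond_exp (Prob S) (stat_alg S n) (indicat_real ?B) w \<partial>Prob S)"
  proof (rule stat.real_cond_exp_intg(2)[symmetric])
    show "integrable (Prob S) (\<lambda>w. indicat_real a (stat S n w) * indicat_real ?B w)"
      by (intro integrable_const_bound[of _ 1]) (auto simp: indicator_def)
    show "(\<lambda>w. indicat_real a (stat S n w)) \<in> borel_measurable (stat_alg S n)"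
      by (rule measurable_compose[OF stat_stat_alg borel_measurable_indicator[OF a]])
  qed measurable
  also have "\<dots> = (\<integral>w. indicat_real a (stat S n w) * ?m w \<partial>Prob S)"
    using next_law_version[OF b, of n] by (intro integral_cong_AE) auto
  finally have int: "(\<integral>w. indicator a (stat S n w) * indicat_real ?B w \<partial>Prob S)
      = (\<integral>w. indicat_real a (stat S n w) * ?m w \<partial>Prob S)" .
  have "emeasure ?M1 X = emeasure (Prob S) {w \<in> space (Prob S). stat S n w \<in> a \<and> w \<in> ?B}"
    unfolding X by (subst emeasure_distr) (auto intro!: arg_cong[where f="emeasure (Prob S)"])
  also have "\<dots> = ennreal (\<integral>w. indicat_real {w \<in> space (Prob S). stat S n w \<in> a \<and> w \<in> ?B} w \<partial>Prob S)"
    by (simp add: emeasure_eq_measure)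
  also have "\<dots> = ennreal (\<integral>w. indicator a (stat S n w) * indicat_real ?B w \<partial>Prob S)"
    by (intro arg_cong[where f=ennreal] Bochner_Integration.integral_cong) (auto simp: indicator_def)
  also have "\<dots> = ennreal (\<integral>w. indicat_real a (stat S n w) * ?m w \<partial>Prob S)"
    unfolding int ..
  also have "\<dots> = (\<integral>\<^sup>+w. ennreal (indicat_real a (stat S n w) * ?m w) \<partial>Prob S)"
  proof (rule nn_integral_eq_integral[symmetric])
    show "integrable (Prob S) (\<lambda>w. indicat_real a (stat S n w) * ?m w)"
      by (rule integrable_const_bound[of _ 1]) (auto simp: indicator_def m1)
  qed simp
  also have "\<dots> = (\<integral>\<^sup>+w. emeasure (?K (stat S n w)) X \<partial>Prob S)"
  proof (rule nn_integral_cong)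
    fix w assume "w \<in> space (Prob S)"
    then have t: "stat S n w \<in> space (T_space S)"
      by (rule measurable_space[OF stat_measurable])
    interpret L: prob_space "next_law S n (stat S n w)"
      by (rule prob_space_next_law[OF t])
    note [measurable_cong] = sets_next_law[OF t]
    have "emeasure (?K (stat S n w)) X
        = emeasure (next_law S n (stat S n w)) (Pair (stat S n w) -` X \<inter> space (next_law S n (stat S n w)))"
      unfolding X using t by (subst emeasure_distr) auto
    also have "Pair (stat S n w) -` X \<inter> space (next_law S n (stat S n w)) = (if stat S n w \<in> a then b else {})"
      using sets.sets_into_space[OF b] sets_eq_imp_space_eq[OF sets_next_law[OF t]] by (auto simp: X)
    finally show "ennreal (indicat_real a (stat S n w) * ?m w) = emeasure (?K (stat S n w)) X"
      by (simp add: L.emeasure_eq_measure)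
  qed
  also have "\<dots> = emeasure (Giry_Monad.bind ?D ?K) X"
    using measurable_compose[OF K measurable_emeasure_subprob_algebra[OF Xs]]
    by (subst emeasure_bind[OF ne K' Xs]) (simp add: nn_integral_distr)
  finally show "emeasure ?M1 X = emeasure (Giry_Monad.bind ?D ?K) X" .
qed

text \<open>The disintegration pushed forward along \<open>t_step\<close>. Both functions take
  values in \<open>ennreal\<close>, so integrability is not an issue; questions about null sets and
  about integrability can be decided by this identity.\<close>

lemma nn_integral_Q_kernel:
  assumes f[measurable]: "f \<in> borel_measurable (T_space S)" and h[measurable]: "h \<in> borel_measurable (T_space S)"
  shows "(\<integral>\<^sup>+w. h (stat S n w) * f (stat S (Suc n) w) \<partial>Prob S)
    = (\<integral>\<^sup>+w. h (stat S n w) * (\<integral>\<^sup>+s. f s \<partial>Q_kernel S n (stat S n w)) \<partial>Prob S)"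
proof -
  let ?F = "\<lambda>(t, x). h t * f (t_step S t x)"
  let ?K = "\<lambda>t. distr (next_law S n t) (T_space S \<Otimes>\<^sub>M X_ref S) (Pair t)"
  note K = next_pair_kernel
  have F: "?F \<in> borel_measurable (T_space S \<Otimes>\<^sub>M X_ref S)"
    by measurable
  have "(\<integral>\<^sup>+w. h (stat S n w) * f (stat S (Suc n) w) \<partial>Prob S)
      = (\<integral>\<^sup>+y. ?F y \<partial>distr (Prob S) (T_space S \<Otimes>\<^sub>M X_ref S) (\<lambda>w. (stat S n w, Obs S (Suc n) w)))"
    using F by (subst nn_integral_distr) auto
  also have "\<dots> = (\<integral>\<^sup>+t. \<integral>\<^sup>+y. ?F y \<partial>?K t \<partial>distr (Prob S) (T_space S) (stat S n))"
    unfolding next_joint using K F by (intro nn_integral_bind[where B="T_space S \<Otimes>\<^sub>M X_ref S"])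
      (simp_all only: measurable_distr_eq1)
  also have "\<dots> = (\<integral>\<^sup>+w. \<integral>\<^sup>+y. ?F y \<partial>?K (stat S n w) \<partial>Prob S)"
    using measurable_compose[OF K nn_integral_measurable_subprob_algebra[OF F]]
    by (intro nn_integral_distr stat_measurable) (simp only: measurable_distr_eq1)
  also have "\<dots> = (\<integral>\<^sup>+w. h (stat S n w) * (\<integral>\<^sup>+s. f s \<partial>Q_kernel S n (stat S n w)) \<partial>Prob S)"
  proof (rule nn_integral_cong)
    fix w assume "w \<in> space (Prob S)"
    then have t[measurable]: "stat S n w \<in> space (T_space S)"
      by (rule measurable_space[OF stat_measurable])
    note [measurable_cong] = sets_next_law[OF t]
    note [measurable] = t_step_measurable_snd[OF t, of n]
    have "(\<integral>\<^sup>+y. ?F y \<partial>?K (stat S n w)) = (\<integral>\<^sup>+x. h (stat S n w) * f (t_step S (stat S n w) x) \<partial>next_law S n (stat S n w))"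
      using F t by (subst nn_integral_distr) auto
    also have "\<dots> = h (stat S n w) * (\<integral>\<^sup>+x. f (t_step S (stat S n w) x) \<partial>next_law S n (stat S n w))"
      by (intro nn_integral_cmult) measurable
    also have "(\<integral>\<^sup>+x. f (t_step S (stat S n w) x) \<partial>next_law S n (stat S n w)) = (\<integral>\<^sup>+s. f s \<partial>Q_kernel S n (stat S n w))"
      unfolding Q_kernel_def by (subst nn_integral_distr) auto
    finally show "(\<integral>\<^sup>+y. ?F y \<partial>?K (stat S n w)) = h (stat S n w) * (\<integral>\<^sup>+s. f s \<partial>Q_kernel S n (stat S n w))" .
  qed
  finally show ?thesis .
qed

text \<open>The mean kernel mass of the exceptional set is the probability that the next statistic
  falls into it, namely 0. This carries a property valid for almost every value at time
  \<open>n + 1\<close> back to time \<open>n\<close>, as a property valid almost everywhere for the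
  kernel.\<close>

lemma AE_Q_kernel:
  assumes G[measurable]: "Measurable.pred (T_space S) G" and ae: "AE w in Prob S. G (stat S (Suc n) w)"
  shows "AE w in Prob S. AE s in Q_kernel S n (stat S n w). G s"
proof -
  let ?f = "\<lambda>t. of_bool (\<not> G t) :: ennreal"
  have f: "?f \<in> borel_measurable (T_space S)"
    by measurable
  have [measurable]: "(\<lambda>t. \<integral>\<^sup>+s. ?f s \<partial>Q_kernel S n t) \<in> borel_measurable (T_space S)"
    by (rule measurable_compose[OF Q_kernel_measurable nn_integral_measurable_subprob_algebra[OF f]])
  have "(\<integral>\<^sup>+w. 1 * (\<integral>\<^sup>+s. ?f s \<partial>Q_kernel S n (stat S n w)) \<partial>Prob S)
      = (\<integral>\<^sup>+w. 1 * ?f (stat S (Suc n) w) \<partial>Prob S)"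
    by (rule nn_integral_Q_kernel[symmetric]) auto
  also have "\<dots> = (\<integral>\<^sup>+w. 0 \<partial>Prob S)"
    using ae by (intro nn_integral_cong_AE) auto
  finally have "(\<integral>\<^sup>+w. (\<integral>\<^sup>+s. ?f s \<partial>Q_kernel S n (stat S n w)) \<partial>Prob S) = 0"
    by simp
  then have "AE w in Prob S. (\<integral>\<^sup>+s. ?f s \<partial>Q_kernel S n (stat S n w)) = 0"
    by (subst (asm) nn_integral_0_iff_AE) auto
  then show ?thesis
  proof eventually_elim
    case (elim w)
    then show ?case
      by (subst (asm) nn_integral_0_iff_AE) auto
  qed
qed

text \<open>Almost sure nonnegativity lets everything be computed with \<open>ennreal\<close>
  integrals first. As the Bochner integral is 0 by default for a non-integrable function, the two
  kinds of integral are identified only after integrability for the kernel is known at almost every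
  statistic.\<close>

lemma integral_Q_kernel:
  fixes f :: "'t \<Rightarrow> real"
  assumes f[measurable]: "f \<in> borel_measurable (T_space S)"
    and nonneg: "AE w in Prob S. 0 \<le> f (stat S (Suc n) w)"
    and int: "integrable (Prob S) (\<lambda>w. f (stat S (Suc n) w))"
  shows "AE w in Prob S. integrable (Q_kernel S n (stat S n w)) f"
    and "integrable (Prob S) (\<lambda>w. \<integral>s. f s \<partial>Q_kernel S n (stat S n w))"
    and "AE w in Prob S. cexp_given (Prob S) (T_space S) (stat S n) (\<lambda>w. f (stat S (Suc n) w)) (stat S n w)
      = (\<integral>s. f s \<partial>Q_kernel S n (stat S n w))"
proof -
  let ?q = "\<lambda>t. \<integral>s. f s \<partial>Q_kernel S n t" and ?nq = "\<lambda>t. \<integral>\<^sup>+s. ennreal (f s) \<partial>Q_kernel S n t"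
  have [measurable]: "?q \<in> borel_measurable (T_space S)"
    by (rule measurable_compose[OF Q_kernel_measurable integral_measurable_subprob_algebra]) simp
  have nqm[measurable]: "?nq \<in> borel_measurable (T_space S)"
    by (rule measurable_compose[OF Q_kernel_measurable nn_integral_measurable_subprob_algebra]) simp
  have "Measurable.pred (T_space S) (\<lambda>t. 0 \<le> f t)"
    by measurable
  from AE_Q_kernel[OF this nonneg]
  have nn: "AE w in Prob S. AE s in Q_kernel S n (stat S n w). 0 \<le> f s" .
  have "(\<integral>\<^sup>+w. 1 * ?nq (stat S n w) \<partial>Prob S) = (\<integral>\<^sup>+w. 1 * ennreal (f (stat S (Suc n) w)) \<partial>Prob S)"
    by (rule nn_integral_Q_kernel[symmetric]) auto
  also have "\<dots> = ennreal (\<integral>w. f (stat S (Suc n) w) \<partial>Prob S)"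
    using int nonneg by (simp add: nn_integral_eq_integral)
  finally have fin: "(\<integral>\<^sup>+w. ?nq (stat S n w) \<partial>Prob S) < \<infinity>"
    by simp
  then have "AE w in Prob S. ?nq (stat S n w) \<noteq> \<infinity>"
    by (intro nn_integral_noteq_infinite) auto
  with nn show aei: "AE w in Prob S. integrable (Q_kernel S n (stat S n w)) f"
  proof eventually_elim
    case (elim w)
    then show ?case
      by (intro integrableI_nonneg) (auto simp: less_top[symmetric])
  qed
  have eq: "AE w in Prob S. ?nq (stat S n w) = ennreal (?q (stat S n w))"
    using nn aei by eventually_elim (simp add: nn_integral_eq_integral)
  have qnn: "AE w in Prob S. 0 \<le> ?q (stat S n w)"
    using nn by eventually_elim (rule integral_nonneg_AE)
  have "(\<integral>\<^sup>+w. ennreal (?q (stat S n w)) \<partial>Prob S) = (\<integral>\<^sup>+w. ?nq (stat S n w) \<partial>Prob S)"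
    using eq by (intro nn_integral_cong_AE) auto
  with fin qnn show qint: "integrable (Prob S) (\<lambda>w. ?q (stat S n w))"
    by (intro integrableI_nonneg) auto
  show "AE w in Prob S. cexp_given (Prob S) (T_space S) (stat S n) (\<lambda>w. f (stat S (Suc n) w)) (stat S n w)
      = ?q (stat S n w)"
  proof (rule cexp_given_charact)
    fix A assume A[measurable]: "A \<in> sets (T_space S)"
    have *: "(\<integral>\<^sup>+w. ennreal (indicator A (stat S n w) * h w) \<partial>Prob S)
        = ennreal (\<integral>w. indicator A (stat S n w) * h w \<partial>Prob S)"
      if "integrable (Prob S) h" "AE w in Prob S. 0 \<le> h w" for h :: "'w \<Rightarrow> real"
    proof (rule nn_integral_eq_integral)
      show "integrable (Prob S) (\<lambda>w. indicator A (stat S n w) * h w)"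
        by (rule Bochner_Integration.integrable_bound[OF that(1)])
          (use that in \<open>auto simp: indicator_def\<close>)
      show "AE w in Prob S. 0 \<le> indicat_real A (stat S n w) * h w"
        using that(2) by eventually_elim simp
    qed
    have "ennreal (\<integral>w. indicator A (stat S n w) * f (stat S (Suc n) w) \<partial>Prob S)
        = (\<integral>\<^sup>+w. indicator A (stat S n w) * ennreal (f (stat S (Suc n) w)) \<partial>Prob S)"
      using int nonneg by (subst *[symmetric]) (auto simp: ennreal_mult' ennreal_indicator)
    also have "\<dots> = (\<integral>\<^sup>+w. indicator A (stat S n w) * ?nq (stat S n w) \<partial>Prob S)"
      by (rule nn_integral_Q_kernel) auto
    also have "\<dots> = (\<integral>\<^sup>+w. ennreal (indicator A (stat S n w) * ?q (stat S n w)) \<partial>Prob S)"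
      using eq by (intro nn_integral_cong_AE) (auto simp: ennreal_mult' ennreal_indicator)
    also have "\<dots> = ennreal (\<integral>w. indicator A (stat S n w) * ?q (stat S n w) \<partial>Prob S)"
      using qint qnn by (rule *)
    finally have "ennreal (\<integral>w. indicator A (stat S n w) * f (stat S (Suc n) w) \<partial>Prob S)
      = ennreal (\<integral>w. indicator A (stat S n w) * ?q (stat S n w) \<partial>Prob S)" .
    moreover have "0 \<le> (\<integral>w. indicator A (stat S n w) * f (stat S (Suc n) w) \<partial>Prob S)"
      using nonneg by (intro integral_nonneg_AE) auto
    moreover have "0 \<le> (\<integral>w. indicator A (stat S n w) * ?q (stat S n w) \<partial>Prob S)"
      using qnn by (intro integral_nonneg_AE) auto
    ultimately show "(\<integral>w. indicator A (stat S n w) * f (stat S (Suc n) w) \<partial>Prob S)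
      = (\<integral>w. indicator A (stat S n w) * ?q (stat S n w) \<partial>Prob S)"
      by simp
  qed (use int qint in auto)
qed

end

section \<open>Posteriors and density ratios\<close>

context seq_model
begin

lemma posterior_z_ratio:
  assumes i: "i \<in> {0, 1}"
  shows "AE w in Prob S. posterior S i n (stat S n w) = prior S i * z_ratio S i n (stat S n w)"
  unfolding posterior_def
proof (rule cexp_given_charact)
  have [measurable]: "pdf_T S n \<in> borel_measurable (T_space S)"
    using distributed_real_measurable[OF _ pdf_T] pdf_T_nonneg measurable_cong_sets[OF T_ref_sets refl] by blast
  have [measurable]: "pdf_T_given S i n \<in> borel_measurable (T_space S)"
    using distributed_real_measurable[OF _ pdf_T_given] pdf_T_given_nonneg i measurable_cong_sets[OF T_ref_sets refl]
    by blast
  note [measurable_cong] = T_ref_sets[of n]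
  have zm[measurable]: "(\<lambda>t. prior S i * z_ratio S i n t) \<in> borel_measurable (T_space S)"
    unfolding z_ratio_def by measurable
  show "(\<lambda>t. prior S i * z_ratio S i n t) \<in> borel_measurable (T_space S)"
    by (rule zm)
  have Pi: "prob_space (Prob_given S i)"
    by (rule prob_space_given[OF i])
  \<comment> \<open>Where \<open>pdf_T\<close> is 0, division by zero makes \<open>z_ratio\<close>
    equal to 0, whatever \<open>pdf_T_given\<close> is. The computation with densities therefore
    sees only this set; its complement has probability zero, also under the hypothesis.\<close>
  let ?pos = "{t \<in> space (T_space S). pdf_T S n t \<noteq> 0}"
  have eq: "pdf_T S n t * (indicator A t * (prior S i * z_ratio S i n t))
      = prior S i * (pdf_T_given S i n t * indicator (A \<inter> ?pos) t)" if "t \<in> space (T_space S)" for t A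
    using that by (auto simp: z_ratio_def indicator_def)
  have sp: "space (T_ref S n) = space (T_space S)"
    by (rule sets_eq_imp_space_eq[OF T_ref_sets])
  have int: "integrable (Prob S) (\<lambda>w. indicator A (stat S n w) * (prior S i * z_ratio S i n (stat S n w)))" (is ?int)
    and eq_int: "(\<integral>w. indicator A (stat S n w) * (prior S i * z_ratio S i n (stat S n w)) \<partial>Prob S)
      = prior S i * (\<integral>w. indicator (A \<inter> ?pos) (stat S n w) \<partial>Prob_given S i)" (is ?eq)
    if A[measurable]: "A \<in> sets (T_space S)" for A
  proof -
    have m1: "(\<lambda>t. indicator A t * (prior S i * z_ratio S i n t)) \<in> borel_measurable (T_ref S n)"
      by measurable
    have m2: "indicat_real (A \<inter> ?pos) \<in> borel_measurable (T_ref S n)"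
      by measurable
    interpret Pi: prob_space "Prob_given S i" by (rule Pi)
    have "integrable (Prob_given S i) (\<lambda>w. indicat_real (A \<inter> ?pos) (stat S n w))"
      by (rule Pi.integrable_const_bound[of _ 1]) (auto simp: indicator_def)
    then have "integrable (T_ref S n) (\<lambda>t. pdf_T_given S i n t * indicat_real (A \<inter> ?pos) t)"
      using distributed_integrable[OF pdf_T_given[OF i] m2] pdf_T_given_nonneg[OF i] by simp
    then have "integrable (T_ref S n) (\<lambda>t. prior S i * (pdf_T_given S i n t * indicat_real (A \<inter> ?pos) t))"
      by simp
    then have "integrable (T_ref S n) (\<lambda>t. pdf_T S n t * (indicator A t * (prior S i * z_ratio S i n t)))"
      by (rule Bochner_Integration.integrable_cong[THEN iffD1, rotated -1]) (simp_all add: sp eq)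
    then show ?int
      using distributed_integrable[OF pdf_T m1] pdf_T_nonneg by simp
    have "(\<integral>w. indicator A (stat S n w) * (prior S i * z_ratio S i n (stat S n w)) \<partial>Prob S)
        = (\<integral>t. pdf_T S n t * (indicator A t * (prior S i * z_ratio S i n t)) \<partial>T_ref S n)"
      using distributed_integral[OF pdf_T m1] pdf_T_nonneg by simp
    also have "\<dots> = (\<integral>t. prior S i * (pdf_T_given S i n t * indicat_real (A \<inter> ?pos) t) \<partial>T_ref S n)"
      by (intro Bochner_Integration.integral_cong) (simp_all add: sp eq)
    also have "\<dots> = prior S i * (\<integral>t. pdf_T_given S i n t * indicat_real (A \<inter> ?pos) t \<partial>T_ref S n)"
      by simp
    also have "(\<integral>t. pdf_T_given S i n t * indicat_real (A \<inter> ?pos) t \<partial>T_ref S n)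
        = (\<integral>w. indicator (A \<inter> ?pos) (stat S n w) \<partial>Prob_given S i)"
      using distributed_integral[OF pdf_T_given[OF i] m2] pdf_T_given_nonneg[OF i] by simp
    finally show ?eq .
  qed
  have "integrable (Prob S) (\<lambda>w. indicator (space (T_space S)) (stat S n w) * (prior S i * z_ratio S i n (stat S n w)))"
    by (rule int) simp
  then show "integrable (Prob S) (\<lambda>w. prior S i * z_ratio S i n (stat S n w))"
    by (rule Bochner_Integration.integrable_cong[THEN iffD1, rotated -1])
       (auto simp: measurable_space[OF stat_measurable])
  have pos: "AE w in Prob S. stat S n w \<in> ?pos"
  proof -
    let ?Z = "{t \<in> space (T_space S). pdf_T S n t = 0}"
    have Z: "?Z \<in> sets (T_ref S n)" by measurable
    have "emeasure (Prob S) (stat S n -` ?Z \<inter> space (Prob S))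
        = (\<integral>\<^sup>+t. ennreal (pdf_T S n t) * indicator ?Z t \<partial>T_ref S n)"
      by (rule distributed_emeasure[OF pdf_T Z])
    also have "\<dots> = (\<integral>\<^sup>+t. 0 \<partial>T_ref S n)"
      by (intro nn_integral_cong) (auto simp: indicator_def)
    finally have "AE w in Prob S. w \<notin> stat S n -` ?Z \<inter> space (Prob S)"
      by (intro AE_not_in) (auto simp: null_sets_def)
    then show ?thesis
      using AE_space
      by eventually_elim (auto simp: measurable_space[OF stat_measurable])
  qed
  fix A assume A[measurable]: "A \<in> sets (T_space S)"
  have posi: "AE w in Prob_given S i. stat S n w \<in> ?pos"
    using pos unfolding AE_given[OF i] by eventually_elim simp
  have "(\<integral>w. indicator A (stat S n w) * (prior S i * z_ratio S i n (stat S n w)) \<partial>Prob S)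
      = prior S i * (\<integral>w. indicator (A \<inter> ?pos) (stat S n w) \<partial>Prob_given S i)"
    by (rule eq_int[OF A])
  also have "(\<integral>w. indicator (A \<inter> ?pos) (stat S n w) \<partial>Prob_given S i)
      = (\<integral>w. indicat_real A (stat S n w) \<partial>Prob_given S i)"
    using posi by (intro integral_cong_AE) (auto simp: indicator_def)
  also have "prior S i * \<dots> = (\<integral>w. indicator (hyp_event S i) w * indicat_real A (stat S n w) \<partial>Prob S)"
    using prior_pos[OF i] by (subst integral_given[OF i]) auto
  finally show "(\<integral>w. indicator A (stat S n w) * indicator (hyp_event S i) w \<partial>Prob S)
      = (\<integral>w. indicator A (stat S n w) * (prior S i * z_ratio S i n (stat S n w)) \<partial>Prob S)"
    by (simp add: mult.commute)
qed simp_all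

text \<open>The initial statistic is constant, so conditioning on it gives the prior. The almost
  sure identity of Bayes then concerns a constant and holds outright.\<close>

lemma z_ratio_init:
  assumes i: "i \<in> {0, 1}" shows "z_ratio S i 0 (t_init S) = 1"
proof -
  have "AE w in Prob S. posterior S i 0 (stat S 0 w) = prior S i"
    unfolding posterior_def
  proof (rule cexp_given_charact)
    fix A assume "A \<in> sets (T_space S)"
    show "(\<integral>w. indicator A (stat S 0 w) * indicator (hyp_event S i) w \<partial>Prob S)
        = (\<integral>w. indicator A (stat S 0 w) * prior S i \<partial>Prob S)"
      by (simp add: prob_hyp_event[OF i] prob_space)
  qed (use t_init in simp_all)
  with posterior_z_ratio[OF i, of 0]
  have "AE w in Prob S. prior S i * z_ratio S i 0 (t_init S) = prior S i"
    by eventually_elim simp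
  then show ?thesis
    using prior_pos[OF i] by simp
qed

text \<open>Tested on events of the current statistic, the posterior at time \<open>n + 1\<close>
  becomes restriction to the hypothesis; under it \<open>R\<close> is replaced by its conditional
  mean \<open>?u\<close>, and the restriction is turned into the posterior at time \<open>n\<close>.
  With \<open>R\<close> the risk at time \<open>n + 1\<close>, this matches the derivative of the
  continuation cost with the continuation term of the recursion.\<close>

lemma integral_posterior_Q_kernel:
  assumes i: "i \<in> {0, 1}" and R[measurable]: "R \<in> borel_measurable (T_space S)"
    and nonneg: "AE w in Prob_given S i. 0 \<le> R (stat S (Suc n) w)"
    and int: "integrable (Prob_given S i) (\<lambda>w. R (stat S (Suc n) w))"
  shows "AE w in Prob S. (\<integral>s. posterior S i (Suc n) s * R s \<partial>Q_kernel S n (stat S n w))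
    = posterior S i n (stat S n w)
      * cexp_given (Prob_given S i) (T_space S) (stat S n) (\<lambda>w. R (stat S (Suc n) w)) (stat S n w)"
proof -
  interpret Pi: prob_space "Prob_given S i"
    by (rule prob_space_given[OF i])
  have stm: "stat S n \<in> Prob_given S i \<rightarrow>\<^sub>M T_space S"
    by simp
  let ?f = "\<lambda>s. posterior S i (Suc n) s * R s"
  let ?u = "cexp_given (Prob_given S i) (T_space S) (stat S n) (\<lambda>w. R (stat S (Suc n) w))"
  have f: "?f \<in> borel_measurable (T_space S)"
    by measurable
  have R_obs: "(\<lambda>w. R (stat S (Suc n) w)) \<in> borel_measurable (obs_alg S (Suc n))"
    by (rule measurable_compose[OF stat_obs_alg R]) simp
  have int': "integrable (Prob S) (\<lambda>w. R (stat S (Suc n) w) * indicator (hyp_event S i) w)"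
    using int by (subst (asm) integrable_given[OF i]) (auto simp: mult.commute simp del: stat.simps)
  have f_int: "integrable (Prob S) (\<lambda>w. ?f (stat S (Suc n) w))"
    using posterior_integral(1)[OF i R_obs int'] by (simp add: mult.commute)
  \<comment> \<open>The sign of \<open>R\<close> is known only under the hypothesis. Where it fails
    the posterior is almost surely 0, so the product is nonnegative under the full measure.\<close>
  have "{t \<in> space (T_space S). 0 \<le> R t} \<in> sets (T_space S)"
    by measurable
  from AE_given_stat[OF i this nonneg] posterior_bounds[of i "Suc n"]
  have f_nonneg: "AE w in Prob S. 0 \<le> ?f (stat S (Suc n) w)"
    by eventually_elim auto
  have u_int: "integrable (Prob_given S i) (\<lambda>w. ?u (stat S n w))"
    by (rule Pi.cexp_given_integrable[OF stm int])
  then have u_int': "integrable (Prob S) (\<lambda>w. ?u (stat S n w) * indicator (hyp_event S i) w)"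
    by (subst (asm) integrable_given[OF i]) (auto simp: mult.commute)
  have obs_n: "(\<lambda>w. h (stat S n w)) \<in> borel_measurable (obs_alg S m)"
    if "n \<le> m" "h \<in> borel_measurable (T_space S)" for h :: "'t \<Rightarrow> real" and m
    using that by (intro measurable_compose[OF stat_obs_alg])
  have pu_int: "integrable (Prob S) (\<lambda>w. posterior S i n (stat S n w) * ?u (stat S n w))"
    using posterior_integral(1)[OF i obs_n[of n ?u] u_int'] by (simp add: mult.commute)
  have "AE w in Prob S. cexp_given (Prob S) (T_space S) (stat S n) (\<lambda>w. ?f (stat S (Suc n) w)) (stat S n w)
    = posterior S i n (stat S n w) * ?u (stat S n w)"
  proof (rule cexp_given_charact)
    fix A assume A[measurable]: "A \<in> sets (T_space S)"
    have RA_int: "integrable (Prob_given S i) (\<lambda>w. indicator A (stat S n w) * R (stat S (Suc n) w))"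
      by (rule Bochner_Integration.integrable_bound[OF int])
         (auto simp: indicator_def simp del: stat.simps)
    have uA_int: "integrable (Prob_given S i) (\<lambda>w. indicator A (stat S n w) * ?u (stat S n w))"
      by (rule Bochner_Integration.integrable_bound[OF u_int]) (auto simp: indicator_def)
    have Am: "indicat_real A \<in> borel_measurable (T_space S)"
      by simp
    have um: "?u \<in> borel_measurable (T_space S)"
      by simp
    have RA_obs: "(\<lambda>w. indicator A (stat S n w) * R (stat S (Suc n) w)) \<in> borel_measurable (obs_alg S (Suc n))"
      by (rule borel_measurable_times[OF obs_n[OF _ Am] R_obs]) simp
    have uA_obs: "(\<lambda>w. indicator A (stat S n w) * ?u (stat S n w)) \<in> borel_measurable (obs_alg S n)"
      by (rule borel_measurable_times[OF obs_n[OF _ Am] obs_n[OF _ um]]) simp_all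
    have RA_int': "integrable (Prob S) (\<lambda>w. indicator A (stat S n w) * R (stat S (Suc n) w) * indicator (hyp_event S i) w)"
      using RA_int by (subst (asm) integrable_given[OF i]) (simp_all only: mult.commute, measurable)
    have uA_int': "integrable (Prob S) (\<lambda>w. indicator A (stat S n w) * ?u (stat S n w) * indicator (hyp_event S i) w)"
      using uA_int by (subst (asm) integrable_given[OF i]) (simp_all only: mult.commute, measurable)
    have "(\<integral>w. indicator A (stat S n w) * ?f (stat S (Suc n) w) \<partial>Prob S)
        = (\<integral>w. indicator A (stat S n w) * R (stat S (Suc n) w) * posterior S i (Suc n) (stat S (Suc n) w) \<partial>Prob S)"
      by (simp only: mult_ac)
    also have "\<dots> = (\<integral>w. indicator A (stat S n w) * R (stat S (Suc n) w) * indicator (hyp_event S i) w \<partial>Prob S)"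
      by (rule posterior_integral(2)[OF i RA_obs RA_int'])
    also have "\<dots> = prior S i * (\<integral>w. indicator A (stat S n w) * R (stat S (Suc n) w) \<partial>Prob_given S i)"
      using prior_pos[OF i] by (subst integral_given[OF i]) (simp_all only: mult_ac, simp_all del: stat.simps)
    also have "(\<integral>w. indicator A (stat S n w) * R (stat S (Suc n) w) \<partial>Prob_given S i)
        = (\<integral>w. indicator A (stat S n w) * ?u (stat S n w) \<partial>Prob_given S i)"
      using int by (intro Pi.cexp_given_integral(2)[symmetric, OF stm _ _ RA_int])
        (auto simp del: stat.simps)
    also have "prior S i * \<dots> = (\<integral>w. indicator A (stat S n w) * ?u (stat S n w) * indicator (hyp_event S i) w \<partial>Prob S)"
      using prior_pos[OF i] by (subst integral_given[OF i]) (simp_all add: mult_ac)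
    also have "\<dots> = (\<integral>w. indicator A (stat S n w) * ?u (stat S n w) * posterior S i n (stat S n w) \<partial>Prob S)"
      by (rule posterior_integral(2)[OF i uA_obs uA_int', symmetric])
    finally show "(\<integral>w. indicator A (stat S n w) * ?f (stat S (Suc n) w) \<partial>Prob S)
        = (\<integral>w. indicator A (stat S n w) * (posterior S i n (stat S n w) * ?u (stat S n w)) \<partial>Prob S)"
      by (simp only: mult_ac)
  next
    show "(\<lambda>t. posterior S i n t * ?u t) \<in> borel_measurable (T_space S)"
      by measurable
  qed (rule stat_measurable f_int pu_int)+
  with integral_Q_kernel(3)[OF f f_nonneg f_int] show ?thesis
    by eventually_elim (rule trans[OF sym])
qed

section \<open>Second moments, the estimator and its conditional squared error\<close>

lemma Theta_sq_integrable_given: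
  assumes i: "i \<in> {0, 1}"
  shows "integrable (Prob_given S i) (\<lambda>w. (Theta S w)\<^sup>2)"
proof -
  have "integrable (Prob S) (\<lambda>w. indicator (hyp_event S i) w * (Theta S w)\<^sup>2)"
    by (rule Bochner_Integration.integrable_bound[OF second_moment]) (auto simp: indicator_def)
  then show ?thesis
    by (subst integrable_given[OF i]) auto
qed

lemma Theta_integrable_given:
  assumes i: "i \<in> {0, 1}"
  shows "integrable (Prob_given S i) (Theta S)"
proof -
  interpret Pi: prob_space "Prob_given S i"
    by (rule prob_space_given[OF i])
  show ?thesis
    by (rule Pi.square_integrable_imp_integrable[OF _ Theta_sq_integrable_given[OF i]]) simp
qed

lemma subalgebra_given: "subalgebra (Prob_given S i) (obs_alg S n)" "subalgebra (Prob_given S i) (stat_alg S n)"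
  using subalgebra_obs[of n] subalgebra_stat[of n] by (auto simp: subalgebra_def)

abbreviation cond_mean :: "nat \<Rightarrow> nat \<Rightarrow> 't \<Rightarrow> real" where
  "cond_mean i n \<equiv> cexp_given (Prob_given S i) (T_space S) (stat S n) (Theta S)"

abbreviation mse :: "nat \<Rightarrow> nat \<Rightarrow> 't \<Rightarrow> real" where
  "mse i n \<equiv> cexp_given (Prob_given S i) (T_space S) (stat S n) (\<lambda>w. (estimator S i n w - Theta S w)\<^sup>2)"

lemma estimator_measurable[measurable]: "estimator S i n \<in> borel_measurable (Prob S)"
  unfolding estimator_def by (rule measurable_from_subalg[OF subalgebra_obs borel_measurable_cond_exp])

text \<open>Sufficiency applied to the parameter, the second component of \<open>hist\<close>: under
  the hypothesis, conditioning on all observations gives no more than conditioning on the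
  statistic.\<close>

lemma estimator_cond_mean:
  assumes i: "i \<in> {0, 1}"
  shows "AE w in Prob_given S i. estimator S i n w = cond_mean i n (stat S n w)"
proof -
  interpret Pi: prob_space "Prob_given S i"
    by (rule prob_space_given[OF i])
  interpret Po: sigma_finite_subalgebra "Prob_given S i" "obs_alg S n"
    by (rule Pi.sigma_finite_subalgebraI[OF subalgebra_given(1)])
  have stm: "stat S n \<in> Prob_given S i \<rightarrow>\<^sub>M T_space S"
    by simp
  show ?thesis
    unfolding estimator_def
  proof (rule Po.real_cond_exp_charact)
    fix A assume A: "A \<in> sets (obs_alg S n)"
    have "(\<integral>w. indicator A w * fst (snd (hist n w)) \<partial>Prob_given S i) =
      (\<integral>w. indicator A w * cexp_given (Prob_given S i) (T_space S) (stat S n) (\<lambda>w. fst (snd (hist n w))) (stat S n w) \<partial>Prob_given S i)"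
      using Theta_integrable_given[OF i] by (intro sufficient_given[OF i A]) (auto simp: hist_def)
    then show "(\<integral>w\<in>A. Theta S w \<partial>Prob_given S i) = (\<integral>w\<in>A. cond_mean i n (stat S n w) \<partial>Prob_given S i)"
      by (simp add: hist_def set_lebesgue_integral_def)
  next
    show "integrable (Prob_given S i) (\<lambda>w. cond_mean i n (stat S n w))"
      by (rule Pi.cexp_given_integrable[OF stm Theta_integrable_given[OF i]])
    show "(\<lambda>w. cond_mean i n (stat S n w)) \<in> borel_measurable (obs_alg S n)"
      by (rule measurable_compose[OF stat_obs_alg]) auto
  qed (rule Theta_integrable_given[OF i])
qed

text \<open>Conditional Jensen for the square bounds the second moment of the estimator by that of
  the parameter; then \<open>(a - b)\<^sup>2 \<le> 2 * a\<^sup>2 + 2 * b\<^sup>2\<close>.\<close>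

lemma sq_error_integrable:
  assumes i: "i \<in> {0, 1}"
  shows "integrable (Prob_given S i) (\<lambda>w. (estimator S i n w - Theta S w)\<^sup>2)"
proof -
  interpret Pi: prob_space "Prob_given S i"
    by (rule prob_space_given[OF i])
  interpret Po: sigma_finite_subalgebra "Prob_given S i" "obs_alg S n"
    by (rule Pi.sigma_finite_subalgebraI[OF subalgebra_given(1)])
  have "integrable (Prob_given S i) (\<lambda>w. (estimator S i n w)\<^sup>2)"
    unfolding estimator_def
    by (rule Po.integrable_convex_cond_exp[where I=UNIV])
      (use Theta_integrable_given[OF i] Theta_sq_integrable_given[OF i] convex_power2 in auto)
  then have "integrable (Prob_given S i) (\<lambda>w. 2 * (estimator S i n w)\<^sup>2 + 2 * (Theta S w)\<^sup>2)"
    using Theta_sq_integrable_given[OF i] by auto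
  then show ?thesis
  proof (rule Bochner_Integration.integrable_bound)
    have "(a - b)\<^sup>2 \<le> 2 * a\<^sup>2 + 2 * b\<^sup>2" for a b :: real
      using zero_le_power2[of "a + b"] by (simp add: power2_sum power2_diff)
    then show "AE w in Prob_given S i. norm ((estimator S i n w - Theta S w)\<^sup>2)
        \<le> norm (2 * (estimator S i n w)\<^sup>2 + 2 * (Theta S w)\<^sup>2)"
      by auto
  qed measurable
qed

lemma mse_cond_var:
  assumes i: "i \<in> {0, 1}"
  shows "AE w in Prob_given S i. mse i n (stat S n w) = cond_var S i n (stat S n w)"
proof -
  interpret Pi: prob_space "Prob_given S i"
    by (rule prob_space_given[OF i])
  have stm: "stat S n \<in> Prob_given S i \<rightarrow>\<^sub>M T_space S"
    by simp
  show ?thesis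
    unfolding cond_var_def
  proof (rule Pi.cexp_given_cong_AE[OF stm])
    show "AE w in Prob_given S i. (estimator S i n w - Theta S w)\<^sup>2 = (Theta S w - cond_mean i n (stat S n w))\<^sup>2"
      using estimator_cond_mean[OF i, of n] by eventually_elim (simp add: power2_commute)
  qed measurable
qed

text \<open>For events of the statistic this is the definition of \<open>mse\<close>. For
  observation events sufficiency is needed, and it applies once the estimator is replaced by
  \<open>cond_mean\<close>, which makes the squared error a function of \<open>hist\<close>.\<close>

lemma mse_obs:
  assumes i: "i \<in> {0, 1}" and A: "A \<in> sets (obs_alg S n)"
  shows "(\<integral>w. indicator A w * (estimator S i n w - Theta S w)\<^sup>2 \<partial>Prob_given S i)
    = (\<integral>w. indicator A w * mse i n (stat S n w) \<partial>Prob_given S i)"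
proof -
  interpret Pi: prob_space "Prob_given S i"
    by (rule prob_space_given[OF i])
  have [measurable]: "A \<in> sets (Prob S)"
    using A subalgebra_obs[of n] by (auto simp: subalgebra_def)
  let ?f = "\<lambda>z :: nat \<times> real \<times> 't \<times> (nat \<Rightarrow> 'x). (cond_mean i n (fst (snd (snd z))) - fst (snd z))\<^sup>2"
  have stm: "stat S n \<in> Prob_given S i \<rightarrow>\<^sub>M T_space S"
    by simp
  have f[measurable]: "?f \<in> borel_measurable (hist_space n)"
    by measurable
  have ae: "AE w in Prob_given S i. (estimator S i n w - Theta S w)\<^sup>2 = ?f (hist n w)"
    using estimator_cond_mean[OF i, of n] by eventually_elim (simp add: hist_def)
  have int: "integrable (Prob_given S i) (\<lambda>w. ?f (hist n w))"
    using sq_error_integrable[OF i, of n] ae by (subst (asm) integrable_cong_AE) auto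
  have ae2: "AE w in Prob_given S i. mse i n (stat S n w)
      = cexp_given (Prob_given S i) (T_space S) (stat S n) (\<lambda>w. ?f (hist n w)) (stat S n w)"
    by (rule Pi.cexp_given_cong_AE[OF stm ae]) measurable
  have "(\<integral>w. indicator A w * (estimator S i n w - Theta S w)\<^sup>2 \<partial>Prob_given S i)
      = (\<integral>w. indicator A w * ?f (hist n w) \<partial>Prob_given S i)"
    using ae by (intro integral_cong_AE) auto
  also have "\<dots> = (\<integral>w. indicator A w *
      cexp_given (Prob_given S i) (T_space S) (stat S n) (\<lambda>w. ?f (hist n w)) (stat S n w) \<partial>Prob_given S i)"
    by (rule sufficient_given[OF i A f int])
  also have "\<dots> = (\<integral>w. indicator A w * mse i n (stat S n w) \<partial>Prob_given S i)"
    using ae2 by (intro integral_cong_AE) auto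
  finally show ?thesis .
qed

section \<open>Measurability of the costs and of the stopping rule\<close>

lemma rho_measurable[measurable]: "rho S N C n \<in> borel_measurable (T_space S)"
proof (induction "N - n" arbitrary: n)
  have g[measurable]: "g_cost S C n \<in> borel_measurable (T_space S)" for n
    unfolding g_cost_def[abs_def] D_cost_def[abs_def] by measurable
  {
    case 0
    then show ?case
      by (subst measurable_cong[of _ _ "g_cost S C n"]) (auto simp: rho.simps[of S N C n])
  next
    case (Suc k)
    have [measurable]: "rho S N C (Suc n) \<in> borel_measurable (T_space S)"
      using Suc by (intro Suc(1)) auto
    have [measurable]: "(\<lambda>t. \<integral>s. rho S N C (Suc n) s \<partial>Q_kernel S n t) \<in> borel_measurable (T_space S)"
      by (rule measurable_compose[OF Q_kernel_measurable integral_measurable_subprob_algebra]) simp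
    show ?case
      by (subst rho.simps[abs_def]) measurable
  }
qed

lemma D_cost_measurable[measurable]: "D_cost S C k n \<in> borel_measurable (T_space S)"
  unfolding D_cost_def[abs_def] by measurable

lemma g_cost_measurable[measurable]: "g_cost S C n \<in> borel_measurable (T_space S)"
  unfolding g_cost_def[abs_def] by measurable

lemma stop_rule_measurable[measurable]: "stop_rule S N C n \<in> borel_measurable (T_space S)"
  unfolding stop_rule_def[abs_def] by measurable

end

section \<open>Expected losses under the stopping rule\<close>

context seq_model
begin

section \<open>The stopping time of the policy\<close>

lemma stop_rule_cases: "stop_rule S N C n t = 0 \<or> stop_rule S N C n t = 1"
  by (simp add: stop_rule_def)

lemma stop_rule_horizon: "stop_rule S N C N t = 1"
  by (simp add: stop_rule_def rho.simps)

lemma stop_rule_stop_time: "stop_rule S N C (stop_time S N C w) (stat S (stop_time S N C w) w) = 1"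
  unfolding stop_time_def
  using Inf_nat_def1[of "{n. stop_rule S N C n (stat S n w) = 1}"] stop_rule_horizon by blast

lemma stop_time_le: "stop_rule S N C n (stat S n w) = 1 \<Longrightarrow> stop_time S N C w \<le> n"
  unfolding stop_time_def by (rule cInf_lower) auto

lemma le_stop_time_iff:
  "n \<le> stop_time S N C w \<longleftrightarrow> (\<forall>m<n. stop_rule S N C m (stat S m w) \<noteq> 1)"
proof
  show "\<forall>m<n. stop_rule S N C m (stat S m w) \<noteq> 1" if "n \<le> stop_time S N C w"
    using that stop_time_le[of C _ w] by fastforce
  show "n \<le> stop_time S N C w" if "\<forall>m<n. stop_rule S N C m (stat S m w) \<noteq> 1"
    using that stop_rule_stop_time[of C w] not_le_imp_less by blast
qed

text \<open>Whether the policy still runs is decided by the statistics before time \<open>n\<close>,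
  each a function of the observations so far. In general it cannot be read off from the statistic at
  time \<open>n\<close>, which is why later integrals are taken over events of
  \<open>obs_alg\<close>.\<close>

lemma running_obs: "{w \<in> space (Prob S). n \<le> stop_time S N C w} \<in> sets (obs_alg S n)"
proof -
  have "{w \<in> space (obs_alg S n). stop_rule S N C m (stat S m w) \<noteq> 1} \<in> sets (obs_alg S n)" if "m < n" for m
  proof -
    have [measurable]: "(\<lambda>w. stop_rule S N C m (stat S m w)) \<in> borel_measurable (obs_alg S n)"
      using that by (intro measurable_compose[OF stat_obs_alg stop_rule_measurable]) simp
    show ?thesis by measurable
  qed
  then have "{w \<in> space (obs_alg S n). \<forall>m\<in>{..<n}. stop_rule S N C m (stat S m w) \<noteq> 1} \<in> sets (obs_alg S n)"
    by (intro sets.sets_Collect_finite_All) (simp_all only: lessThan_iff finite_lessThan)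
  also have "{w \<in> space (obs_alg S n). \<forall>m\<in>{..<n}. stop_rule S N C m (stat S m w) \<noteq> 1}
      = {w \<in> space (Prob S). n \<le> stop_time S N C w}"
    unfolding le_stop_time_iff space_obs_alg Ball_def lessThan_iff ..
  finally show ?thesis .
qed

lemma obs_in_Prob: "A \<in> sets (obs_alg S n) \<Longrightarrow> A \<in> sets (Prob S)"
  using subalgebra_obs[of n] by (auto simp: subalgebra_def)

lemma stop_time_measurable[measurable]: "stop_time S N C \<in> Prob S \<rightarrow>\<^sub>M count_space UNIV"
proof (subst measurable_count_space_eq2_countable, safe)
  fix m
  have "stop_time S N C -` {m} \<inter> space (Prob S)
      = {w \<in> space (Prob S). m \<le> stop_time S N C w} - {w \<in> space (Prob S). Suc m \<le> stop_time S N C w}"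
    by auto
  also have "\<dots> \<in> sets (Prob S)"
    using obs_in_Prob[OF running_obs] by (intro sets.Diff) auto
  finally show "stop_time S N C -` {m} \<inter> space (Prob S) \<in> sets (Prob S)" .
qed auto

end

text \<open>
  Detection and estimation errors are treated together: \<open>incurred n\<close> is the random loss of stopping
  at time \<open>n\<close>, \<open>loss n\<close> its conditional mean given the statistic under hypothesis \<open>i\<close>, and \<open>risk\<close>
  the backward recursion of the expected loss.
\<close>

locale loss_recursion = seq_model S N
  for S :: "('w, 'x, 't) seq_setup" and N :: nat +
  fixes C :: "nat \<Rightarrow> real" and i :: nat
    and incurred :: "nat \<Rightarrow> 'w \<Rightarrow> real" and loss risk :: "nat \<Rightarrow> 't \<Rightarrow> real"
  assumes hyp: "i \<in> {0, 1}"
    and loss_measurable: "\<And>n. n \<le> N \<Longrightarrow> loss n \<in> borel_measurable (T_space S)"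
    and loss_nonneg: "\<And>n. n \<le> N \<Longrightarrow> AE w in Prob_given S i. 0 \<le> loss n (stat S n w)"
    and loss_integrable: "\<And>n. n \<le> N \<Longrightarrow> integrable (Prob_given S i) (\<lambda>w. loss n (stat S n w))"
    and incurred_integrable: "\<And>n. n \<le> N \<Longrightarrow> integrable (Prob_given S i) (incurred n)"
    and incurred_loss: "\<And>n A. n \<le> N \<Longrightarrow> A \<in> sets (obs_alg S n) \<Longrightarrow>
      (\<integral>w. indicator A w * incurred n w \<partial>Prob_given S i)
      = (\<integral>w. indicator A w * loss n (stat S n w) \<partial>Prob_given S i)"
    and risk_horizon: "\<And>t. risk N t = loss N t * stop_rule S N C N t"
    and risk_step: "\<And>n t. n < N \<Longrightarrow> risk n t = loss n t * stop_rule S N C n t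
      + (1 - stop_rule S N C n t)
        * cexp_given (Prob_given S i) (T_space S) (stat S n) (\<lambda>w. risk (Suc n) (stat S (Suc n) w)) t"
begin

sublocale Pi: prob_space "Prob_given S i"
  by (rule prob_space_given[OF hyp])

lemma stat_measurable_given: "stat S n \<in> Prob_given S i \<rightarrow>\<^sub>M T_space S"
  by simp

abbreviation next_risk :: "nat \<Rightarrow> 't \<Rightarrow> real" where
  "next_risk n \<equiv> cexp_given (Prob_given S i) (T_space S) (stat S n) (\<lambda>w. risk (Suc n) (stat S (Suc n) w))"

lemma risk_measurable: "n \<le> N \<Longrightarrow> risk n \<in> borel_measurable (T_space S)"
proof (cases "n < N")
  case True
  have [measurable]: "loss n \<in> borel_measurable (T_space S)"
    using True by (intro loss_measurable) simp
  show ?thesis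
    unfolding risk_step[OF True, abs_def] by measurable
next
  case False
  assume "n \<le> N"
  with False have "n = N" by simp
  have [measurable]: "loss N \<in> borel_measurable (T_space S)"
    by (intro loss_measurable) simp
  show ?thesis
    unfolding \<open>n = N\<close> risk_horizon[abs_def] by measurable
qed

lemma risk_nonneg_integrable:
  "n \<le> N \<Longrightarrow> (AE w in Prob_given S i. 0 \<le> risk n (stat S n w)) \<and>
     integrable (Prob_given S i) (\<lambda>w. risk n (stat S n w))"
proof (induction rule: inc_induct)
  case base
  then show ?case
    using loss_nonneg[of N] loss_integrable[of N] by (simp add: risk_horizon stop_rule_horizon)
next
  case (step n)
  then have n: "n \<le> N" "n < N" and nonneg: "AE w in Prob_given S i. 0 \<le> risk (Suc n) (stat S (Suc n) w)"
    and int: "integrable (Prob_given S i) (\<lambda>w. risk (Suc n) (stat S (Suc n) w))"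
    by auto
  have [measurable]: "loss n \<in> borel_measurable (T_space S)" "risk n \<in> borel_measurable (T_space S)"
    "risk (Suc n) \<in> borel_measurable (T_space S)"
    using n by (auto intro: loss_measurable risk_measurable)
  have next_nonneg: "AE w in Prob_given S i. 0 \<le> next_risk n (stat S n w)"
    by (rule Pi.cexp_given_nonneg[OF stat_measurable_given nonneg]) measurable
  have next_int: "integrable (Prob_given S i) (\<lambda>w. next_risk n (stat S n w))"
    by (rule Pi.cexp_given_integrable[OF stat_measurable_given int])
  have "AE w in Prob_given S i. 0 \<le> risk n (stat S n w)"
    using loss_nonneg[OF n(1)] next_nonneg
  proof eventually_elim
    case (elim w)
    then show ?case
      using stop_rule_cases[of C n "stat S n w"] by (auto simp: risk_step[OF n(2)])
  qed
  moreover have "integrable (Prob_given S i) (\<lambda>w. risk n (stat S n w))"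
  proof (rule Bochner_Integration.integrable_bound)
    show "integrable (Prob_given S i) (\<lambda>w. \<bar>loss n (stat S n w)\<bar> + \<bar>next_risk n (stat S n w)\<bar>)"
      using loss_integrable[OF n(1)] next_int by (intro Bochner_Integration.integrable_add integrable_abs)
    show "AE w in Prob_given S i. norm (risk n (stat S n w))
        \<le> norm (\<bar>loss n (stat S n w)\<bar> + \<bar>next_risk n (stat S n w)\<bar>)"
    proof (rule AE_I2)
      fix w
      show "norm (risk n (stat S n w)) \<le> norm (\<bar>loss n (stat S n w)\<bar> + \<bar>next_risk n (stat S n w)\<bar>)"
        using stop_rule_cases[of C n "stat S n w"] by (auto simp: risk_step[OF n(2)])
    qed
  qed measurable
  ultimately show ?case ..
qed

text \<open>In the two instances this is the random variable inside the conditional expectations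
  \<open>detection_error\<close> and \<open>estimation_error\<close>.\<close>

definition total :: "'w \<Rightarrow> real" where
  "total w = incurred (stop_time S N C w) w"

lemma integrable_indicator_given:
  fixes f :: "'w \<Rightarrow> real"
  assumes A: "A \<in> sets (Prob S)" and f: "integrable (Prob_given S i) f"
  shows "integrable (Prob_given S i) (\<lambda>w. indicator A w * f w)"
  using integrable_mult_indicator[of A "Prob_given S i" f] assms by simp

text \<open>The policy stops by time \<open>N\<close>, so the loss is a finite sum of the incurred
  losses cut off to the events on which it stops at a given time.\<close>

lemma total_integrable: "integrable (Prob_given S i) total"
proof -
  have [measurable]: "{w \<in> space (Prob S). stop_time S N C w = m} \<in> sets (Prob S)" for m
    by measurable
  have "integrable (Prob_given S i) (\<lambda>w. \<Sum>m\<le>N. indicator {w \<in> space (Prob S). stop_time S N C w = m} w * incurred m w)"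
  proof (intro Bochner_Integration.integrable_sum)
    fix m assume "m \<in> {..N}"
    then have "integrable (Prob_given S i) (incurred m)"
      by (intro incurred_integrable) simp
    then show "integrable (Prob_given S i) (\<lambda>w. indicator {w \<in> space (Prob S). stop_time S N C w = m} w * incurred m w)"
      by (intro integrable_indicator_given) measurable
  qed
  moreover have "(\<Sum>m\<le>N. indicator {w \<in> space (Prob S). stop_time S N C w = m} w * incurred m w) = total w"
    if "w \<in> space (Prob S)" for w
  proof -
    have "stop_time S N C w \<le> N"
      by (rule stop_time_le[OF stop_rule_horizon])
    then show ?thesis
      using that by (subst sum.remove[of _ "stop_time S N C w"]) (auto simp: total_def intro!: sum.neutral)
  qed
  ultimately show ?thesis
    by (subst (asm) Bochner_Integration.integrable_cong[OF refl, of _ _ total]) auto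
qed

text \<open>\<open>A\<close> ranges over all observation events on which the policy still runs,
  since the induction leaves the events of the statistic: the part \<open>A2\<close> of
  \<open>A\<close> on which the policy continues is such an event for time \<open>n + 1\<close>.
  Sufficiency then replaces the risk at time \<open>n + 1\<close> by its conditional mean given the
  statistic, integrated over \<open>A2\<close>. On the rest \<open>A1\<close> the policy stops at
  \<open>n\<close> and the incurred loss is replaced by \<open>loss n\<close>.\<close>

lemma total_risk:
  assumes "n \<le> N" and "A \<in> sets (obs_alg S n)" and "\<And>w. w \<in> A \<Longrightarrow> n \<le> stop_time S N C w"
  shows "(\<integral>w. indicator A w * total w \<partial>Prob_given S i) = (\<integral>w. indicator A w * risk n (stat S n w) \<partial>Prob_given S i)"
  using assms
proof (induction arbitrary: A rule: inc_induct)
  case base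
  have "indicator A w * total w = indicator A w * incurred N w" for w
    using base(2)[of w] stop_time_le[OF stop_rule_horizon, of C w] by (auto simp: indicator_def total_def)
  then show ?case
    using incurred_loss[OF order_refl base(1)] by (simp only: risk_horizon stop_rule_horizon mult_1_right)
next
  case (step n)
  then have n: "n \<le> N" "n < N" "Suc n \<le> N" by auto
  note A = step.prems(1)
  have "(\<lambda>w. stop_rule S N C n (stat S n w)) \<in> borel_measurable (obs_alg S n)"
    by (rule measurable_compose[OF stat_obs_alg stop_rule_measurable]) simp
  then have "{w \<in> space (obs_alg S n). stop_rule S N C n (stat S n w) = 1} \<in> sets (obs_alg S n)"
    by measurable
  then have D: "{w \<in> space (Prob S). stop_rule S N C n (stat S n w) = 1} \<in> sets (obs_alg S n)"
    by simp
  let ?D = "{w \<in> space (Prob S). stop_rule S N C n (stat S n w) = 1}"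
  define A1 where "A1 = A \<inter> ?D"
  define A2 where "A2 = A - ?D"
  have obs: "A1 \<in> sets (obs_alg S n)" "A2 \<in> sets (obs_alg S n)"
    using A D by (auto simp: A1_def A2_def)
  have A2': "A2 \<in> sets (obs_alg S (Suc n))"
    using obs(2) obs_alg_mono[of n "Suc n"] by auto
  have A_space: "A \<subseteq> space (Prob S)"
    using sets.sets_into_space[OF A] by simp
  have later: "Suc n \<le> stop_time S N C w" if "w \<in> A2" for w
    using that step.prems(2)[of w] A_space by (auto simp: le_stop_time_iff less_Suc_eq A2_def)
  have [measurable]: "risk (Suc n) \<in> borel_measurable (T_space S)"
    using n by (intro risk_measurable)
  note [measurable] = obs[THEN obs_in_Prob]
  have int: "integrable (Prob_given S i) (\<lambda>w. risk (Suc n) (stat S (Suc n) w))"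
    using risk_nonneg_integrable[OF n(3)] by simp
  \<comment> \<open>The next statistic is one \<open>t_step\<close> from the current one and
    coordinate \<open>Suc n\<close> of the future, so the next risk is a function of
    \<open>hist n\<close>.\<close>
  let ?F = "\<lambda>z :: nat \<times> real \<times> 't \<times> (nat \<Rightarrow> 'x).
    risk (Suc n) (t_step S (fst (snd (snd z))) (snd (snd (snd z)) (Suc n)))"
  have F: "?F \<in> borel_measurable (hist_space n)"
    by measurable
  have F_hist: "?F (hist n w) = risk (Suc n) (stat S (Suc n) w)" for w
    by (simp add: hist_def)
  have next_step: "(\<integral>w. indicator A2 w * risk (Suc n) (stat S (Suc n) w) \<partial>Prob_given S i)
      = (\<integral>w. indicator A2 w * next_risk n (stat S n w) \<partial>Prob_given S i)"
    using sufficient_given[OF hyp obs(2) F] int unfolding F_hist by blast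
  have "(\<integral>w. indicator A w * total w \<partial>Prob_given S i)
      = (\<integral>w. indicator A1 w * incurred n w + indicator A2 w * total w \<partial>Prob_given S i)"
  proof (rule Bochner_Integration.integral_cong[OF refl])
    fix w
    have "stop_time S N C w = n" if "w \<in> A1"
      using that step.prems(2)[of w] stop_time_le[of C n w] by (auto simp: A1_def)
    then show "indicator A w * total w = indicator A1 w * incurred n w + indicator A2 w * total w"
      using A_space by (auto simp: indicator_def A1_def A2_def total_def)
  qed
  also have "\<dots> = (\<integral>w. indicator A1 w * incurred n w \<partial>Prob_given S i)
      + (\<integral>w. indicator A2 w * total w \<partial>Prob_given S i)"
    using incurred_integrable[OF n(1)] total_integrable obs[THEN obs_in_Prob]
    by (intro Bochner_Integration.integral_add integrable_indicator_given)
  also have "\<dots> = (\<integral>w. indicator A1 w * loss n (stat S n w) \<partial>Prob_given S i)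
      + (\<integral>w. indicator A2 w * next_risk n (stat S n w) \<partial>Prob_given S i)"
    using incurred_loss[OF n(1) obs(1)] trans[OF step.IH[OF A2' later] next_step] by (simp only:)
  also have "\<dots> = (\<integral>w. indicator A1 w * loss n (stat S n w)
      + indicator A2 w * next_risk n (stat S n w) \<partial>Prob_given S i)"
    using loss_integrable[OF n(1)] obs[THEN obs_in_Prob]
    by (intro Bochner_Integration.integral_add[symmetric] integrable_indicator_given
        Pi.cexp_given_integrable[OF stat_measurable_given int])
  also have "\<dots> = (\<integral>w. indicator A w * risk n (stat S n w) \<partial>Prob_given S i)"
  proof (rule Bochner_Integration.integral_cong[OF refl])
    fix w
    show "indicator A1 w * loss n (stat S n w) + indicator A2 w * next_risk n (stat S n w)
        = indicator A w * risk n (stat S n w)"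
      unfolding risk_step[OF n(2)] using A_space stop_rule_cases[of C n "stat S n w"]
      by (auto simp: indicator_def A1_def A2_def)
  qed
  finally show ?case .
qed

text \<open>\<open>total_risk\<close> says that \<open>risk n\<close> satisfies the characterization
  of the conditional expectation given the statistic, the hypothesis and a running policy. The set
  where it differs from the chosen version, cut to the running policy, is an observation event that
  is null under the hypothesis, so there the posterior vanishes almost surely.\<close>

lemma risk_running:
  assumes n: "n \<le> N"
  shows "AE w in Prob S. n \<le> stop_time S N C w \<longrightarrow> posterior S i n (stat S n w) = 0 \<or>
    cexp_given (Prob_given_running S N C i n) (T_space S) (stat S n) total (stat S n w) = risk n (stat S n w)"
proof -
  let ?run = "{w \<in> space (Prob S). n \<le> stop_time S N C w}"
  let ?E = "hyp_event S i \<inter> ?run"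
  let ?P = "Prob_given_running S N C i n"
  let ?e = "cexp_given ?P (T_space S) (stat S n) total"
  have run[measurable]: "?run \<in> sets (Prob S)"
    by (rule obs_in_Prob[OF running_obs])
  have E[measurable]: "?E \<in> sets (Prob S)"
    by measurable
  have P: "?P = uniform_measure (Prob S) ?E"
    unfolding Prob_given_running_def by (rule arg_cong[where f="uniform_measure _"]) (auto simp: hyp_event_def)
  have [measurable_cong]: "sets ?P = sets (Prob S)"
    by (simp add: P)
  have stm: "stat S n \<in> ?P \<rightarrow>\<^sub>M T_space S"
    by measurable
  have em[measurable]: "?e \<in> borel_measurable (T_space S)"
    by (rule cexp_given_measurable[OF stm])
  have rm[measurable]: "risk n \<in> borel_measurable (T_space S)"
    by (rule risk_measurable[OF n])
  let ?ne = "{t \<in> space (T_space S). ?e t \<noteq> risk n t}"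
  have ne: "?ne \<in> sets (T_space S)"
    by measurable
  let ?A = "?run \<inter> (stat S n -` ?ne \<inter> space (Prob S))"
  have A: "?A \<in> sets (obs_alg S n)"
    using running_obs measurable_sets[OF stat_obs_alg[of n n] ne] by auto
  have "AE w in Prob S. w \<in> hyp_event S i \<longrightarrow> w \<notin> ?A"
  proof (cases "emeasure (Prob S) ?E = 0")
    \<comment> \<open>Conditioning on this null event says nothing about the chosen version, but
      then the policy almost surely does not run under the hypothesis, and \<open>?A\<close> is null
      under it for that reason.\<close>
    case True
    then have "AE w in Prob S. w \<notin> ?E"
      by (intro AE_not_in) (auto simp: null_sets_def)
    then show ?thesis
      by eventually_elim auto
  next
    case False
    have rint: "integrable (Prob_given S i) (\<lambda>w. risk n (stat S n w))"
      using risk_nonneg_integrable[OF n] by simp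
    interpret PE: prob_space ?P
      unfolding P using False by (intro prob_space_uniform_measure) (auto simp: emeasure_eq_measure)
    have [measurable]: "total \<in> borel_measurable (Prob S)"
      using borel_measurable_integrable[OF total_integrable] by simp
    have PE_int: "integrable ?P f" if f: "integrable (Prob_given S i) f" for f :: "'w \<Rightarrow> real"
    proof -
      have [measurable]: "f \<in> borel_measurable (Prob S)"
        using borel_measurable_integrable[OF f] by simp
      have "integrable (Prob_given S i) (\<lambda>w. indicator ?run w * f w)"
        by (rule integrable_indicator_given[OF run f])
      then have "integrable (Prob S) (\<lambda>w. indicator ?E w * f w)"
        by (subst (asm) integrable_given[OF hyp]) (auto simp: indicator_inter_arith mult_ac)
      then show ?thesis
        unfolding P by (subst integrable_uniform_measure[OF E False]) auto
    qed
    have PE_integral: "(\<integral>w. f w \<partial>?P) = prior S i / prob ?E * (\<integral>w. indicator ?run w * f w \<partial>Prob_given S i)"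
      if [measurable]: "f \<in> borel_measurable (Prob S)" for f :: "'w \<Rightarrow> real"
      unfolding P using prior_pos[OF hyp]
      by (subst integral_uniform_measure[OF E False], simp, subst integral_given[OF hyp])
         (auto simp: indicator_inter_arith mult_ac)
    have "AE w in ?P. ?e (stat S n w) = risk n (stat S n w)"
    proof (rule PE.cexp_given_charact[OF stm rm])
      fix B assume B[measurable]: "B \<in> sets (T_space S)"
      let ?R = "?run \<inter> (stat S n -` B \<inter> space (Prob S))"
      have R: "?R \<in> sets (obs_alg S n)"
        using running_obs measurable_sets[OF stat_obs_alg[of n n] B] by auto
      have split: "(\<integral>w. indicator ?run w * (indicator B (stat S n w) * h w) \<partial>Prob_given S i)
        = (\<integral>w. indicator ?R w * h w \<partial>Prob_given S i)" for h :: "'w \<Rightarrow> real"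
        by (rule Bochner_Integration.integral_cong) (auto simp: indicator_def)
      show "(\<integral>w. indicator B (stat S n w) * total w \<partial>?P) = (\<integral>w. indicator B (stat S n w) * risk n (stat S n w) \<partial>?P)"
        using total_risk[OF n R] by (subst (1 2) PE_integral) (auto simp: split)
    qed (use PE_int total_integrable rint in auto)
    then have "AE w in Prob S. w \<in> ?E \<longrightarrow> ?e (stat S n w) = risk n (stat S n w)"
      unfolding P using False by (subst (asm) AE_uniform_measure) (auto simp: emeasure_eq_measure less_top[symmetric])
    then show ?thesis
      by eventually_elim auto
  qed
  from AE_given_obs[OF hyp A this] show ?thesis
    using AE_space
    by eventually_elim (auto simp: measurable_space[OF stat_measurable])
qed

end

section \<open>Differentiation of the cost functions\<close>

context seq_model
begin

text \<open>The cost of decision \<open>k\<close> is affine in each weight; this is its slope in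
  \<open>C j\<close>, and 0 if that weight does not occur in it.\<close>

definition D_slope :: "nat \<Rightarrow> nat \<Rightarrow> nat \<Rightarrow> 't \<Rightarrow> real" where
  "D_slope j k n t = (if j = 1 - k then posterior S (1 - k) n t
     else if j = 2 + k then posterior S k n t * cond_var S k n t else 0)"

text \<open>The absolute values of all slopes added up, so that one function bounds the Lipschitz
  constants for every weight and both decisions.\<close>

definition envelope :: "nat \<Rightarrow> 't \<Rightarrow> real" where
  "envelope n t = \<bar>posterior S 0 n t\<bar> + \<bar>posterior S 1 n t\<bar>
     + \<bar>posterior S 0 n t * cond_var S 0 n t\<bar> + \<bar>posterior S 1 n t * cond_var S 1 n t\<bar>"

text \<open>The chosen versions have the right signs only almost surely. The variance appears
  together with the posterior because its sign is controlled only under the respective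
  hypothesis.\<close>

definition regular :: "nat \<Rightarrow> 't \<Rightarrow> bool" where
  "regular n t \<longleftrightarrow> 0 \<le> posterior S 0 n t \<and> 0 \<le> posterior S 1 n t
     \<and> 0 \<le> posterior S 0 n t * cond_var S 0 n t \<and> 0 \<le> posterior S 1 n t * cond_var S 1 n t"

lemma D_slope_measurable[measurable]: "D_slope j k n \<in> borel_measurable (T_space S)"
  unfolding D_slope_def[abs_def] by measurable

lemma envelope_measurable[measurable]: "envelope n \<in> borel_measurable (T_space S)"
  unfolding envelope_def[abs_def] by measurable

lemma regular_measurable[measurable]: "Measurable.pred (T_space S) (regular n)"
  unfolding regular_def[abs_def] by measurable

lemma D_cost_upd:
  assumes "k \<in> {0, 1}"
  shows "D_cost S (C(j := c)) k n t = D_cost S C k n t + (c - C j) * D_slope j k n t"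
  using assms by (auto simp: D_cost_def D_slope_def algebra_simps)

lemma D_slope_envelope: "k \<in> {0, 1} \<Longrightarrow> \<bar>D_slope j k n t\<bar> \<le> envelope n t"
  by (auto simp: D_slope_def envelope_def)

text \<open>The constant \<open>C 1 + C 2\<close> comes from bounding the minimum by the cost of
  decision 0, which contains just these two weights. The bound makes the costs integrable at all
  nonnegative weights.\<close>

lemma g_cost_bounds:
  assumes "regular n t" and C: "\<And>m. m \<le> 3 \<Longrightarrow> 0 \<le> C m"
  shows "0 \<le> g_cost S C n t" "g_cost S C n t \<le> (C 1 + C 2) * envelope n t"
proof -
  have r: "0 \<le> posterior S 0 n t" "0 \<le> posterior S 1 n t"
    "0 \<le> posterior S 0 n t * cond_var S 0 n t" "0 \<le> posterior S 1 n t * cond_var S 1 n t"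
    using assms(1) by (auto simp: regular_def)
  have D: "D_cost S C 0 n t = C 1 * posterior S 1 n t + C 2 * (posterior S 0 n t * cond_var S 0 n t)"
    "D_cost S C 1 n t = C 0 * posterior S 0 n t + C 3 * (posterior S 1 n t * cond_var S 1 n t)"
    by (simp_all add: D_cost_def)
  show "0 \<le> g_cost S C n t"
    unfolding g_cost_def D
    by (intro min.boundedI add_nonneg_nonneg mult_nonneg_nonneg[OF C] r) simp_all
  have "g_cost S C n t \<le> D_cost S C 0 n t"
    by (simp add: g_cost_def)
  also have "\<dots> \<le> C 1 * envelope n t + C 2 * envelope n t"
    unfolding D using C by (intro add_mono mult_left_mono) (auto simp: envelope_def)
  finally show "g_cost S C n t \<le> (C 1 + C 2) * envelope n t"
    by (simp add: distrib_right)
qed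

lemma g_cost_lipschitz:
  "\<bar>g_cost S (C(j := c)) n t - g_cost S (C(j := c')) n t\<bar> \<le> \<bar>c - c'\<bar> * envelope n t"
proof -
  have "\<bar>D_cost S (C(j := c)) k n t - D_cost S (C(j := c')) k n t\<bar> \<le> \<bar>c - c'\<bar> * envelope n t"
    if "k \<in> {0, 1}" for k
  proof -
    have "D_cost S (C(j := c)) k n t - D_cost S (C(j := c')) k n t = (c - c') * D_slope j k n t"
      by (simp only: D_cost_upd[OF that]) (simp add: algebra_simps)
    then show ?thesis
      using D_slope_envelope[OF that, of j n t] by (simp add: abs_mult mult_left_mono)
  qed
  from this[of 0] this[of 1] show ?thesis
    by (auto simp: g_cost_def min_def abs_le_iff)
qed

lemma posterior_given_integrable:
  fixes f :: "'t \<Rightarrow> real"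
  assumes i: "i \<in> {0, 1}" and f[measurable]: "f \<in> borel_measurable (T_space S)"
    and int: "integrable (Prob_given S i) (\<lambda>w. f (stat S n w))"
  shows "integrable (Prob S) (\<lambda>w. posterior S i n (stat S n w) * f (stat S n w))"
proof -
  have "integrable (Prob S) (\<lambda>w. f (stat S n w) * indicator (hyp_event S i) w)"
    using int by (subst (asm) integrable_given[OF i]) (auto simp: mult.commute)
  then have "integrable (Prob S) (\<lambda>w. f (stat S n w) * posterior S i n (stat S n w))"
    by (intro posterior_integral(1)[OF i] measurable_compose[OF stat_obs_alg f]) simp_all
  then show ?thesis
    by (simp add: mult.commute)
qed

lemma cond_var_given:
  assumes i: "i \<in> {0, 1}"
  shows "integrable (Prob_given S i) (\<lambda>w. cond_var S i n (stat S n w))"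
    and "AE w in Prob_given S i. 0 \<le> cond_var S i n (stat S n w)"
    and "integrable (Prob_given S i) (\<lambda>w. mse i n (stat S n w))"
    and "AE w in Prob_given S i. 0 \<le> mse i n (stat S n w)"
proof -
  interpret Pi: prob_space "Prob_given S i"
    by (rule prob_space_given[OF i])
  have stm: "stat S n \<in> Prob_given S i \<rightarrow>\<^sub>M T_space S"
    by simp
  show m1: "integrable (Prob_given S i) (\<lambda>w. mse i n (stat S n w))"
    by (rule Pi.cexp_given_integrable[OF stm sq_error_integrable[OF i]])
  show m2: "AE w in Prob_given S i. 0 \<le> mse i n (stat S n w)"
    by (rule Pi.cexp_given_nonneg[OF stm]) auto
  show "integrable (Prob_given S i) (\<lambda>w. cond_var S i n (stat S n w))"
    by (rule integrable_cong_AE_imp[OF m1 _ mse_cond_var[OF i]]) simp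
  show "AE w in Prob_given S i. 0 \<le> cond_var S i n (stat S n w)"
    using m2 mse_cond_var[OF i, of n] by eventually_elim simp
qed

lemma regular_AE: "AE w in Prob S. regular n (stat S n w)"
proof -
  have "AE w in Prob S. 0 \<le> posterior S i n (stat S n w) * cond_var S i n (stat S n w)"
    if i: "i \<in> {0, 1}" for i
  proof -
    have "{t \<in> space (T_space S). 0 \<le> cond_var S i n t} \<in> sets (T_space S)"
      by measurable
    from AE_given_stat[OF i this cond_var_given(2)[OF i]] posterior_bounds[of i n] show ?thesis
      by eventually_elim auto
  qed
  from this[of 0] this[of 1] posterior_bounds[of 0 n] posterior_bounds[of 1 n] show ?thesis
    by (simp add: regular_def)
qed

lemma envelope_integrable: "integrable (Prob S) (\<lambda>w. envelope n (stat S n w))"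
proof -
  have "integrable (Prob S) (\<lambda>w. posterior S i n (stat S n w))" for i
    using posterior_bounds[of i n] by (intro integrable_const_bound[of _ 1]) auto
  moreover have "integrable (Prob S) (\<lambda>w. posterior S i n (stat S n w) * cond_var S i n (stat S n w))"
    if "i \<in> {0, 1}" for i
    using cond_var_given(1)[OF that] by (intro posterior_given_integrable[OF that]) auto
  ultimately show ?thesis
    unfolding envelope_def by auto
qed

end

context loss_recursion
begin

text \<open>The induction hypothesis. A single set \<open>G\<close> serves all weights, since a
  separate null set for each weight would not allow differentiation at a fixed \<open>t\<close>; it
  is measurable so that \<open>AE_Q_kernel\<close> applies. The upper bound gives integrability
  under the kernel, the Lipschitz bound the domination of difference quotients.\<close>

definition derivative_bound :: "nat \<Rightarrow> nat \<Rightarrow> ('t \<Rightarrow> bool) \<Rightarrow> ('t \<Rightarrow> real) \<Rightarrow> bool" where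
  "derivative_bound j n G L \<longleftrightarrow> Measurable.pred (T_space S) G \<and> (AE w in Prob S. G (stat S n w))
    \<and> L \<in> borel_measurable (T_space S) \<and> (\<forall>t. 0 \<le> L t) \<and> integrable (Prob S) (\<lambda>w. L (stat S n w))
    \<and> (\<forall>t\<in>space (T_space S). G t \<longrightarrow>
        (\<forall>C'. (\<forall>m\<le>3. 0 \<le> C' m) \<longrightarrow> 0 \<le> rho S N C' n t \<and> rho S N C' n t \<le> (C' 1 + C' 2) * L t)
      \<and> (\<forall>c\<ge>0. \<forall>c'\<ge>0. \<bar>rho S N (C(j := c)) n t - rho S N (C(j := c')) n t\<bar> \<le> \<bar>c - c'\<bar> * L t)
      \<and> has_cost_derivative S N C j n t (posterior S i n t * risk n t))"

text \<open>
  Backward induction. Outside a null set of values of the statistic, the costs are Lipschitz in the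
  weight \<open>C j\<close> with an integrable constant \<open>L\<close>, so differentiation commutes with the
  integral with respect to \<open>Q\<close>; off the boundaries the minima are locally attained by a single argument.
\<close>

lemma cost_derivative_aux:
  assumes weights: "\<And>m. m \<le> 3 \<Longrightarrow> 0 \<le> C m" and j: "j \<le> 3"
    and stop_null: "\<And>n. n < N \<Longrightarrow> AE w in Prob S. stat S n w \<notin> stop_boundary S N C n"
    and decision_null: "\<And>n. n \<le> N \<Longrightarrow> AE w in Prob S. stat S n w \<notin> decision_boundary S N C n"
    and decision: "optimal_decision S N C \<delta>"
    and slope: "\<And>n. n \<le> N \<Longrightarrow> AE w in Prob S.
      D_slope j (\<delta> n (stat S n w)) n (stat S n w) = posterior S i n (stat S n w) * loss n (stat S n w)"
    and n: "n \<le> N"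
  shows "\<exists>G L. derivative_bound j n G L"
  using n
proof (induction rule: inc_induct)
  have Cj: "C j \<in> {0..}"
    using weights[OF j] by simp
  have upd: "0 \<le> (C(j := c)) m" if "0 \<le> c" "m \<le> 3" for c m
    using that weights by simp
  \<comment> \<open>The conditions under which stopping at \<open>t\<close> can be differentiated. A
    tie between the decisions is excluded only where the policy stops; the last clause says that the
    slope of the chosen decision is the posterior times the loss.\<close>
  define base where "base n t \<longleftrightarrow> regular n t
      \<and> (stop_rule S N C n t = 1 \<longrightarrow> D_cost S C 0 n t \<noteq> D_cost S C 1 n t)
      \<and> D_slope j (\<delta> n t) n t = posterior S i n t * loss n t" for n t
  have base_measurable: "Measurable.pred (T_space S) (base n)" if n: "n \<le> N" for n
  proof -
    have [measurable]: "\<delta> n \<in> T_space S \<rightarrow>\<^sub>M count_space UNIV"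
      using decision n by (auto simp: optimal_decision_def)
    have [measurable]: "loss n \<in> borel_measurable (T_space S)"
      by (rule loss_measurable[OF n])
    have [measurable]: "(\<lambda>t. D_slope j (\<delta> n t) n t) \<in> borel_measurable (T_space S)"
      by (rule measurable_compose_countable[where g="\<delta> n"]) measurable
    show ?thesis
      unfolding base_def[abs_def] by measurable
  qed
  have base_AE: "AE w in Prob S. base n (stat S n w)" if n: "n \<le> N" for n
    using regular_AE[of n] decision_null[OF n] slope[OF n] AE_space
    by eventually_elim (auto simp: base_def decision_boundary_def measurable_space[OF stat_measurable])
  have g_deriv: "((\<lambda>c. g_cost S (C(j := c)) n t) has_real_derivative posterior S i n t * loss n t) (at (C j) within {0..})"
    if n: "n \<le> N" and t: "t \<in> space (T_space S)" and G: "base n t" and stop: "stop_rule S N C n t = 1" for n t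
  proof -
    let ?D = "\<lambda>k c. D_cost S C k n t + (c - C j) * D_slope j k n t"
    have g: "(\<lambda>c. g_cost S (C(j := c)) n t) = (\<lambda>c. min (?D 0 c) (?D 1 c))"
      by (simp add: g_cost_def D_cost_upd)
    have D: "(?D k has_real_derivative D_slope j k n t) (at (C j) within {0..})" for k
      by (auto intro!: derivative_eq_intros)
    have Dc: "continuous (at (C j) within {0..}) (?D k)" for k
      using D by (rule DERIV_continuous)
    have d: "of_bool (D_cost S C 0 n t > D_cost S C 1 n t) \<le> \<delta> n t" "\<delta> n t \<le> of_bool (D_cost S C 0 n t \<ge> D_cost S C 1 n t)"
      using decision n t by (auto simp: optimal_decision_def)
    have ne: "D_cost S C 0 n t \<noteq> D_cost S C 1 n t" and sl: "D_slope j (\<delta> n t) n t = posterior S i n t * loss n t"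
      using G stop by (auto simp: base_def)
    show ?thesis
    proof (cases "D_cost S C 0 n t < D_cost S C 1 n t")
      case True
      then have "\<delta> n t = 0" using d by simp
      with sl have "D_slope j 0 n t = posterior S i n t * loss n t" by simp
      then show ?thesis
        using has_real_derivative_min_less[OF D[of 0] Dc[of 1] _ Cj] True unfolding g by simp
    next
      case False
      with ne have less: "D_cost S C 1 n t < D_cost S C 0 n t" by simp
      then have "\<delta> n t = 1" using d by simp
      with sl have "D_slope j 1 n t = posterior S i n t * loss n t" by simp
      then show ?thesis
        using has_real_derivative_min_less[OF D[of 1] Dc[of 0] _ Cj] less unfolding g
        by (simp add: min.commute)
    qed
  qed
  \<comment> \<open>Ties are possible where the policy continues, and there the cost of stopping may
    fail to be differentiable. As the larger argument of the minimum it only has to be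
    continuous.\<close>
  have g_cont: "continuous (at (C j) within {0..}) (\<lambda>c. g_cost S (C(j := c)) n t)" for n t
  proof -
    have g: "(\<lambda>c. g_cost S (C(j := c)) n t)
        = (\<lambda>c. min (D_cost S C 0 n t + (c - C j) * D_slope j 0 n t) (D_cost S C 1 n t + (c - C j) * D_slope j 1 n t))"
      by (simp add: g_cost_def D_cost_upd)
    show ?thesis
      unfolding g continuous_within by (intro tendsto_intros)
  qed
  {
    case base
    have rho_N: "rho S N C' N t = g_cost S C' N t" for C' t
      by (simp add: rho.simps)
    have deriv: "has_cost_derivative S N C j N t (posterior S i N t * risk N t)"
      if "t \<in> space (T_space S)" "base N t" for t
      using g_deriv[OF order_refl that stop_rule_horizon]
      by (simp add: has_cost_derivative_def rho_N risk_horizon stop_rule_horizon)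
    have main: "(\<forall>C'. (\<forall>m\<le>3. 0 \<le> C' m) \<longrightarrow> 0 \<le> rho S N C' N t \<and> rho S N C' N t \<le> (C' 1 + C' 2) * envelope N t)
      \<and> (\<forall>c\<ge>0. \<forall>c'\<ge>0. \<bar>rho S N (C(j := c)) N t - rho S N (C(j := c')) N t\<bar> \<le> \<bar>c - c'\<bar> * envelope N t)
      \<and> has_cost_derivative S N C j N t (posterior S i N t * risk N t)"
      if "t \<in> space (T_space S)" "base N t" for t
    proof (intro conjI allI impI)
      have reg: "regular N t"
        using that(2) by (simp only: base_def)
      show "0 \<le> rho S N C' N t" "rho S N C' N t \<le> (C' 1 + C' 2) * envelope N t"
        if "\<forall>m\<le>3. 0 \<le> C' m" for C'
        unfolding rho_N using that by (auto intro!: g_cost_bounds[OF reg])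
      show "\<bar>rho S N (C(j := c)) N t - rho S N (C(j := c')) N t\<bar> \<le> \<bar>c - c'\<bar> * envelope N t" for c c'
        unfolding rho_N by (rule g_cost_lipschitz)
      show "has_cost_derivative S N C j N t (posterior S i N t * risk N t)"
        by (rule deriv[OF that])
    qed
    have nonneg: "\<forall>t. 0 \<le> envelope N t"
      by (simp add: envelope_def)
    show ?case
      unfolding derivative_bound_def
      by (rule exI[of _ "base N"], rule exI[of _ "envelope N"],
          rule conjI[OF base_measurable[OF order_refl] conjI[OF base_AE[OF order_refl]
            conjI[OF envelope_measurable conjI[OF nonneg conjI[OF envelope_integrable]]]]])
        (rule ballI, rule impI, rule main)
  next
    case (step n)
    then have n: "n \<le> N" "n < N" "Suc n \<le> N" by auto
    from step.IH obtain G' L' where IH: "derivative_bound j (Suc n) G' L'"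
      by (elim exE)
    note IH = IH[unfolded derivative_bound_def]
    have G'[measurable]: "Measurable.pred (T_space S) G'"
      and G'_AE: "AE w in Prob S. G' (stat S (Suc n) w)"
      and L'[measurable]: "L' \<in> borel_measurable (T_space S)"
      and L'_nonneg: "\<forall>t. 0 \<le> L' t"
      and L'_int: "integrable (Prob S) (\<lambda>w. L' (stat S (Suc n) w))"
      by (rule IH[THEN conjunct1] IH[THEN conjunct2, THEN conjunct1]
        IH[THEN conjunct2, THEN conjunct2, THEN conjunct1]
        IH[THEN conjunct2, THEN conjunct2, THEN conjunct2, THEN conjunct1]
        IH[THEN conjunct2, THEN conjunct2, THEN conjunct2, THEN conjunct2, THEN conjunct1])+
    note IH_pt = IH[THEN conjunct2, THEN conjunct2, THEN conjunct2, THEN conjunct2, THEN conjunct2,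
        THEN bspec, THEN mp]
    have bound': "0 \<le> rho S N C' (Suc n) t \<and> rho S N C' (Suc n) t \<le> (C' 1 + C' 2) * L' t"
      if "t \<in> space (T_space S)" "G' t" "\<forall>m\<le>3. 0 \<le> C' m" for t C'
      using IH_pt[OF that(1,2), THEN conjunct1] that(3) by blast
    have lip': "\<bar>rho S N (C(j := c)) (Suc n) t - rho S N (C(j := c')) (Suc n) t\<bar> \<le> \<bar>c - c'\<bar> * L' t"
      if "t \<in> space (T_space S)" "G' t" "0 \<le> c" "0 \<le> c'" for t c c'
      using IH_pt[OF that(1,2), THEN conjunct2, THEN conjunct1] that(3,4) by blast
    have deriv': "has_cost_derivative S N C j (Suc n) t (posterior S i (Suc n) t * risk (Suc n) t)"
      if "t \<in> space (T_space S)" "G' t" for t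
      by (rule IH_pt[OF that, THEN conjunct2, THEN conjunct2])
    let ?Q = "Q_kernel S n"
    have [measurable]: "risk (Suc n) \<in> borel_measurable (T_space S)" "risk n \<in> borel_measurable (T_space S)"
      using n by (auto intro: risk_measurable)
    have Q_int[measurable]: "(\<lambda>t. \<integral>s. f s \<partial>?Q t) \<in> borel_measurable (T_space S)"
      if "f \<in> borel_measurable (T_space S)" for f :: "'t \<Rightarrow> real"
      by (rule measurable_compose[OF Q_kernel_measurable integral_measurable_subprob_algebra[OF that]])
    \<comment> \<open>A minimum inherits the larger of two Lipschitz constants; the sum dominates
      both, namely the one for stopping and the kernel average of the one for continuing.\<close>
    define L where "L t = envelope n t + (\<integral>s. L' s \<partial>?Q t)" for t
    \<comment> \<open>Expresses that \<open>G'\<close> holds almost everywhere for the kernel by a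
      vanishing integral, which is visibly a measurable condition on \<open>t\<close>.\<close>
    let ?bad = "\<lambda>t. \<integral>\<^sup>+s. of_bool (\<not> G' s) \<partial>?Q t"
    let ?d = "\<lambda>s. posterior S i (Suc n) s * risk (Suc n) s"
    \<comment> \<open>Besides the conditions for stopping, \<open>t\<close> is off the stopping
      boundary, the data of time \<open>n + 1\<close> are usable under the kernel, and the
      integrated derivative is already identified with the posterior times
      \<open>next_risk\<close>.\<close>
    define G where "G t \<longleftrightarrow> base n t \<and> ?bad t = 0 \<and> integrable (?Q t) L'
        \<and> g_cost S C n t \<noteq> 1 + (\<integral>s. rho S N C (Suc n) s \<partial>?Q t)
        \<and> (\<integral>s. ?d s \<partial>?Q t) = posterior S i n t * next_risk n t" for t
    have [measurable]: "?bad \<in> borel_measurable (T_space S)"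
      by (rule measurable_compose[OF Q_kernel_measurable nn_integral_measurable_subprob_algebra]) measurable
    have [measurable]: "Measurable.pred (T_space S) (\<lambda>t. integrable (?Q t) L')"
      by (rule measurable_compose[OF Q_kernel_measurable integrable_measurable_subprob_algebra]) measurable
    note [measurable] = base_measurable[OF n(1)]
    have G_meas: "Measurable.pred (T_space S) G"
      unfolding G_def[abs_def] by measurable
    have bad_iff: "?bad t = 0 \<longleftrightarrow> (AE s in ?Q t. G' s)" for t
    proof -
      have "?bad t = 0 \<longleftrightarrow> (AE s in ?Q t. (of_bool (\<not> G' s) :: ennreal) = 0)"
        by (rule nn_integral_0_iff_AE) measurable
      then show ?thesis by simp
    qed
    have L'_nonneg_AE: "AE w in Prob S. 0 \<le> L' (stat S (Suc n) w)"
      using L'_nonneg by simp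
    have risk_next: "AE w in Prob_given S i. 0 \<le> risk (Suc n) (stat S (Suc n) w)"
      "integrable (Prob_given S i) (\<lambda>w. risk (Suc n) (stat S (Suc n) w))"
      using risk_nonneg_integrable[OF n(3)] by auto
    have G_AE: "AE w in Prob S. G (stat S n w)"
      using base_AE[OF n(1)] AE_Q_kernel[OF G' G'_AE] integral_Q_kernel(1)[OF L' L'_nonneg_AE L'_int]
        stop_null[OF n(2)] integral_posterior_Q_kernel[OF hyp risk_measurable[OF n(3)] risk_next] AE_space
    proof eventually_elim
      case (elim w)
      then show ?case
        by (auto simp: G_def bad_iff stop_boundary_def measurable_space[OF stat_measurable])
    qed
    have L_meas: "L \<in> borel_measurable (T_space S)"
      unfolding L_def[abs_def] by measurable
    have Q_L'_nonneg: "0 \<le> (\<integral>s. L' s \<partial>?Q t)" for t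
      by (intro integral_nonneg_AE) (simp add: L'_nonneg)
    have env_nonneg: "0 \<le> envelope n t" for t
      by (simp add: envelope_def)
    have L_nonneg: "0 \<le> L t" for t
      unfolding L_def using Q_L'_nonneg env_nonneg by (intro add_nonneg_nonneg)
    have L_int: "integrable (Prob S) (\<lambda>w. L (stat S n w))"
      unfolding L_def using envelope_integrable integral_Q_kernel(2)[OF L' L'_nonneg_AE L'_int]
      by (rule Bochner_Integration.integrable_add)
    have main: "(\<forall>C'. (\<forall>m\<le>3. 0 \<le> C' m) \<longrightarrow> 0 \<le> rho S N C' n t \<and> rho S N C' n t \<le> (C' 1 + C' 2) * L t)
      \<and> (\<forall>c\<ge>0. \<forall>c'\<ge>0. \<bar>rho S N (C(j := c)) n t - rho S N (C(j := c')) n t\<bar> \<le> \<bar>c - c'\<bar> * L t)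
      \<and> has_cost_derivative S N C j n t (posterior S i n t * risk n t)"
      if t: "t \<in> space (T_space S)" and Gt: "G t" for t
    proof (intro conjI allI impI)
      have bt: "base n t" and reg: "regular n t" and L'_Q: "integrable (?Q t) L'"
        and ne: "g_cost S C n t \<noteq> 1 + (\<integral>s. rho S N C (Suc n) s \<partial>?Q t)"
        and d_eq: "(\<integral>s. ?d s \<partial>?Q t) = posterior S i n t * next_risk n t"
        and G'_Q: "AE s in ?Q t. G' s"
        using Gt by (auto simp: G_def base_def bad_iff)
      have G'_Q': "AE s in ?Q t. s \<in> space (T_space S) \<and> G' s"
        using G'_Q AE_space by eventually_elim simp
      have rho_n: "rho S N C' n t = min (g_cost S C' n t) (1 + (\<integral>s. rho S N C' (Suc n) s \<partial>?Q t))" for C'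
        using n by (subst rho.simps) simp
      \<comment> \<open>Integrability at every admissible weight is needed because a non-integrable
        cost would have integral 0 by default, and differences of such integrals would be
        meaningless.\<close>
      have rho_int: "integrable (?Q t) (rho S N C' (Suc n))" if "\<forall>m\<le>3. 0 \<le> C' m" for C'
      proof (rule Bochner_Integration.integrable_bound)
        show "integrable (?Q t) (\<lambda>s. (C' 1 + C' 2) * L' s)"
          using L'_Q by simp
        show "AE s in ?Q t. norm (rho S N C' (Suc n) s) \<le> norm ((C' 1 + C' 2) * L' s)"
          using G'_Q' by eventually_elim (use bound'[OF _ _ that] in force)
      qed measurable
      {
        fix C' :: "nat \<Rightarrow> real" assume C': "\<forall>m\<le>3. 0 \<le> C' m"
        have "AE s in ?Q t. 0 \<le> rho S N C' (Suc n) s"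
          using G'_Q' by eventually_elim (use bound'[OF _ _ C'] in blast)
        then have "0 \<le> (\<integral>s. rho S N C' (Suc n) s \<partial>?Q t)"
          by (rule integral_nonneg_AE)
        then show "0 \<le> rho S N C' n t"
          unfolding rho_n using g_cost_bounds(1)[OF reg, of C'] C' by simp
        have "rho S N C' n t \<le> (C' 1 + C' 2) * envelope n t"
          unfolding rho_n using g_cost_bounds(2)[OF reg, of C'] C' by simp
        also have "\<dots> \<le> (C' 1 + C' 2) * L t"
          using C' Q_L'_nonneg by (intro mult_left_mono) (auto simp: L_def)
        finally show "rho S N C' n t \<le> (C' 1 + C' 2) * L t" .
      }
      have updC: "\<forall>m\<le>3. 0 \<le> (C(j := c)) m" if "0 \<le> c" for c
        using upd[OF that] by blast
      {
        fix c c' :: real assume c: "0 \<le> c" "0 \<le> c'"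
        note int = rho_int[OF updC[OF c(1)]] rho_int[OF updC[OF c(2)]]
        have "\<bar>(\<integral>s. rho S N (C(j := c)) (Suc n) s \<partial>?Q t) - (\<integral>s. rho S N (C(j := c')) (Suc n) s \<partial>?Q t)\<bar>
            = \<bar>\<integral>s. rho S N (C(j := c)) (Suc n) s - rho S N (C(j := c')) (Suc n) s \<partial>?Q t\<bar>"
          by (simp only: Bochner_Integration.integral_diff[OF int])
        also have "\<dots> \<le> (\<integral>s. \<bar>rho S N (C(j := c)) (Suc n) s - rho S N (C(j := c')) (Suc n) s\<bar> \<partial>?Q t)"
          by (rule integral_abs_bound)
        also have "\<dots> \<le> (\<integral>s. \<bar>c - c'\<bar> * L' s \<partial>?Q t)"
        proof (rule integral_mono_AE)
          show "AE s in ?Q t. \<bar>rho S N (C(j := c)) (Suc n) s - rho S N (C(j := c')) (Suc n) s\<bar> \<le> \<bar>c - c'\<bar> * L' s"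
            using G'_Q' by eventually_elim (rule lip'[OF _ _ c], simp_all)
        qed (use L'_Q in \<open>auto intro: integrable_abs[OF Bochner_Integration.integrable_diff[OF int]]\<close>)
        also have "\<dots> = \<bar>c - c'\<bar> * (\<integral>s. L' s \<partial>?Q t)"
          by simp
        finally have "\<bar>(\<integral>s. rho S N (C(j := c)) (Suc n) s \<partial>?Q t) - (\<integral>s. rho S N (C(j := c')) (Suc n) s \<partial>?Q t)\<bar>
            \<le> \<bar>c - c'\<bar> * (\<integral>s. L' s \<partial>?Q t)" .
        moreover have "0 \<le> \<bar>c - c'\<bar> * envelope n t" "0 \<le> \<bar>c - c'\<bar> * (\<integral>s. L' s \<partial>?Q t)"
          using env_nonneg Q_L'_nonneg by auto
        ultimately show "\<bar>rho S N (C(j := c)) n t - rho S N (C(j := c')) n t\<bar> \<le> \<bar>c - c'\<bar> * L t"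
          unfolding rho_n L_def distrib_left using g_cost_lipschitz[of C j c n t c']
          by linarith
      }
      let ?I = "\<lambda>c. 1 + (\<integral>s. rho S N (C(j := c)) (Suc n) s \<partial>?Q t)"
      have "((\<lambda>c. \<integral>s. rho S N (C(j := c)) (Suc n) s \<partial>?Q t) has_real_derivative (\<integral>s. ?d s \<partial>?Q t)) (at (C j) within {0..})"
      proof (rule has_real_derivative_integral_within[OF _ L'_Q])
        show "integrable (?Q t) (rho S N (C(j := c)) (Suc n))" if "c \<in> {0..}" for c
          using that by (intro rho_int updC) simp
        show "AE s in ?Q t. \<bar>rho S N (C(j := c)) (Suc n) s - rho S N (C(j := C j)) (Suc n) s\<bar> \<le> \<bar>c - C j\<bar> * L' s"
          if "c \<in> {0..}" for c
          using G'_Q' by eventually_elim (use that Cj in \<open>auto intro!: lip' simp del: fun_upd_triv\<close>)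
        show "AE s in ?Q t. ((\<lambda>c. rho S N (C(j := c)) (Suc n) s) has_real_derivative ?d s) (at (C j) within {0..})"
          using G'_Q' by eventually_elim (use deriv' in \<open>auto simp: has_cost_derivative_def\<close>)
      qed (use Cj in auto)
      then have I: "(?I has_real_derivative posterior S i n t * next_risk n t) (at (C j) within {0..})"
        unfolding d_eq by (auto intro!: derivative_eq_intros)
      have "((\<lambda>c. min (g_cost S (C(j := c)) n t) (?I c)) has_real_derivative posterior S i n t * risk n t) (at (C j) within {0..})"
      proof (cases "stop_rule S N C n t = 1")
        \<comment> \<open>Stopping means that the cost of stopping is at most that of continuing,
          and \<open>G\<close> excludes equality. In the other case the strict inequality is part of
          not stopping.\<close>
        case True
        then have "g_cost S C n t < ?I (C j)"
          using ne by (auto simp: stop_rule_def rho_n)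
        then show ?thesis
          using has_real_derivative_min_less[OF g_deriv[OF n(1) t bt True] DERIV_continuous[OF I] _ Cj] True
          by (simp add: risk_step[OF n(2)])
      next
        case False
        then have "?I (C j) < g_cost S C n t"
          by (auto simp: stop_rule_def rho_n min_def split: if_splits)
        moreover have "stop_rule S N C n t = 0"
          using False stop_rule_cases by blast
        ultimately show ?thesis
          using has_real_derivative_min_less[OF I g_cont _ Cj, of n t]
          by (simp add: risk_step[OF n(2)] min.commute)
      qed
      then show "has_cost_derivative S N C j n t (posterior S i n t * risk n t)"
        unfolding has_cost_derivative_def rho_n .
    qed
    show ?case
      unfolding derivative_bound_def
      by (rule exI[of _ G], rule exI[of _ L],
          rule conjI[OF G_meas conjI[OF G_AE conjI[OF L_meas conjI[OF allI[OF L_nonneg] conjI[OF L_int]]]]])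
        (rule ballI, rule impI, rule main)
  }
qed

lemma cost_derivative:
  assumes weights: "\<And>m. m \<le> 3 \<Longrightarrow> 0 \<le> C m" and j: "j \<le> 3"
    and stop_null: "\<And>n. n < N \<Longrightarrow> AE w in Prob S. stat S n w \<notin> stop_boundary S N C n"
    and decision_null: "\<And>n. n \<le> N \<Longrightarrow> AE w in Prob S. stat S n w \<notin> decision_boundary S N C n"
    and decision: "optimal_decision S N C \<delta>"
    and slope: "\<And>n. n \<le> N \<Longrightarrow> AE w in Prob S.
      D_slope j (\<delta> n (stat S n w)) n (stat S n w) = posterior S i n (stat S n w) * loss n (stat S n w)"
  shows "n \<le> N \<Longrightarrow> AE w in Prob S. has_cost_derivative S N C j n (stat S n w)
      (prior S i * z_ratio S i n (stat S n w) * risk n (stat S n w))"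
    and "n \<le> N \<Longrightarrow> AE w in Prob S. n \<le> stop_time S N C w \<longrightarrow>
      has_cost_derivative S N C j n (stat S n w) (prior S i * z_ratio S i n (stat S n w)
        * cexp_given (Prob_given_running S N C i n) (T_space S) (stat S n) total (stat S n w))"
    and "has_cost_derivative S N C j 0 (t_init S) (prior S i * risk 0 (t_init S))"
    and "has_cost_derivative S N C j 0 (t_init S)
      (prior S i * cexp_given (Prob_given_running S N C i 0) (T_space S) (stat S 0) total (t_init S))"
proof -
  have rec: "AE w in Prob S. has_cost_derivative S N C j n (stat S n w)
      (prior S i * z_ratio S i n (stat S n w) * risk n (stat S n w))" if n: "n \<le> N" for n
  proof -
    from cost_derivative_aux[OF weights j stop_null decision_null decision slope n]
    obtain G L where "derivative_bound j n G L"
      by blast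
    then have G: "AE w in Prob S. G (stat S n w)"
      and deriv: "\<And>t. t \<in> space (T_space S) \<Longrightarrow> G t \<Longrightarrow> has_cost_derivative S N C j n t (posterior S i n t * risk n t)"
      by (simp_all add: derivative_bound_def)
    show ?thesis
      using G posterior_z_ratio[OF hyp, of n] AE_space
    proof eventually_elim
      case (elim w)
      with deriv[of "stat S n w"] show ?case
        by (simp add: measurable_space[OF stat_measurable])
    qed
  qed
  \<comment> \<open>Where the posterior vanishes, so does the factor in front of the error, and the
    undetermined value of the conditional expectation does not matter.\<close>
  have run: "AE w in Prob S. n \<le> stop_time S N C w \<longrightarrow>
      has_cost_derivative S N C j n (stat S n w) (prior S i * z_ratio S i n (stat S n w)
        * cexp_given (Prob_given_running S N C i n) (T_space S) (stat S n) total (stat S n w))"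
    if n: "n \<le> N" for n
    using rec[OF n] risk_running[OF n] posterior_z_ratio[OF hyp, of n]
    by eventually_elim auto
  show "n \<le> N \<Longrightarrow> AE w in Prob S. has_cost_derivative S N C j n (stat S n w)
      (prior S i * z_ratio S i n (stat S n w) * risk n (stat S n w))"
    by (rule rec)
  show "n \<le> N \<Longrightarrow> AE w in Prob S. n \<le> stop_time S N C w \<longrightarrow>
      has_cost_derivative S N C j n (stat S n w) (prior S i * z_ratio S i n (stat S n w)
        * cexp_given (Prob_given_running S N C i n) (T_space S) (stat S n) total (stat S n w))"
    by (rule run)
  \<comment> \<open>The initial statistic is constant, so an almost sure statement about it holds
    outright, and the density ratio is 1.\<close>
  show "has_cost_derivative S N C j 0 (t_init S) (prior S i * risk 0 (t_init S))"
    using rec[of 0] by (simp add: z_ratio_init[OF hyp])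
  show "has_cost_derivative S N C j 0 (t_init S)
      (prior S i * cexp_given (Prob_given_running S N C i 0) (T_space S) (stat S 0) total (t_init S))"
    using run[of 0] by (simp add: z_ratio_init[OF hyp])
qed

end

section \<open>Detection and estimation errors as instances of the loss recursion\<close>

context seq_model
begin

lemma decision_obs:
  assumes "optimal_decision S N C \<delta>" "n \<le> N" "A \<in> sets (obs_alg S n)"
  shows "A \<inter> {w \<in> space (Prob S). \<delta> n (stat S n w) = k} \<in> sets (obs_alg S n)"
proof -
  have "\<delta> n \<in> T_space S \<rightarrow>\<^sub>M count_space UNIV"
    using assms by (simp add: optimal_decision_def)
  then have [measurable]: "(\<lambda>w. \<delta> n (stat S n w)) \<in> obs_alg S n \<rightarrow>\<^sub>M count_space UNIV"
    by (rule measurable_compose[OF stat_obs_alg[OF order_refl]])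
  have "{w \<in> space (obs_alg S n). \<delta> n (stat S n w) = k} \<in> sets (obs_alg S n)"
    by measurable
  with assms(3) show ?thesis
    by (auto intro: sets.Int)
qed

lemma decision_cases:
  assumes "optimal_decision S N C \<delta>" "n \<le> N" "t \<in> space (T_space S)" "i \<in> {0, 1}"
  shows "\<delta> n t = i \<or> \<delta> n t = 1 - i"
proof -
  have "\<delta> n t \<le> of_bool (D_cost S C 0 n t \<ge> D_cost S C 1 n t)"
    using assms by (auto simp: optimal_decision_def)
  also have "\<dots> \<le> 1"
    by simp
  finally show ?thesis
    using assms(4) by auto
qed

text \<open>A wrong decision is itself a function of the statistic, so it is its own conditional
  mean and the condition on \<open>incurred\<close> is immediate.\<close>

lemma detection_loss:
  assumes i: "i \<in> {0, 1}" and decision: "optimal_decision S N C \<delta>"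
  shows "loss_recursion S N C i (\<lambda>n w. of_bool (\<delta> n (stat S n w) = 1 - i)) (\<lambda>n t. of_bool (\<delta> n t = 1 - i))
    (detection_error_rec S N C \<delta> i)"
proof -
  interpret Pi: prob_space "Prob_given S i"
    by (rule prob_space_given[OF i])
  have \<delta>: "\<delta> n \<in> T_space S \<rightarrow>\<^sub>M count_space UNIV" if "n \<le> N" for n
    using decision that by (simp add: optimal_decision_def)
  have meas: "(\<lambda>t. of_bool (\<delta> n t = 1 - i) :: real) \<in> borel_measurable (T_space S)" if "n \<le> N" for n
    by (rule measurable_compose[OF \<delta>[OF that]]) simp
  have int: "integrable (Prob_given S i) (\<lambda>w. of_bool (\<delta> n (stat S n w) = 1 - i) :: real)" if "n \<le> N" for n
  proof (rule Pi.integrable_const_bound[of _ 1])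
    show "(\<lambda>w. of_bool (\<delta> n (stat S n w) = 1 - i) :: real) \<in> borel_measurable (Prob_given S i)"
      using measurable_compose[OF stat_measurable meas[OF that]]
      unfolding measurable_cong_sets[OF sets_Prob_given refl] .
  qed simp
  show ?thesis
  proof unfold_locales
    show "detection_error_rec S N C \<delta> i N t = of_bool (\<delta> N t = 1 - i) * stop_rule S N C N t" for t
      by (subst detection_error_rec.simps) simp
    show "detection_error_rec S N C \<delta> i n t = of_bool (\<delta> n t = 1 - i) * stop_rule S N C n t
      + (1 - stop_rule S N C n t) * cexp_given (Prob_given S i) (T_space S) (stat S n)
          (\<lambda>w. detection_error_rec S N C \<delta> i (Suc n) (stat S (Suc n) w)) t" if "n < N" for n t
      using that by (subst detection_error_rec.simps) (simp only: if_True)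
  qed (use i meas int in auto)
qed

text \<open>The decision is determined by the observations, so the event that it equals
  \<open>i\<close> can be intersected with \<open>A\<close>, and \<open>mse_obs\<close> applies to
  the intersection.\<close>

lemma estimation_loss:
  assumes i: "i \<in> {0, 1}" and decision: "optimal_decision S N C \<delta>"
  shows "loss_recursion S N C i
    (\<lambda>n w. of_bool (\<delta> n (stat S n w) = i) * (estimator S i n w - Theta S w)\<^sup>2)
    (\<lambda>n t. mse i n t * of_bool (\<delta> n t = i))
    (estimation_error_rec S N C \<delta> i)"
proof -
  interpret Pi: prob_space "Prob_given S i"
    by (rule prob_space_given[OF i])
  let ?D = "\<lambda>n. {w \<in> space (Prob S). \<delta> n (stat S n w) = i}"
  have D: "?D n \<in> sets (obs_alg S n)" if "n \<le> N" for n
    using decision_obs[OF decision that sets.top] by (simp add: Int_def)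
  have \<delta>: "\<delta> n \<in> T_space S \<rightarrow>\<^sub>M count_space UNIV" if "n \<le> N" for n
    using decision that by (simp add: optimal_decision_def)
  have meas: "(\<lambda>t. mse i n t * of_bool (\<delta> n t = i)) \<in> borel_measurable (T_space S)" if "n \<le> N" for n
  proof -
    have "(\<lambda>t. of_bool (\<delta> n t = i) :: real) \<in> borel_measurable (T_space S)"
      by (rule measurable_compose[OF \<delta>[OF that]]) simp
    then show ?thesis
      by measurable
  qed
  have restrict: "integrable (Prob_given S i) (\<lambda>w. of_bool (\<delta> n (stat S n w) = i) * f w)"
    if n: "n \<le> N" and f: "integrable (Prob_given S i) f" for n and f :: "'w \<Rightarrow> real"
  proof -
    have "integrable (Prob_given S i) (\<lambda>w. indicator (?D n) w *\<^sub>R f w)"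
      using obs_in_Prob[OF D[OF n]] by (intro integrable_mult_indicator f) simp
    then show ?thesis
      by (rule Bochner_Integration.integrable_cong[THEN iffD1, rotated -1]) (auto simp: indicator_def)
  qed
  show ?thesis
  proof unfold_locales
    fix n assume n: "n \<le> N"
    show "AE w in Prob_given S i. 0 \<le> mse i n (stat S n w) * of_bool (\<delta> n (stat S n w) = i)"
      using cond_var_given(4)[OF i, of n] by eventually_elim simp
    show "integrable (Prob_given S i) (\<lambda>w. mse i n (stat S n w) * of_bool (\<delta> n (stat S n w) = i))"
      using restrict[OF n cond_var_given(3)[OF i]] by (simp only: mult.commute)
    show "integrable (Prob_given S i) (\<lambda>w. of_bool (\<delta> n (stat S n w) = i) * (estimator S i n w - Theta S w)\<^sup>2)"
      by (rule restrict[OF n sq_error_integrable[OF i]])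
    fix A assume A: "A \<in> sets (obs_alg S n)"
    have split: "(\<integral>w. indicator A w * (of_bool (\<delta> n (stat S n w) = i) * f w) \<partial>Prob_given S i)
        = (\<integral>w. indicator (A \<inter> ?D n) w * f w \<partial>Prob_given S i)" for f :: "'w \<Rightarrow> real"
      by (rule Bochner_Integration.integral_cong) (auto simp: indicator_def)
    show "(\<integral>w. indicator A w * (of_bool (\<delta> n (stat S n w) = i) * (estimator S i n w - Theta S w)\<^sup>2) \<partial>Prob_given S i)
        = (\<integral>w. indicator A w * (mse i n (stat S n w) * of_bool (\<delta> n (stat S n w) = i)) \<partial>Prob_given S i)"
      unfolding split mult.commute[of "mse i n _"]
      by (rule mse_obs[OF i decision_obs[OF decision n A]])
  next
    show "estimation_error_rec S N C \<delta> i N t = mse i N t * of_bool (\<delta> N t = i) * stop_rule S N C N t" for t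
      by (subst estimation_error_rec.simps) (simp add: Let_def)
    show "estimation_error_rec S N C \<delta> i n t = mse i n t * of_bool (\<delta> n t = i) * stop_rule S N C n t
      + (1 - stop_rule S N C n t) * cexp_given (Prob_given S i) (T_space S) (stat S n)
          (\<lambda>w. estimation_error_rec S N C \<delta> i (Suc n) (stat S (Suc n) w)) t" if "n < N" for n t
      using that by (subst estimation_error_rec.simps) (simp only: if_True Let_def)
  qed (use i meas in auto)
qed

text \<open>For \<open>i\<close> in \<open>{0, 1}\<close> the weight \<open>C i\<close> enters only
  the cost of the wrong decision \<open>1 - i\<close>, with the posterior of \<open>i\<close> as
  slope.\<close>

lemma detection_slope:
  assumes i: "i \<in> {0, 1}" and decision: "optimal_decision S N C \<delta>" and n: "n \<le> N"
  shows "AE w in Prob S. D_slope i (\<delta> n (stat S n w)) n (stat S n w)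
    = posterior S i n (stat S n w) * of_bool (\<delta> n (stat S n w) = 1 - i)"
proof (rule AE_I2)
  fix w assume "w \<in> space (Prob S)"
  from decision_cases[OF decision n measurable_space[OF stat_measurable[of n] this] i]
  show "D_slope i (\<delta> n (stat S n w)) n (stat S n w)
    = posterior S i n (stat S n w) * of_bool (\<delta> n (stat S n w) = 1 - i)"
    using i by (auto simp: D_slope_def)
qed

text \<open>The weight \<open>C (2 + i)\<close> enters only the cost of decision \<open>i\<close>,
  with slope posterior times \<open>cond_var\<close>. Under the hypothesis this variance is
  \<open>mse\<close>; where the two differ the posterior is almost surely 0.\<close>

lemma estimation_slope:
  assumes i: "i \<in> {0, 1}" and decision: "optimal_decision S N C \<delta>" and n: "n \<le> N"
  shows "AE w in Prob S. D_slope (2 + i) (\<delta> n (stat S n w)) n (stat S n w)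
    = posterior S i n (stat S n w) * (mse i n (stat S n w) * of_bool (\<delta> n (stat S n w) = i))"
proof -
  have "{t \<in> space (T_space S). mse i n t = cond_var S i n t} \<in> sets (T_space S)"
    by measurable
  from AE_given_stat[OF i this mse_cond_var[OF i]] AE_space show ?thesis
  proof eventually_elim
    case (elim w)
    from decision_cases[OF decision n measurable_space[OF stat_measurable[of n] elim(2)] i] elim(1)
    show ?case
      using i by (auto simp: D_slope_def)
  qed
qed

end

theorem theorem4p2:
  fixes S :: "('w, 'x, 't) seq_setup" and N :: nat
    and C :: "nat \<Rightarrow> real" and \<delta> :: "nat \<Rightarrow> 't \<Rightarrow> nat"
  assumes model: "seq_model S N"
    and weights: "\<And>i. i \<le> 3 \<Longrightarrow> 0 \<le> C i"
    and stop_boundary_null: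
      "\<And>n. n < N \<Longrightarrow> AE w in Prob S. stat S n w \<notin> stop_boundary S N C n"
    and decision_boundary_null:
      "\<And>n. n \<le> N \<Longrightarrow> AE w in Prob S. stat S n w \<notin> decision_boundary S N C n"
    and decision: "optimal_decision S N C \<delta>"
  shows
    "(\<forall>n\<le>N. \<forall>i\<in>{0, 1}. AE w in Prob S.
        has_cost_derivative S N C i n (stat S n w)
          (prior S i * z_ratio S i n (stat S n w)
             * detection_error_rec S N C \<delta> i n (stat S n w)))
   \<and> (\<forall>n\<le>N. \<forall>i\<in>{2, 3}. AE w in Prob S.
        has_cost_derivative S N C i n (stat S n w)
          (prior S (i - 2) * z_ratio S (i - 2) n (stat S n w)
             * estimation_error_rec S N C \<delta> (i - 2) n (stat S n w)))
   \<and> (\<forall>n\<le>N. \<forall>i\<in>{0, 1}. AE w in Prob S. n \<le> stop_time S N C w \<longrightarrow>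
        has_cost_derivative S N C i n (stat S n w)
          (prior S i * z_ratio S i n (stat S n w)
             * detection_error S N C \<delta> i n (stat S n w)))
   \<and> (\<forall>n\<le>N. \<forall>i\<in>{2, 3}. AE w in Prob S. n \<le> stop_time S N C w \<longrightarrow>
        has_cost_derivative S N C i n (stat S n w)
          (prior S (i - 2) * z_ratio S (i - 2) n (stat S n w)
             * estimation_error S N C \<delta> (i - 2) n (stat S n w)))
   \<and> (\<forall>i\<in>{0, 1}.
        has_cost_derivative S N C i 0 (t_init S)
          (prior S i * detection_error_rec S N C \<delta> i 0 (t_init S)) \<and>
        has_cost_derivative S N C i 0 (t_init S)
          (prior S i * detection_error S N C \<delta> i 0 (t_init S)))
   \<and> (\<forall>i\<in>{2, 3}.
        has_cost_derivative S N C i 0 (t_init S)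
          (prior S (i - 2) * estimation_error_rec S N C \<delta> (i - 2) 0 (t_init S)) \<and>
        has_cost_derivative S N C i 0 (t_init S)
          (prior S (i - 2) * estimation_error S N C \<delta> (i - 2) 0 (t_init S)))"
proof -
  interpret seq_model S N
    by (rule model)
  note optimal = stop_boundary_null decision_boundary_null decision
  have det: "n \<le> N \<Longrightarrow> AE w in Prob S. has_cost_derivative S N C i n (stat S n w)
        (prior S i * z_ratio S i n (stat S n w) * detection_error_rec S N C \<delta> i n (stat S n w))"
    "n \<le> N \<Longrightarrow> AE w in Prob S. n \<le> stop_time S N C w \<longrightarrow> has_cost_derivative S N C i n (stat S n w)
        (prior S i * z_ratio S i n (stat S n w) * detection_error S N C \<delta> i n (stat S n w))"
    "has_cost_derivative S N C i 0 (t_init S) (prior S i * detection_error_rec S N C \<delta> i 0 (t_init S))"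
    "has_cost_derivative S N C i 0 (t_init S) (prior S i * detection_error S N C \<delta> i 0 (t_init S))"
    if i: "i \<in> {0, 1}" for i n
  proof -
    interpret L: loss_recursion S N C i "\<lambda>n w. of_bool (\<delta> n (stat S n w) = 1 - i)"
      "\<lambda>n t. of_bool (\<delta> n t = 1 - i)" "detection_error_rec S N C \<delta> i"
      by (rule detection_loss[OF i decision])
    have eq: "detection_error S N C \<delta> i m
        = cexp_given (Prob_given_running S N C i m) (T_space S) (stat S m) L.total" for m
      unfolding detection_error_def Let_def L.total_def[abs_def] ..
    have i3: "i \<le> 3" using i by auto
    note D = L.cost_derivative[OF weights i3 optimal detection_slope[OF i decision], folded eq]
    show "n \<le> N \<Longrightarrow> AE w in Prob S. has_cost_derivative S N C i n (stat S n w)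
        (prior S i * z_ratio S i n (stat S n w) * detection_error_rec S N C \<delta> i n (stat S n w))"
      by (rule D(1))
    show "n \<le> N \<Longrightarrow> AE w in Prob S. n \<le> stop_time S N C w \<longrightarrow> has_cost_derivative S N C i n (stat S n w)
        (prior S i * z_ratio S i n (stat S n w) * detection_error S N C \<delta> i n (stat S n w))"
      by (rule D(2))
    show "has_cost_derivative S N C i 0 (t_init S) (prior S i * detection_error_rec S N C \<delta> i 0 (t_init S))"
      by (rule D(3))
    show "has_cost_derivative S N C i 0 (t_init S) (prior S i * detection_error S N C \<delta> i 0 (t_init S))"
      by (rule D(4))
  qed
  have est: "n \<le> N \<Longrightarrow> AE w in Prob S. has_cost_derivative S N C j n (stat S n w)
        (prior S (j - 2) * z_ratio S (j - 2) n (stat S n w) * estimation_error_rec S N C \<delta> (j - 2) n (stat S n w))"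
    "n \<le> N \<Longrightarrow> AE w in Prob S. n \<le> stop_time S N C w \<longrightarrow> has_cost_derivative S N C j n (stat S n w)
        (prior S (j - 2) * z_ratio S (j - 2) n (stat S n w) * estimation_error S N C \<delta> (j - 2) n (stat S n w))"
    "has_cost_derivative S N C j 0 (t_init S) (prior S (j - 2) * estimation_error_rec S N C \<delta> (j - 2) 0 (t_init S))"
    "has_cost_derivative S N C j 0 (t_init S) (prior S (j - 2) * estimation_error S N C \<delta> (j - 2) 0 (t_init S))"
    if j: "j \<in> {2, 3}" for j n
  proof -
    define i where "i = j - 2"
    have i: "i \<in> {0, 1}" and ij: "2 + i = j" and j3: "j \<le> 3"
      using j by (auto simp: i_def)
    interpret L: loss_recursion S N C i
      "\<lambda>n w. of_bool (\<delta> n (stat S n w) = i) * (estimator S i n w - Theta S w)\<^sup>2"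
      "\<lambda>n t. mse i n t * of_bool (\<delta> n t = i)" "estimation_error_rec S N C \<delta> i"
      by (rule estimation_loss[OF i decision])
    have eq: "estimation_error S N C \<delta> i m
        = cexp_given (Prob_given_running S N C i m) (T_space S) (stat S m) L.total" for m
      unfolding estimation_error_def Let_def L.total_def[abs_def] ..
    note D = L.cost_derivative[OF weights j3 optimal estimation_slope[OF i decision, unfolded ij], folded eq,
        unfolded i_def]
    show "n \<le> N \<Longrightarrow> AE w in Prob S. has_cost_derivative S N C j n (stat S n w)
        (prior S (j - 2) * z_ratio S (j - 2) n (stat S n w) * estimation_error_rec S N C \<delta> (j - 2) n (stat S n w))"
      by (rule D(1))
    show "n \<le> N \<Longrightarrow> AE w in Prob S. n \<le> stop_time S N C w \<longrightarrow> has_cost_derivative S N C j n (stat S n w)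
        (prior S (j - 2) * z_ratio S (j - 2) n (stat S n w) * estimation_error S N C \<delta> (j - 2) n (stat S n w))"
      by (rule D(2))
    show "has_cost_derivative S N C j 0 (t_init S) (prior S (j - 2) * estimation_error_rec S N C \<delta> (j - 2) 0 (t_init S))"
      by (rule D(3))
    show "has_cost_derivative S N C j 0 (t_init S) (prior S (j - 2) * estimation_error S N C \<delta> (j - 2) 0 (t_init S))"
      by (rule D(4))
  qed
  show ?thesis
    by (intro conjI allI ballI impI det est) assumption+
qed

end
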